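(* The functors $\kappa_P\colon E^{\mathbf 2}\to P\downarrow B$ (for $P\colon E\to B$) are the components of a 2-natural transformation $$\kappa\colon\mathbb S\,\mathrm{Dom}\Longrightarrow\mathrm{Dom}\,\mathbb C.$$ They satisfy the unit and multiplication equations $$\kappa_PI_E=H^P,\qquad \kappa_Pm_E=M^P\,\kappa_{\mathbb CP}\,(\kappa_P)^{\mathbf 2}.$$ Thus $(\mathrm{Dom},\kappa)$ is a colax morphism of 2-monads from $\mathbb C$ to $\mathbb S$. It therefore pulls strict $\mathbb C$-algebras back to strict $\mathbb S$-algebras.
   Context: $\mathbf{CAT}$ is the strict 2-category of locally small categories, functors and natural transformations. $\mathbf{CAT}^{\mathbf 2}$ is the strict arrow 2-category: objects are functors $P\colon E\to B$; a 1-cell $(T,S)\colon P\to Q$, with $Q\colon F\to C$, is a pair of functors with $QT=SP$; a 2-cell $(\beta,\alpha)\colon(T,S)\Rightarrow(T',S')$ is a pair of natural transformations with $Q\beta=\alpha P$. $\mathrm{Dom}\colon\mathbf{CAT}^{\mathbf 2}\to\mathbf{CAT}$ sends $P\colon E\to B$ to $E$, $(T,S)$ to $T$, $(\beta,\alpha)$ to $\beta$. **Comma 2-monad $\mathbb C$ on $\mathbf{CAT}^{\mathbf 2}$.** $P\downarrow B$ has objects $(x,u)$ with $x\in E$, $u\colon Px\to b$; an arrow $(f,v)\colon(x,u)\to(y,w)$ consists of $f\colon x\to y$, $v\colon b\to c$ with $vu=w\,Pf$. $\mathbb CP=\mathrm{Cod}_P\colon P\downarrow B\to B$, $(x,u)\mapsto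 b$, $(f,v)\mapsto v$; $\mathbb C(T,S)=(\overline T,S)$ with $\overline T(x,u)=(Tx,Su)$, $\overline T(f,v)=(Tf,Sv)$; $\mathbb C(\beta,\alpha)=(\overline\beta,\alpha)$ with $\overline\beta_{(x,u)}=(\beta_x,\alpha_b)$; unit $(H^P,1_B)$, $H^Px=(x,1_{Px})$, $H^Pf=(f,Pf)$; multiplication $(M^P,1_B)$ with $M^P\colon\mathbb CP\downarrow B\to P\downarrow B$, $M^P((x,u),v)=(x,vu)$, $M^P((f,r),s)=(f,s)$. **Squaring 2-monad $\mathbb S$ on $\mathbf{CAT}$.** $\mathbb SE=E^{\mathbf 2}$ is the arrow category (arrows $(r,s)\colon f\to g$ are commutative squares $sf=gr$), with $T\mapsto T^{\mathbf 2}$, $\beta\mapsto\beta^{\mathbf 2}$; unit $I_E\colon E\to E^{\mathbf 2}$ sends $x$ to $1_x$ (and $f$ to $(f,f)$); multiplication $m_E\colon(E^{\mathbf 2})^{\mathbf 2}\to E^{\mathbf 2}$ sends a commutative square $(r,s)\colon f\to g$ to its diagonal $sf=gr$, and a morphism of squares to its components at the upper-left (initial) and lower-right (terminal) vertices. **$\kappa_P$.** $\kappa_P(f\colon x\to y)=(x,Pf)$ and $\kappa_P(r,s)=(r,Ps)$ for a commutative square $(r,s)\colon f\to g$. **Colax morphism.** For strict 2-monads $\mathbb T$ on $\mathcal K$, $\mathbb R$ on $\mathcal L$, a colax morphism from $\mathbb T$ to $\mathbb R$ is a strict 2-functor $V\colon\mathcal K\to\mathcal L$ and a 2-natural transformation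 $\lambda\colon\mathbb RV\Rightarrow V\mathbb T$ with $\lambda_X\eta^{\mathbb R}_{VX}=V\eta^{\mathbb T}_X$ and $\lambda_X\mu^{\mathbb R}_{VX}=V\mu^{\mathbb T}_X\,\lambda_{\mathbb TX}\,\mathbb R\lambda_X$ for all $X$. A strict $\mathbb T$-algebra is $a\colon\mathbb TX\to X$ with $a\eta_X=1_X$, $a\mu_X=a\,\mathbb Ta$; the pullback of $a$ along $(V,\lambda)$ is the action $Va\,\lambda_X\colon\mathbb R(VX)\to VX$. *)

theory Defs
  imports Main "HOL-Library.FuncSet" "HOL-Library.Nat_Bijection"
begin

section \<open>A universe of discourse\<close>

text \<open>
  The elements of a type of this class play the role of sets, and subsets of the type that of
  classes. The injective pairing makes the arrow category and the comma category of
  categories over \<open>'u\<close> be again categories over \<open>'u\<close>, so that the squaring and comma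
  constructions are endofunctors. The intended model is a type of all ZFC sets with
  Kuratowski pairs, where a class is small iff it is the extension of a set. Everything below
  is stated over an arbitrary model of these closure properties.
\<close>

class universe =
  fixes upair :: "'a \<Rightarrow> 'a \<Rightarrow> 'a"
    and small :: "'a set \<Rightarrow> bool"
  assumes upair_inject: "upair a b = upair c d \<longleftrightarrow> a = c \<and> b = d"
    and small_subset: "small A \<Longrightarrow> B \<subseteq> A \<Longrightarrow> small B"
    and small_singleton: "small {a}"
    and small_product: "small A \<Longrightarrow> small B \<Longrightarrow> small {upair a b |a b. a \<in> A \<and> b \<in> B}"

text \<open>The axioms are satisfiable, for instance by the following (degenerate) model.\<close>

instantiation nat :: universe
begin

definition upair_nat :: "nat \<Rightarrow> nat \<Rightarrow> nat" where
  "upair_nat a b = prod_encode (a, b)"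

definition small_nat :: "nat set \<Rightarrow> bool" where
  "small_nat A \<longleftrightarrow> finite A"

instance
proof
  fix A B :: "nat set"
  assume A: "small A" "small B"
  have "{upair a b |a b. a \<in> A \<and> b \<in> B} = (\<lambda>(a, b). upair a b) ` (A \<times> B)"
    by auto
  then show "small {upair a b |a b. a \<in> A \<and> b \<in> B}"
    using A by (simp add: small_nat_def)
qed (auto simp: upair_nat_def small_nat_def intro: finite_subset)

end

definition ufst :: "'u::universe \<Rightarrow> 'u" where
  "ufst z = (THE a. \<exists>b. z = upair a b)"

definition usnd :: "'u::universe \<Rightarrow> 'u" where
  "usnd z = (THE b. \<exists>a. z = upair a b)"


section \<open>Categories, functors, natural transformations\<close>

record ('o, 'a) cat =
  Obj :: "'o set"
  Arr :: "'a set"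
  src :: "'a \<Rightarrow> 'o"
  tgt :: "'a \<Rightarrow> 'o"
  idn :: "'o \<Rightarrow> 'a"
  cmp :: "'a \<Rightarrow> 'a \<Rightarrow> 'a"  \<comment> \<open>\<open>cmp C g f\<close> is \<open>g\<close> after \<open>f\<close>\<close>

definition hom :: "('o, 'a) cat \<Rightarrow> 'o \<Rightarrow> 'o \<Rightarrow> 'a set" where
  "hom C x y = {f \<in> Arr C. src C f = x \<and> tgt C f = y}"

locale category =
  fixes C :: "('o, 'a) cat"
  assumes src_closed: "f \<in> Arr C \<Longrightarrow> src C f \<in> Obj C"
    and tgt_closed: "f \<in> Arr C \<Longrightarrow> tgt C f \<in> Obj C"
    and idn_closed: "x \<in> Obj C \<Longrightarrow> idn C x \<in> hom C x x"
    and cmp_closed: "f \<in> hom C x y \<Longrightarrow> g \<in> hom C y z \<Longrightarrow> cmp C g f \<in> hom C x z"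
    and cmp_idn_right: "f \<in> hom C x y \<Longrightarrow> cmp C f (idn C x) = f"
    and cmp_idn_left: "f \<in> hom C x y \<Longrightarrow> cmp C (idn C y) f = f"
    and cmp_assoc: "f \<in> hom C w x \<Longrightarrow> g \<in> hom C x y \<Longrightarrow> h \<in> hom C y z \<Longrightarrow>
      cmp C h (cmp C g f) = cmp C (cmp C h g) f"

text \<open>
  HOL functions are total. The objects of \<open>CAT\<close> below have undefined structure off their
  carriers, so that equality in HOL coincides with equality of categories; likewise for functors
  and natural transformations.
\<close>

definition normalized :: "('o, 'a) cat \<Rightarrow> bool" where
  "normalized C \<longleftrightarrow>
     src C \<in> extensional (Arr C) \<and> tgt C \<in> extensional (Arr C) \<and> idn C \<in> extensional (Obj C) \<and>
     (\<forall>g f. \<not> (f \<in> Arr C \<and> g \<in> Arr C \<and> tgt C f = src C g) \<longrightarrow> cmp C g f = undefined)"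

definition locally_small :: "('o, 'u::universe) cat \<Rightarrow> bool" where
  "locally_small C \<longleftrightarrow> (\<forall>x\<in>Obj C. \<forall>y\<in>Obj C. small (hom C x y))"

type_synonym 'u ucat = "('u, 'u) cat"

record 'u func =
  Fsrc :: "'u ucat"
  Ftgt :: "'u ucat"
  Fo :: "'u \<Rightarrow> 'u"
  Fa :: "'u \<Rightarrow> 'u"

definition is_functor :: "'u func \<Rightarrow> bool" where
  "is_functor F \<longleftrightarrow>
     category (Fsrc F) \<and> category (Ftgt F) \<and>
     (\<forall>x\<in>Obj (Fsrc F). Fo F x \<in> Obj (Ftgt F)) \<and>
     (\<forall>x y. \<forall>f\<in>hom (Fsrc F) x y. Fa F f \<in> hom (Ftgt F) (Fo F x) (Fo F y)) \<and>
     (\<forall>x\<in>Obj (Fsrc F). Fa F (idn (Fsrc F) x) = idn (Ftgt F) (Fo F x)) \<and>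
     (\<forall>x y z. \<forall>f\<in>hom (Fsrc F) x y. \<forall>g\<in>hom (Fsrc F) y z.
        Fa F (cmp (Fsrc F) g f) = cmp (Ftgt F) (Fa F g) (Fa F f)) \<and>
     Fo F \<in> extensional (Obj (Fsrc F)) \<and> Fa F \<in> extensional (Arr (Fsrc F))"

definition fid :: "'u ucat \<Rightarrow> 'u func" where
  "fid C = \<lparr>Fsrc = C, Ftgt = C, Fo = (\<lambda>x\<in>Obj C. x), Fa = (\<lambda>f\<in>Arr C. f)\<rparr>"

definition fcomp :: "'u func \<Rightarrow> 'u func \<Rightarrow> 'u func"  (infixr "\<circ>\<^sub>F" 75) where
  "G \<circ>\<^sub>F F = \<lparr>Fsrc = Fsrc F, Ftgt = Ftgt G,
     Fo = (\<lambda>x\<in>Obj (Fsrc F). Fo G (Fo F x)), Fa = (\<lambda>f\<in>Arr (Fsrc F). Fa G (Fa F f))\<rparr>"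

record 'u nattr =
  Nsrc :: "'u func"
  Ntgt :: "'u func"
  Nc :: "'u \<Rightarrow> 'u"

definition is_nattr :: "'u nattr \<Rightarrow> bool" where
  "is_nattr t \<longleftrightarrow>
     (let F = Nsrc t; G = Ntgt t; C = Fsrc F; D = Ftgt F in
       is_functor F \<and> is_functor G \<and> Fsrc G = C \<and> Ftgt G = D \<and>
       (\<forall>x\<in>Obj C. Nc t x \<in> hom D (Fo F x) (Fo G x)) \<and>
       (\<forall>x y. \<forall>f\<in>hom C x y. cmp D (Nc t y) (Fa F f) = cmp D (Fa G f) (Nc t x)) \<and>
       Nc t \<in> extensional (Obj C))"

definition nid :: "'u func \<Rightarrow> 'u nattr" where
  "nid F = \<lparr>Nsrc = F, Ntgt = F, Nc = (\<lambda>x\<in>Obj (Fsrc F). idn (Ftgt F) (Fo F x))\<rparr>"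

definition nvcomp :: "'u nattr \<Rightarrow> 'u nattr \<Rightarrow> 'u nattr" where
  "nvcomp t s = \<lparr>Nsrc = Nsrc s, Ntgt = Ntgt t,
     Nc = (\<lambda>x\<in>Obj (Fsrc (Nsrc s)). cmp (Ftgt (Nsrc s)) (Nc t x) (Nc s x))\<rparr>"

definition nhcomp :: "'u nattr \<Rightarrow> 'u nattr \<Rightarrow> 'u nattr" where
  "nhcomp t s = \<lparr>Nsrc = Nsrc t \<circ>\<^sub>F Nsrc s, Ntgt = Ntgt t \<circ>\<^sub>F Ntgt s,
     Nc = (\<lambda>x\<in>Obj (Fsrc (Nsrc s)).
       cmp (Ftgt (Nsrc t)) (Nc t (Fo (Ntgt s) x)) (Fa (Nsrc t) (Nc s x)))\<rparr>"


section \<open>Strict 2-categories, 2-functors, 2-natural transformations, 2-monads\<close>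

record ('o, 'm, 'c) twocat =
  C0 :: "'o set"
  C1 :: "'m set"
  C2 :: "'c set"
  src1 :: "'m \<Rightarrow> 'o"
  tgt1 :: "'m \<Rightarrow> 'o"
  src2 :: "'c \<Rightarrow> 'm"
  tgt2 :: "'c \<Rightarrow> 'm"
  id1 :: "'o \<Rightarrow> 'm"
  id2 :: "'m \<Rightarrow> 'c"
  comp1 :: "'m \<Rightarrow> 'm \<Rightarrow> 'm"
  vcomp :: "'c \<Rightarrow> 'c \<Rightarrow> 'c"
  hcomp :: "'c \<Rightarrow> 'c \<Rightarrow> 'c"

text \<open>The underlying category, the 1- and 2-cells under vertical composition, and the 0- and
  2-cells under horizontal composition.\<close>

definition cat01 :: "('o, 'm, 'c) twocat \<Rightarrow> ('o, 'm) cat" where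
  "cat01 K = \<lparr>Obj = C0 K, Arr = C1 K, src = src1 K, tgt = tgt1 K, idn = id1 K, cmp = comp1 K\<rparr>"

definition cat12 :: "('o, 'm, 'c) twocat \<Rightarrow> ('m, 'c) cat" where
  "cat12 K = \<lparr>Obj = C1 K, Arr = C2 K, src = src2 K, tgt = tgt2 K, idn = id2 K, cmp = vcomp K\<rparr>"

definition cat02 :: "('o, 'm, 'c) twocat \<Rightarrow> ('o, 'c) cat" where
  "cat02 K = \<lparr>Obj = C0 K, Arr = C2 K, src = (\<lambda>a. src1 K (src2 K a)), tgt = (\<lambda>a. tgt1 K (src2 K a)),
     idn = (\<lambda>x. id2 K (id1 K x)), cmp = hcomp K\<rparr>"

locale two_category =
  fixes K :: "('o, 'm, 'c) twocat"
  assumes cat01: "category (cat01 K)"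
    and cat12: "category (cat12 K)"
    and cat02: "category (cat02 K)"
    and globular_src: "a \<in> C2 K \<Longrightarrow> src1 K (tgt2 K a) = src1 K (src2 K a)"
    and globular_tgt: "a \<in> C2 K \<Longrightarrow> tgt1 K (tgt2 K a) = tgt1 K (src2 K a)"
    and hcomp_src: "a \<in> C2 K \<Longrightarrow> b \<in> C2 K \<Longrightarrow> tgt1 K (src2 K a) = src1 K (src2 K b) \<Longrightarrow>
      src2 K (hcomp K b a) = comp1 K (src2 K b) (src2 K a)"
    and hcomp_tgt: "a \<in> C2 K \<Longrightarrow> b \<in> C2 K \<Longrightarrow> tgt1 K (src2 K a) = src1 K (src2 K b) \<Longrightarrow>
      tgt2 K (hcomp K b a) = comp1 K (tgt2 K b) (tgt2 K a)"
    and hcomp_id2: "f \<in> C1 K \<Longrightarrow> g \<in> C1 K \<Longrightarrow> tgt1 K f = src1 K g \<Longrightarrow>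
      hcomp K (id2 K g) (id2 K f) = id2 K (comp1 K g f)"
    and interchange: "a \<in> C2 K \<Longrightarrow> a' \<in> C2 K \<Longrightarrow> b \<in> C2 K \<Longrightarrow> b' \<in> C2 K \<Longrightarrow>
      tgt2 K a = src2 K a' \<Longrightarrow> tgt2 K b = src2 K b' \<Longrightarrow>
      tgt1 K (src2 K a) = src1 K (src2 K b) \<Longrightarrow>
      hcomp K (vcomp K b' b) (vcomp K a' a) = vcomp K (hcomp K b' a') (hcomp K b a)"

record ('o, 'm, 'c, 'p, 'n, 'd) twofun =
  on0 :: "'o \<Rightarrow> 'p"
  on1 :: "'m \<Rightarrow> 'n"
  on2 :: "'c \<Rightarrow> 'd"

locale two_functor = K: two_category K + L: two_category L
  for K :: "('o, 'm, 'c) twocat" and L :: "('p, 'n, 'd) twocat" +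
  fixes F :: "('o, 'm, 'c, 'p, 'n, 'd) twofun"
  assumes on0_closed: "x \<in> C0 K \<Longrightarrow> on0 F x \<in> C0 L"
    and on1_closed: "f \<in> C1 K \<Longrightarrow> on1 F f \<in> C1 L"
    and on2_closed: "a \<in> C2 K \<Longrightarrow> on2 F a \<in> C2 L"
    and on1_src: "f \<in> C1 K \<Longrightarrow> src1 L (on1 F f) = on0 F (src1 K f)"
    and on1_tgt: "f \<in> C1 K \<Longrightarrow> tgt1 L (on1 F f) = on0 F (tgt1 K f)"
    and on2_src: "a \<in> C2 K \<Longrightarrow> src2 L (on2 F a) = on1 F (src2 K a)"
    and on2_tgt: "a \<in> C2 K \<Longrightarrow> tgt2 L (on2 F a) = on1 F (tgt2 K a)"
    and on1_id1: "x \<in> C0 K \<Longrightarrow> on1 F (id1 K x) = id1 L (on0 F x)"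
    and on2_id2: "f \<in> C1 K \<Longrightarrow> on2 F (id2 K f) = id2 L (on1 F f)"
    and on1_comp1: "f \<in> C1 K \<Longrightarrow> g \<in> C1 K \<Longrightarrow> tgt1 K f = src1 K g \<Longrightarrow>
      on1 F (comp1 K g f) = comp1 L (on1 F g) (on1 F f)"
    and on2_vcomp: "a \<in> C2 K \<Longrightarrow> b \<in> C2 K \<Longrightarrow> tgt2 K a = src2 K b \<Longrightarrow>
      on2 F (vcomp K b a) = vcomp L (on2 F b) (on2 F a)"
    and on2_hcomp: "a \<in> C2 K \<Longrightarrow> b \<in> C2 K \<Longrightarrow> tgt1 K (src2 K a) = src1 K (src2 K b) \<Longrightarrow>
      on2 F (hcomp K b a) = hcomp L (on2 F b) (on2 F a)"

definition tfid :: "('o, 'm, 'c, 'o, 'm, 'c) twofun" where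
  "tfid = \<lparr>on0 = (\<lambda>x. x), on1 = (\<lambda>f. f), on2 = (\<lambda>a. a)\<rparr>"

definition tfcomp :: "('p, 'n, 'd, 'q, 'k, 'e) twofun \<Rightarrow> ('o, 'm, 'c, 'p, 'n, 'd) twofun \<Rightarrow>
    ('o, 'm, 'c, 'q, 'k, 'e) twofun"  (infixr "\<circ>\<^sub>2" 75) where
  "G \<circ>\<^sub>2 F = \<lparr>on0 = (\<lambda>x. on0 G (on0 F x)), on1 = (\<lambda>f. on1 G (on1 F f)),
     on2 = (\<lambda>a. on2 G (on2 F a))\<rparr>"

locale two_natural = F: two_functor K L F + G: two_functor K L G
  for K :: "('o, 'm, 'c) twocat" and L :: "('p, 'n, 'd) twocat"
    and F G :: "('o, 'm, 'c, 'p, 'n, 'd) twofun" +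
  fixes lam :: "'o \<Rightarrow> 'n"
  assumes component: "x \<in> C0 K \<Longrightarrow>
      lam x \<in> C1 L \<and> src1 L (lam x) = on0 F x \<and> tgt1 L (lam x) = on0 G x"
    and natural1: "f \<in> C1 K \<Longrightarrow>
      comp1 L (lam (tgt1 K f)) (on1 F f) = comp1 L (on1 G f) (lam (src1 K f))"
    and natural2: "a \<in> C2 K \<Longrightarrow>
      hcomp L (id2 L (lam (tgt1 K (src2 K a)))) (on2 F a) =
      hcomp L (on2 G a) (id2 L (lam (src1 K (src2 K a))))"

record ('o, 'm, 'c) twomonad =
  endo :: "('o, 'm, 'c, 'o, 'm, 'c) twofun"
  unit :: "'o \<Rightarrow> 'm"
  mult :: "'o \<Rightarrow> 'm"

locale two_monad = two_category K
  for K :: "('o, 'm, 'c) twocat" +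
  fixes T :: "('o, 'm, 'c) twomonad"
  assumes unit_natural: "two_natural K K tfid (endo T) (unit T)"
    and mult_natural: "two_natural K K (endo T \<circ>\<^sub>2 endo T) (endo T) (mult T)"
    and unit_left: "x \<in> C0 K \<Longrightarrow> comp1 K (mult T x) (unit T (on0 (endo T) x)) = id1 K (on0 (endo T) x)"
    and unit_right: "x \<in> C0 K \<Longrightarrow> comp1 K (mult T x) (on1 (endo T) (unit T x)) = id1 K (on0 (endo T) x)"
    and mult_assoc: "x \<in> C0 K \<Longrightarrow>
      comp1 K (mult T x) (mult T (on0 (endo T) x)) = comp1 K (mult T x) (on1 (endo T) (mult T x))"

locale colax_morphism = T: two_monad K T + R: two_monad L R
  for K :: "('o, 'm, 'c) twocat" and T :: "('o, 'm, 'c) twomonad"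
    and L :: "('p, 'n, 'd) twocat" and R :: "('p, 'n, 'd) twomonad" +
  fixes V :: "('o, 'm, 'c, 'p, 'n, 'd) twofun" and lam :: "'o \<Rightarrow> 'n"
  assumes two_functor: "two_functor K L V"
    and two_natural: "two_natural K L (endo R \<circ>\<^sub>2 V) (V \<circ>\<^sub>2 endo T) lam"
    and unit_eq: "x \<in> C0 K \<Longrightarrow> comp1 L (lam x) (unit R (on0 V x)) = on1 V (unit T x)"
    and mult_eq: "x \<in> C0 K \<Longrightarrow>
      comp1 L (lam x) (mult R (on0 V x)) =
      comp1 L (on1 V (mult T x)) (comp1 L (lam (on0 (endo T) x)) (on1 (endo R) (lam x)))"

locale strict_algebra = two_monad K T
  for K :: "('o, 'm, 'c) twocat" and T :: "('o, 'm, 'c) twomonad" +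
  fixes X :: 'o and a :: 'm
  assumes carrier: "X \<in> C0 K"
    and action: "a \<in> C1 K" "src1 K a = on0 (endo T) X" "tgt1 K a = X"
    and action_unit: "comp1 K a (unit T X) = id1 K X"
    and action_mult: "comp1 K a (mult T X) = comp1 K a (on1 (endo T) a)"

definition pullback_action ::
    "('p, 'n, 'd) twocat \<Rightarrow> ('o, 'm, 'c, 'p, 'n, 'd) twofun \<Rightarrow> ('o \<Rightarrow> 'n) \<Rightarrow> 'o \<Rightarrow> 'm \<Rightarrow> 'n" where
  "pullback_action L V lam X a = comp1 L (on1 V a) (lam X)"


section \<open>The arrow 2-category\<close>

record 'm sq1 =
  dom1 :: 'm
  cod1 :: 'm
  top1 :: 'm
  bot1 :: 'm

record ('m, 'c) sq2 =
  dom2 :: "'m sq1"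
  cod2 :: "'m sq1"
  top2 :: 'c
  bot2 :: 'c

definition arrow_cells1 :: "('o, 'm, 'c) twocat \<Rightarrow> 'm sq1 set" where
  "arrow_cells1 K = {s. dom1 s \<in> C1 K \<and> cod1 s \<in> C1 K \<and> top1 s \<in> C1 K \<and> bot1 s \<in> C1 K \<and>
     src1 K (top1 s) = src1 K (dom1 s) \<and> tgt1 K (top1 s) = src1 K (cod1 s) \<and>
     src1 K (bot1 s) = tgt1 K (dom1 s) \<and> tgt1 K (bot1 s) = tgt1 K (cod1 s) \<and>
     comp1 K (cod1 s) (top1 s) = comp1 K (bot1 s) (dom1 s)}"

definition arrow_cells2 :: "('o, 'm, 'c) twocat \<Rightarrow> ('m, 'c) sq2 set" where
  "arrow_cells2 K = {c. dom2 c \<in> arrow_cells1 K \<and> cod2 c \<in> arrow_cells1 K \<and>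
     dom1 (cod2 c) = dom1 (dom2 c) \<and> cod1 (cod2 c) = cod1 (dom2 c) \<and>
     top2 c \<in> C2 K \<and> src2 K (top2 c) = top1 (dom2 c) \<and> tgt2 K (top2 c) = top1 (cod2 c) \<and>
     bot2 c \<in> C2 K \<and> src2 K (bot2 c) = bot1 (dom2 c) \<and> tgt2 K (bot2 c) = bot1 (cod2 c) \<and>
     hcomp K (id2 K (cod1 (dom2 c))) (top2 c) = hcomp K (bot2 c) (id2 K (dom1 (dom2 c)))}"

definition arrow_comp1 :: "('o, 'm, 'c) twocat \<Rightarrow> 'm sq1 \<Rightarrow> 'm sq1 \<Rightarrow> 'm sq1" where
  "arrow_comp1 K t s = \<lparr>dom1 = dom1 s, cod1 = cod1 t,
     top1 = comp1 K (top1 t) (top1 s), bot1 = comp1 K (bot1 t) (bot1 s)\<rparr>"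

definition arrow_2cat :: "('o, 'm, 'c) twocat \<Rightarrow> ('m, 'm sq1, ('m, 'c) sq2) twocat" where
  "arrow_2cat K = \<lparr>
     C0 = C1 K, C1 = arrow_cells1 K, C2 = arrow_cells2 K,
     src1 = dom1, tgt1 = cod1, src2 = dom2, tgt2 = cod2,
     id1 = (\<lambda>P. \<lparr>dom1 = P, cod1 = P, top1 = id1 K (src1 K P), bot1 = id1 K (tgt1 K P)\<rparr>),
     id2 = (\<lambda>s. \<lparr>dom2 = s, cod2 = s, top2 = id2 K (top1 s), bot2 = id2 K (bot1 s)\<rparr>),
     comp1 = arrow_comp1 K,
     vcomp = (\<lambda>d c. \<lparr>dom2 = dom2 c, cod2 = cod2 d,
       top2 = vcomp K (top2 d) (top2 c), bot2 = vcomp K (bot2 d) (bot2 c)\<rparr>),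
     hcomp = (\<lambda>d c. \<lparr>dom2 = arrow_comp1 K (dom2 d) (dom2 c), cod2 = arrow_comp1 K (cod2 d) (cod2 c),
       top2 = hcomp K (top2 d) (top2 c), bot2 = hcomp K (bot2 d) (bot2 c)\<rparr>)\<rparr>"

definition dom_2functor ::
    "('o, 'm, 'c) twocat \<Rightarrow> ('m, 'm sq1, ('m, 'c) sq2, 'o, 'm, 'c) twofun" where
  "dom_2functor K = \<lparr>on0 = src1 K, on1 = top1, on2 = top2\<rparr>"


section \<open>The 2-categories \<open>CAT\<close> and \<open>CAT\<^sup>2\<close>\<close>

type_synonym 'u functor_square = "'u func sq1"
type_synonym 'u nattr_square = "('u func, 'u nattr) sq2"

definition CAT :: "('u::universe ucat, 'u func, 'u nattr) twocat" where
  "CAT = (let cats = {C. category C \<and> normalized C \<and> locally_small C} in \<lparr>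
     C0 = cats,
     C1 = {F. is_functor F \<and> Fsrc F \<in> cats \<and> Ftgt F \<in> cats},
     C2 = {t. is_nattr t \<and> Fsrc (Nsrc t) \<in> cats \<and> Ftgt (Nsrc t) \<in> cats},
     src1 = Fsrc, tgt1 = Ftgt, src2 = Nsrc, tgt2 = Ntgt,
     id1 = fid, id2 = nid, comp1 = fcomp, vcomp = nvcomp, hcomp = nhcomp\<rparr>)"

definition CAT2 :: "('u::universe func, 'u functor_square, 'u nattr_square) twocat" where
  "CAT2 = arrow_2cat CAT"

definition Dom :: "('u::universe func, 'u functor_square, 'u nattr_square,
    'u ucat, 'u func, 'u nattr) twofun" where
  "Dom = dom_2functor CAT"


section \<open>Categories whose arrows are pairs of arrows\<close>

text \<open>
  An arrow \<open>(f, g): X \<rightarrow> Y\<close> of an arrow category or of a comma category is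
  coded as \<open>upair (upair X Y) (upair f g)\<close>: the pair \<open>(f, g)\<close> does not determine its source and
  target.
\<close>

definition parr :: "'u::universe \<Rightarrow> 'u \<Rightarrow> 'u \<Rightarrow> 'u \<Rightarrow> 'u" where
  "parr X Y f g = upair (upair X Y) (upair f g)"

definition psrc :: "'u::universe \<Rightarrow> 'u" where "psrc a = ufst (ufst a)"
definition ptgt :: "'u::universe \<Rightarrow> 'u" where "ptgt a = usnd (ufst a)"
definition pfst :: "'u::universe \<Rightarrow> 'u" where "pfst a = ufst (usnd a)"
definition psnd :: "'u::universe \<Rightarrow> 'u" where "psnd a = usnd (usnd a)"

text \<open>
  \<open>pair_cat C D p q Os As\<close> has objects \<open>Os\<close> and arrows \<open>As\<close> with componentwise identities and
  composition. The first component of an arrow \<open>X \<rightarrow> Y\<close> is an arrow \<open>p X \<rightarrow> p Y\<close> of \<open>C\<close>, the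
  second is an arrow \<open>q X \<rightarrow> q Y\<close> of \<open>D\<close>.
\<close>

definition pair_cat :: "'u::universe ucat \<Rightarrow> 'u ucat \<Rightarrow> ('u \<Rightarrow> 'u) \<Rightarrow> ('u \<Rightarrow> 'u) \<Rightarrow>
    'u set \<Rightarrow> 'u set \<Rightarrow> 'u ucat" where
  "pair_cat C D p q Os As = \<lparr>
     Obj = Os, Arr = As, src = (\<lambda>a\<in>As. psrc a), tgt = (\<lambda>a\<in>As. ptgt a),
     idn = (\<lambda>X\<in>Os. parr X X (idn C (p X)) (idn D (q X))),
     cmp = (\<lambda>b a. if a \<in> As \<and> b \<in> As \<and> ptgt a = psrc b
       then parr (psrc a) (ptgt b) (cmp C (pfst b) (pfst a)) (cmp D (psnd b) (psnd a))
       else undefined)\<rparr>"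


section \<open>The squaring 2-monad\<close>

definition arrow_cat :: "'u::universe ucat \<Rightarrow> 'u ucat" where
  "arrow_cat E = pair_cat E E (src E) (tgt E) (Arr E)
     {parr f g r s |f g r s. f \<in> Arr E \<and> g \<in> Arr E \<and>
        r \<in> hom E (src E f) (src E g) \<and> s \<in> hom E (tgt E f) (tgt E g) \<and>
        cmp E s f = cmp E g r}"

definition arrow_fun :: "'u::universe func \<Rightarrow> 'u func" where
  "arrow_fun T = \<lparr>Fsrc = arrow_cat (Fsrc T), Ftgt = arrow_cat (Ftgt T),
     Fo = (\<lambda>f\<in>Arr (Fsrc T). Fa T f),
     Fa = (\<lambda>a\<in>Arr (arrow_cat (Fsrc T)).
       parr (Fa T (psrc a)) (Fa T (ptgt a)) (Fa T (pfst a)) (Fa T (psnd a)))\<rparr>"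

definition arrow_nattr :: "'u::universe nattr \<Rightarrow> 'u nattr" where
  "arrow_nattr b = \<lparr>Nsrc = arrow_fun (Nsrc b), Ntgt = arrow_fun (Ntgt b),
     Nc = (let E = Fsrc (Nsrc b) in
       (\<lambda>f\<in>Arr E. parr (Fa (Nsrc b) f) (Fa (Ntgt b) f) (Nc b (src E f)) (Nc b (tgt E f))))\<rparr>"

definition I_fun :: "'u::universe ucat \<Rightarrow> 'u func" where
  "I_fun E = \<lparr>Fsrc = E, Ftgt = arrow_cat E,
     Fo = (\<lambda>x\<in>Obj E. idn E x),
     Fa = (\<lambda>f\<in>Arr E. parr (idn E (src E f)) (idn E (tgt E f)) f f)\<rparr>"

text \<open>An object of \<open>arrow_cat (arrow_cat E)\<close> is a coded square \<open>z = parr f g r s\<close>, with diagonal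
  \<open>s f\<close>. An arrow of it has as components two coded squares, the first between the sources \<open>f\<close>
  and the second between the targets \<open>g\<close>; hence the initial and terminal vertex components.\<close>

definition m_obj :: "'u::universe ucat \<Rightarrow> 'u \<Rightarrow> 'u" where
  "m_obj E z = cmp E (psnd z) (psrc z)"

definition m_fun :: "'u::universe ucat \<Rightarrow> 'u func" where
  "m_fun E = \<lparr>Fsrc = arrow_cat (arrow_cat E), Ftgt = arrow_cat E,
     Fo = (\<lambda>z\<in>Arr (arrow_cat E). m_obj E z),
     Fa = (\<lambda>a\<in>Arr (arrow_cat (arrow_cat E)).
       parr (m_obj E (psrc a)) (m_obj E (ptgt a)) (pfst (pfst a)) (psnd (psnd a)))\<rparr>"

definition Squaring :: "('u::universe ucat, 'u func, 'u nattr) twomonad" where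
  "Squaring = \<lparr>endo = \<lparr>on0 = arrow_cat, on1 = arrow_fun, on2 = arrow_nattr\<rparr>,
     unit = I_fun, mult = m_fun\<rparr>"


section \<open>The comma 2-monad\<close>

text \<open>An object \<open>(x, u)\<close> is coded as \<open>upair x u\<close>; the target \<open>b\<close> of \<open>u\<close> is determined by \<open>u\<close>.\<close>

definition comma_obj :: "'u::universe func \<Rightarrow> 'u set" where
  "comma_obj P = {upair x u |x u. x \<in> Obj (Fsrc P) \<and> u \<in> Arr (Ftgt P) \<and> src (Ftgt P) u = Fo P x}"

definition comma :: "'u::universe func \<Rightarrow> 'u ucat" where
  "comma P = (let E = Fsrc P; B = Ftgt P in
     pair_cat E B ufst (\<lambda>X. tgt B (usnd X)) (comma_obj P)
       {parr (upair x u) (upair y w) f v |x u y w f v.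
          upair x u \<in> comma_obj P \<and> upair y w \<in> comma_obj P \<and>
          f \<in> hom E x y \<and> v \<in> hom B (tgt B u) (tgt B w) \<and> cmp B v u = cmp B w (Fa P f)})"

definition Cod_fun :: "'u::universe func \<Rightarrow> 'u func" where
  "Cod_fun P = \<lparr>Fsrc = comma P, Ftgt = Ftgt P,
     Fo = (\<lambda>X\<in>Obj (comma P). tgt (Ftgt P) (usnd X)),
     Fa = (\<lambda>a\<in>Arr (comma P). psnd a)\<rparr>"

definition bar_obj :: "'u::universe functor_square \<Rightarrow> 'u \<Rightarrow> 'u" where
  "bar_obj s X = upair (Fo (top1 s) (ufst X)) (Fa (bot1 s) (usnd X))"

definition bar_fun :: "'u::universe functor_square \<Rightarrow> 'u func" where
  "bar_fun s = \<lparr>Fsrc = comma (dom1 s), Ftgt = comma (cod1 s),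
     Fo = (\<lambda>X\<in>Obj (comma (dom1 s)). bar_obj s X),
     Fa = (\<lambda>a\<in>Arr (comma (dom1 s)).
       parr (bar_obj s (psrc a)) (bar_obj s (ptgt a)) (Fa (top1 s) (pfst a)) (Fa (bot1 s) (psnd a)))\<rparr>"

definition comma_fun :: "'u::universe functor_square \<Rightarrow> 'u functor_square" where
  "comma_fun s = \<lparr>dom1 = Cod_fun (dom1 s), cod1 = Cod_fun (cod1 s), top1 = bar_fun s, bot1 = bot1 s\<rparr>"

definition bar_nattr :: "'u::universe nattr_square \<Rightarrow> 'u nattr" where
  "bar_nattr c = \<lparr>Nsrc = bar_fun (dom2 c), Ntgt = bar_fun (cod2 c),
     Nc = (let P = dom1 (dom2 c) in
       (\<lambda>X\<in>Obj (comma P). parr (bar_obj (dom2 c) X) (bar_obj (cod2 c) X)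
         (Nc (top2 c) (ufst X)) (Nc (bot2 c) (tgt (Ftgt P) (usnd X)))))\<rparr>"

definition comma_nattr :: "'u::universe nattr_square \<Rightarrow> 'u nattr_square" where
  "comma_nattr c = \<lparr>dom2 = comma_fun (dom2 c), cod2 = comma_fun (cod2 c),
     top2 = bar_nattr c, bot2 = bot2 c\<rparr>"

definition H_obj :: "'u::universe func \<Rightarrow> 'u \<Rightarrow> 'u" where
  "H_obj P x = upair x (idn (Ftgt P) (Fo P x))"

definition H_fun :: "'u::universe func \<Rightarrow> 'u func" where
  "H_fun P = (let E = Fsrc P in \<lparr>Fsrc = E, Ftgt = comma P,
     Fo = (\<lambda>x\<in>Obj E. H_obj P x),
     Fa = (\<lambda>f\<in>Arr E. parr (H_obj P (src E f)) (H_obj P (tgt E f)) f (Fa P f))\<rparr>)"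

definition M_obj :: "'u::universe func \<Rightarrow> 'u \<Rightarrow> 'u" where
  "M_obj P Z = upair (ufst (ufst Z)) (cmp (Ftgt P) (usnd Z) (usnd (ufst Z)))"

definition M_fun :: "'u::universe func \<Rightarrow> 'u func" where
  "M_fun P = \<lparr>Fsrc = comma (Cod_fun P), Ftgt = comma P,
     Fo = (\<lambda>Z\<in>Obj (comma (Cod_fun P)). M_obj P Z),
     Fa = (\<lambda>a\<in>Arr (comma (Cod_fun P)).
       parr (M_obj P (psrc a)) (M_obj P (ptgt a)) (pfst (pfst a)) (psnd a))\<rparr>"

definition Comma :: "('u::universe func, 'u functor_square, 'u nattr_square) twomonad" where
  "Comma = \<lparr>endo = \<lparr>on0 = Cod_fun, on1 = comma_fun, on2 = comma_nattr\<rparr>,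
     unit = (\<lambda>P. \<lparr>dom1 = P, cod1 = Cod_fun P, top1 = H_fun P, bot1 = fid (Ftgt P)\<rparr>),
     mult = (\<lambda>P. \<lparr>dom1 = Cod_fun (Cod_fun P), cod1 = Cod_fun P, top1 = M_fun P, bot1 = fid (Ftgt P)\<rparr>)\<rparr>"


section \<open>The comparison functors\<close>

definition kappa_obj :: "'u::universe func \<Rightarrow> 'u \<Rightarrow> 'u" where
  "kappa_obj P f = upair (src (Fsrc P) f) (Fa P f)"

definition kappa :: "'u::universe func \<Rightarrow> 'u func" where
  "kappa P = (let E = Fsrc P in \<lparr>Fsrc = arrow_cat E, Ftgt = comma P,
     Fo = (\<lambda>f\<in>Arr E. kappa_obj P f),
     Fa = (\<lambda>a\<in>Arr (arrow_cat E).
       parr (kappa_obj P (psrc a)) (kappa_obj P (ptgt a)) (pfst a) (Fa P (psnd a)))\<rparr>)"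

end

theory Submission
  imports Defs
begin

text \<open>
  All cells involved are determined by their components, so every equation between functors or
  natural transformations reduces to one between arrows of a category. Arrow categories and
  comma categories are both categories of pairs of arrows subject to a compatibility relation
  \<open>R\<close> that is stable under composition, and a functor into such a category is a pair of functorial
  assignments satisfying \<open>R\<close>. A 2-natural transformation into an arrow 2-category is a pair of
  2-natural transformations into the underlying 2-category; since the unit and the multiplication
  of the comma 2-monad are identities on codomains, only their domain components need work.
  Algebras are pulled back along any colax morphism: naturality of \<open>\<lambda>\<close> at the action \<open>a\<close>, together
  with the unit and multiplication equations, turns the axioms of \<open>a\<close> into those of \<open>V a \<lambda>\<close>.
\<close>

text \<open>The obstacle is partiality. The structure of the constructed categories is restricted to
  carriers, so its rewrite rules fire only once membership of the arguments is known. Most proofs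
  therefore first establish, from functoriality, that the values to be composed or decoded are
  arrows of the right category, and only then compute. The same restriction makes componentwise
  reasoning legitimate: functors or transformations that agree on the carrier also agree off it.

  Coding an arrow together with its endpoints has a further effect. An equation of coded arrows
  contains the equations of their endpoints, which are objects computed by the object parts of the
  same functors. Hence the object part of an identity of functors is often proved first and then
  rewrites the endpoints in the arrow part; evaluation rules are deleted where they would unfold
  these objects too early.

  The mathematical input for \<open>kappa\<close> is small: the unit equation is
  \<open>P 1 = 1\<close>, the multiplication equation is \<open>P (s f) = (P s) (P f)\<close>, and
  2-naturality is \<open>Q T = S P\<close> and \<open>Q beta = alpha P\<close>.\<close>

lemma ufst_upair [simp]: "ufst (upair a b) = a"
  by (auto simp: ufst_def upair_inject)

lemma usnd_upair [simp]: "usnd (upair a b) = b"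
  by (auto simp: usnd_def upair_inject)

lemma parr_simps [simp]:
  "psrc (parr X Y f g) = X" "ptgt (parr X Y f g) = Y"
  "pfst (parr X Y f g) = f" "psnd (parr X Y f g) = g"
  by (simp_all add: parr_def psrc_def ptgt_def pfst_def psnd_def)

lemma parr_inject [simp]:
  "parr X Y f g = parr X' Y' f' g' \<longleftrightarrow> X = X' \<and> Y = Y' \<and> f = f' \<and> g = g'"
  by (auto simp: parr_def upair_inject)


section \<open>Categories, functors and natural transformations\<close>

lemma in_hom_iff: "f \<in> hom C x y \<longleftrightarrow> f \<in> Arr C \<and> src C f = x \<and> tgt C f = y"
  by (simp add: hom_def)

context category
begin

lemma idn_simps [simp]:
  assumes "x \<in> Obj C"
  shows "idn C x \<in> Arr C" "src C (idn C x) = x" "tgt C (idn C x) = x"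
  using idn_closed[OF assms] by (auto simp: in_hom_iff)

lemma obj_simps [simp]:
  assumes "f \<in> Arr C"
  shows "src C f \<in> Obj C" "tgt C f \<in> Obj C"
  using assms src_closed tgt_closed by auto

lemma cmp_simps [simp]:
  assumes "f \<in> Arr C" "g \<in> Arr C" "src C g = tgt C f"
  shows "cmp C g f \<in> Arr C" "src C (cmp C g f) = src C f" "tgt C (cmp C g f) = tgt C g"
  using cmp_closed[of f "src C f" "tgt C f" g "tgt C g"] assms by (auto simp: in_hom_iff)

lemma cmp_idn [simp]:
  assumes "f \<in> Arr C"
  shows "src C f = x \<Longrightarrow> cmp C f (idn C x) = f" "tgt C f = y \<Longrightarrow> cmp C (idn C y) f = f"
  using cmp_idn_right[of f "src C f" "tgt C f"] cmp_idn_left[of f "src C f" "tgt C f"] assms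
  by (auto simp: in_hom_iff)

lemma assoc:
  assumes "f \<in> Arr C" "g \<in> Arr C" "h \<in> Arr C" "src C g = tgt C f" "src C h = tgt C g"
  shows "cmp C (cmp C h g) f = cmp C h (cmp C g f)"
  using cmp_assoc[of f "src C f" "tgt C f" g "tgt C g" h "tgt C h"] assms
  by (auto simp: in_hom_iff)

end

text \<open>\<open>hom\<close> is replaced by separate conditions on \<open>src\<close> and
  \<open>tgt\<close>, the form in which the simplifier decides composability. The orientation
  \<open>src C g = tgt C f\<close> is shared with the rewrite rules for \<open>cmp\<close>.\<close>

lemma categoryI:
  assumes "\<And>f. f \<in> Arr C \<Longrightarrow> src C f \<in> Obj C" "\<And>f. f \<in> Arr C \<Longrightarrow> tgt C f \<in> Obj C"
    and "\<And>x. x \<in> Obj C \<Longrightarrow> idn C x \<in> Arr C"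
    and "\<And>x. x \<in> Obj C \<Longrightarrow> src C (idn C x) = x" "\<And>x. x \<in> Obj C \<Longrightarrow> tgt C (idn C x) = x"
    and "\<And>f g. f \<in> Arr C \<Longrightarrow> g \<in> Arr C \<Longrightarrow> src C g = tgt C f \<Longrightarrow> cmp C g f \<in> Arr C"
    and "\<And>f g. f \<in> Arr C \<Longrightarrow> g \<in> Arr C \<Longrightarrow> src C g = tgt C f \<Longrightarrow> src C (cmp C g f) = src C f"
    and "\<And>f g. f \<in> Arr C \<Longrightarrow> g \<in> Arr C \<Longrightarrow> src C g = tgt C f \<Longrightarrow> tgt C (cmp C g f) = tgt C g"
    and "\<And>f. f \<in> Arr C \<Longrightarrow> cmp C f (idn C (src C f)) = f"
    and "\<And>f. f \<in> Arr C \<Longrightarrow> cmp C (idn C (tgt C f)) f = f"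
    and "\<And>f g h. f \<in> Arr C \<Longrightarrow> g \<in> Arr C \<Longrightarrow> h \<in> Arr C \<Longrightarrow> src C g = tgt C f \<Longrightarrow>
      src C h = tgt C g \<Longrightarrow> cmp C h (cmp C g f) = cmp C (cmp C h g) f"
  shows "category C"
  by unfold_locales (use assms in \<open>auto simp: in_hom_iff\<close>)

section \<open>Functors and their composition\<close>

lemma is_functorI:
  assumes "category (Fsrc F)" "category (Ftgt F)"
    and "\<And>x. x \<in> Obj (Fsrc F) \<Longrightarrow> Fo F x \<in> Obj (Ftgt F)"
    and "\<And>f. f \<in> Arr (Fsrc F) \<Longrightarrow> Fa F f \<in> Arr (Ftgt F)"
    and "\<And>f. f \<in> Arr (Fsrc F) \<Longrightarrow> src (Ftgt F) (Fa F f) = Fo F (src (Fsrc F) f)"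
    and "\<And>f. f \<in> Arr (Fsrc F) \<Longrightarrow> tgt (Ftgt F) (Fa F f) = Fo F (tgt (Fsrc F) f)"
    and "\<And>x. x \<in> Obj (Fsrc F) \<Longrightarrow> Fa F (idn (Fsrc F) x) = idn (Ftgt F) (Fo F x)"
    and "\<And>f g. f \<in> Arr (Fsrc F) \<Longrightarrow> g \<in> Arr (Fsrc F) \<Longrightarrow> src (Fsrc F) g = tgt (Fsrc F) f \<Longrightarrow>
      Fa F (cmp (Fsrc F) g f) = cmp (Ftgt F) (Fa F g) (Fa F f)"
    and "Fo F \<in> extensional (Obj (Fsrc F))" "Fa F \<in> extensional (Arr (Fsrc F))"
  shows "is_functor F"
  unfolding is_functor_def hom_def using assms by (intro conjI allI ballI impI; clarsimp)

lemma functor_category: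
  assumes "is_functor F"
  shows "category (Fsrc F)" "category (Ftgt F)"
  using assms unfolding is_functor_def by blast+

text \<open>The source and target categories occur as separate variables in the next lemmas so that they
  remain applicable as rewrite rules after \<open>Fsrc F\<close> and \<open>Ftgt F\<close> have been rewritten.\<close>

lemma functor_obj [simp]:
  assumes "is_functor F" "Ftgt F = D" "x \<in> Obj (Fsrc F)"
  shows "Fo F x \<in> Obj D"
  using assms unfolding is_functor_def by blast+

lemma functor_arr [simp]:
  assumes "is_functor F" "Ftgt F = D" "f \<in> Arr (Fsrc F)"
  shows "Fa F f \<in> Arr D" "src D (Fa F f) = Fo F (src (Fsrc F) f)"
    "tgt D (Fa F f) = Fo F (tgt (Fsrc F) f)"
  using assms unfolding is_functor_def hom_def by blast+

lemma functor_idn [simp]: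
  assumes "is_functor F" "Fsrc F = C" "x \<in> Obj C"
  shows "Fa F (idn C x) = idn (Ftgt F) (Fo F x)"
  using assms unfolding is_functor_def by blast+

lemma functor_cmp [simp]:
  assumes "is_functor F" "Fsrc F = C" "f \<in> Arr C" "g \<in> Arr C" "src C g = tgt C f"
  shows "Fa F (cmp C g f) = cmp (Ftgt F) (Fa F g) (Fa F f)"
  using assms unfolding is_functor_def hom_def by blast

lemma functor_extensional:
  assumes "is_functor F"
  shows "Fo F \<in> extensional (Obj (Fsrc F))" "Fa F \<in> extensional (Arr (Fsrc F))"
  using assms unfolding is_functor_def by blast+

text \<open>Outside the carriers both functors take the value \<open>undefined\<close>, so agreement
  on objects and arrows already gives equality of the HOL functions, and hence of the
  records.\<close>

lemma func_eqI:
  assumes "is_functor F" "is_functor G" "Fsrc F = Fsrc G" "Ftgt F = Ftgt G"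
    and "\<And>x. x \<in> Obj (Fsrc F) \<Longrightarrow> Fo F x = Fo G x"
    and "\<And>f. f \<in> Arr (Fsrc F) \<Longrightarrow> Fa F f = Fa G f"
  shows "F = (G :: 'u func)"
proof -
  have "Fo F = Fo G" "Fa F = Fa G"
    using assms functor_extensional[OF assms(1)] functor_extensional[OF assms(2)]
    by (auto intro: extensionalityI)
  then show ?thesis using assms by simp
qed

lemma fid_simps [simp]:
  "Fsrc (fid C) = C" "Ftgt (fid C) = C"
  "x \<in> Obj C \<Longrightarrow> Fo (fid C) x = x" "f \<in> Arr C \<Longrightarrow> Fa (fid C) f = f"
  by (simp_all add: fid_def)

lemma fcomp_simps [simp]:
  "Fsrc (G \<circ>\<^sub>F F) = Fsrc F" "Ftgt (G \<circ>\<^sub>F F) = Ftgt G"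
  "x \<in> Obj (Fsrc F) \<Longrightarrow> Fo (G \<circ>\<^sub>F F) x = Fo G (Fo F x)"
  "f \<in> Arr (Fsrc F) \<Longrightarrow> Fa (G \<circ>\<^sub>F F) f = Fa G (Fa F f)"
  by (simp_all add: fcomp_def)

lemma fcomp_ext: "Fo (G \<circ>\<^sub>F F) \<in> extensional (Obj (Fsrc F))"
  "Fa (G \<circ>\<^sub>F F) \<in> extensional (Arr (Fsrc F))"
  by (simp_all add: fcomp_def)

lemma fid_functor [simp]: "category C \<Longrightarrow> is_functor (fid C)"
  by (rule is_functorI) (auto simp: category.obj_simps category.idn_simps category.cmp_simps, auto simp: fid_def)

lemma fcomp_functor [simp]:
  assumes F: "is_functor F" and G: "is_functor G" and FG: "Fsrc G = Ftgt F"
  shows "is_functor (G \<circ>\<^sub>F F)"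
proof -
  interpret A: category "Fsrc F" using functor_category[OF F] by simp
  interpret B: category "Ftgt F" using functor_category[OF F] by simp
  interpret C: category "Ftgt G" using functor_category[OF G] by simp
  show ?thesis
    by (rule is_functorI)
      (use F G FG A.category_axioms C.category_axioms in \<open>simp_all add: fcomp_ext\<close>)
qed

lemma fcomp_fid [simp]:
  assumes "is_functor F"
  shows "Fsrc F = C \<Longrightarrow> F \<circ>\<^sub>F fid C = F" "Ftgt F = D \<Longrightarrow> fid D \<circ>\<^sub>F F = F"
  using assms functor_category[OF assms] by (auto intro!: func_eqI simp: category.obj_simps)

lemma fcomp_assoc:
  assumes "is_functor F" "is_functor G" "is_functor H" "Fsrc G = Ftgt F" "Fsrc H = Ftgt G"
  shows "(H \<circ>\<^sub>F G) \<circ>\<^sub>F F = H \<circ>\<^sub>F (G \<circ>\<^sub>F F)"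
  by (rule func_eqI) (use assms in simp_all)

section \<open>Natural transformations, their two compositions, and whiskering\<close>

lemma is_nattrI:
  assumes "is_functor (Nsrc t)" "is_functor (Ntgt t)"
    and "Fsrc (Ntgt t) = Fsrc (Nsrc t)" "Ftgt (Ntgt t) = Ftgt (Nsrc t)"
    and "\<And>x. x \<in> Obj (Fsrc (Nsrc t)) \<Longrightarrow> Nc t x \<in> Arr (Ftgt (Nsrc t))"
    and "\<And>x. x \<in> Obj (Fsrc (Nsrc t)) \<Longrightarrow> src (Ftgt (Nsrc t)) (Nc t x) = Fo (Nsrc t) x"
    and "\<And>x. x \<in> Obj (Fsrc (Nsrc t)) \<Longrightarrow> tgt (Ftgt (Nsrc t)) (Nc t x) = Fo (Ntgt t) x"
    and "\<And>f. f \<in> Arr (Fsrc (Nsrc t)) \<Longrightarrow>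
      cmp (Ftgt (Nsrc t)) (Nc t (tgt (Fsrc (Nsrc t)) f)) (Fa (Nsrc t) f) =
      cmp (Ftgt (Nsrc t)) (Fa (Ntgt t) f) (Nc t (src (Fsrc (Nsrc t)) f))"
    and "Nc t \<in> extensional (Obj (Fsrc (Nsrc t)))"
  shows "is_nattr t"
  unfolding is_nattr_def Let_def hom_def using assms by (intro conjI allI ballI impI; clarsimp)

lemma nattr_functor:
  assumes "is_nattr t"
  shows "is_functor (Nsrc t)" "is_functor (Ntgt t)"
    "Fsrc (Ntgt t) = Fsrc (Nsrc t)" "Ftgt (Ntgt t) = Ftgt (Nsrc t)"
  using assms unfolding is_nattr_def Let_def by blast+

lemma nattr_arr [simp]:
  assumes "is_nattr t" "Ftgt (Nsrc t) = D" "x \<in> Obj (Fsrc (Nsrc t))"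
  shows "Nc t x \<in> Arr D" "src D (Nc t x) = Fo (Nsrc t) x" "tgt D (Nc t x) = Fo (Ntgt t) x"
  using assms unfolding is_nattr_def Let_def hom_def by blast+

lemma nattr_natural:
  assumes "is_nattr t" "Ftgt (Nsrc t) = D" "f \<in> Arr (Fsrc (Nsrc t))"
    "x = src (Fsrc (Nsrc t)) f" "y = tgt (Fsrc (Nsrc t)) f"
  shows "cmp D (Nc t y) (Fa (Nsrc t) f) = cmp D (Fa (Ntgt t) f) (Nc t x)"
  using assms unfolding is_nattr_def Let_def hom_def by blast

lemma nattr_extensional:
  assumes "is_nattr t"
  shows "Nc t \<in> extensional (Obj (Fsrc (Nsrc t)))"
  using assms unfolding is_nattr_def Let_def by blast+

lemma nattr_eqI:
  assumes "is_nattr t" "is_nattr s" "Nsrc t = Nsrc s" "Ntgt t = Ntgt s"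
    and "\<And>x. x \<in> Obj (Fsrc (Nsrc t)) \<Longrightarrow> Nc t x = Nc s x"
  shows "t = (s :: 'u nattr)"
proof -
  have "Nc t = Nc s"
    using assms nattr_extensional[OF assms(1)] nattr_extensional[OF assms(2)]
    by (auto intro: extensionalityI)
  then show ?thesis using assms by simp
qed

lemma nid_simps [simp]:
  "Nsrc (nid F) = F" "Ntgt (nid F) = F"
  "x \<in> Obj (Fsrc F) \<Longrightarrow> Nc (nid F) x = idn (Ftgt F) (Fo F x)"
  by (simp_all add: nid_def)

lemma nvcomp_simps [simp]:
  "Nsrc (nvcomp t s) = Nsrc s" "Ntgt (nvcomp t s) = Ntgt t"
  "x \<in> Obj (Fsrc (Nsrc s)) \<Longrightarrow> Nc (nvcomp t s) x = cmp (Ftgt (Nsrc s)) (Nc t x) (Nc s x)"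
  by (simp_all add: nvcomp_def)

lemma nhcomp_simps [simp]:
  "Nsrc (nhcomp t s) = Nsrc t \<circ>\<^sub>F Nsrc s" "Ntgt (nhcomp t s) = Ntgt t \<circ>\<^sub>F Ntgt s"
  "x \<in> Obj (Fsrc (Nsrc s)) \<Longrightarrow> Nc (nhcomp t s) x =
    cmp (Ftgt (Nsrc t)) (Nc t (Fo (Ntgt s) x)) (Fa (Nsrc t) (Nc s x))"
  by (simp_all add: nhcomp_def)

lemma nid_nattr [simp]:
  assumes "is_functor F"
  shows "is_nattr (nid F)"
proof -
  interpret A: category "Fsrc F" using functor_category[OF assms] by simp
  interpret B: category "Ftgt F" using functor_category[OF assms] by simp
  show ?thesis by (rule is_nattrI) (use assms in \<open>auto simp: nid_def\<close>)
qed

lemma nvcomp_nattr [simp]: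
  assumes s: "is_nattr s" and t: "is_nattr t" and st: "Nsrc t = Ntgt s"
  shows "is_nattr (nvcomp t s)"
proof -
  note F = nattr_functor[OF s] nattr_functor[OF t]
  interpret A: category "Fsrc (Nsrc s)" using functor_category F by blast
  interpret B: category "Ftgt (Nsrc s)" using functor_category F by blast
  show ?thesis
  proof (rule is_nattrI)
    fix f assume f: "f \<in> Arr (Fsrc (Nsrc (nvcomp t s)))"
    let ?D = "Ftgt (Nsrc s)" and ?x = "src (Fsrc (Nsrc s)) f" and ?y = "tgt (Fsrc (Nsrc s)) f"
    \<comment> \<open>The naturality squares of \<open>s\<close> and \<open>t\<close> at
      \<open>f\<close> are pasted along their common side \<open>Fa (Ntgt s) f\<close>.\<close>
    have "cmp ?D (cmp ?D (Nc t ?y) (Nc s ?y)) (Fa (Nsrc s) f) =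
      cmp ?D (Nc t ?y) (cmp ?D (Nc s ?y) (Fa (Nsrc s) f))"
      by (rule B.assoc) (use s t st F f in simp_all)
    also have "\<dots> = cmp ?D (Nc t ?y) (cmp ?D (Fa (Ntgt s) f) (Nc s ?x))"
      using nattr_natural[OF s refl, of f] f by simp
    also have "\<dots> = cmp ?D (cmp ?D (Nc t ?y) (Fa (Ntgt s) f)) (Nc s ?x)"
      by (rule B.assoc[symmetric]) (use s t st F f in simp_all)
    also have "\<dots> = cmp ?D (cmp ?D (Fa (Ntgt t) f) (Nc t ?x)) (Nc s ?x)"
      using nattr_natural[OF t refl, of f] f st F by simp
    also have "\<dots> = cmp ?D (Fa (Ntgt t) f) (cmp ?D (Nc t ?x) (Nc s ?x))"
      by (rule B.assoc) (use s t st F f in simp_all)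
    finally show "cmp (Ftgt (Nsrc (nvcomp t s))) (Nc (nvcomp t s) (tgt (Fsrc (Nsrc (nvcomp t s))) f))
        (Fa (Nsrc (nvcomp t s)) f) =
      cmp (Ftgt (Nsrc (nvcomp t s))) (Fa (Ntgt (nvcomp t s)) f)
        (Nc (nvcomp t s) (src (Fsrc (Nsrc (nvcomp t s))) f))"
      using f by simp
  qed (use s t st F in \<open>auto simp: nvcomp_def\<close>)
qed

lemma nhcomp_nattr [simp]:
  assumes s: "is_nattr s" and t: "is_nattr t" and st: "Fsrc (Nsrc t) = Ftgt (Nsrc s)"
  shows "is_nattr (nhcomp t s)"
proof -
  note F = nattr_functor[OF s] nattr_functor[OF t]
  interpret A: category "Fsrc (Nsrc s)" using functor_category F by blast
  interpret B: category "Ftgt (Nsrc s)" using functor_category F by blast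
  interpret C: category "Ftgt (Nsrc t)" using functor_category F by blast
  show ?thesis
  proof (rule is_nattrI)
    fix f assume f: "f \<in> Arr (Fsrc (Nsrc (nhcomp t s)))"
    let ?D = "Ftgt (Nsrc s)" and ?x = "src (Fsrc (Nsrc s)) f" and ?y = "tgt (Fsrc (Nsrc s)) f"
    let ?E = "Ftgt (Nsrc t)"
    let ?F = "Nsrc s" and ?F' = "Ntgt s" and ?G = "Nsrc t" and ?G' = "Ntgt t"
    \<comment> \<open>Two naturality squares are combined: that of \<open>s\<close> at
      \<open>f\<close>, carried along by \<open>Nsrc t\<close>, and that of \<open>t\<close> at the
      arrow \<open>Fa ?F' f\<close>.\<close>
    have "cmp ?E (cmp ?E (Nc t (Fo ?F' ?y)) (Fa ?G (Nc s ?y))) (Fa ?G (Fa ?F f)) =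
      cmp ?E (Nc t (Fo ?F' ?y)) (cmp ?E (Fa ?G (Nc s ?y)) (Fa ?G (Fa ?F f)))"
      by (rule C.assoc) (use s t st F f in simp_all)
    also have "cmp ?E (Fa ?G (Nc s ?y)) (Fa ?G (Fa ?F f)) = Fa ?G (cmp ?D (Nc s ?y) (Fa ?F f))"
      using s t st F f by simp
    also have "\<dots> = Fa ?G (cmp ?D (Fa ?F' f) (Nc s ?x))"
      using nattr_natural[OF s refl, of f] f by simp
    also have "\<dots> = cmp ?E (Fa ?G (Fa ?F' f)) (Fa ?G (Nc s ?x))"
      using s t st F f by simp
    also have "cmp ?E (Nc t (Fo ?F' ?y)) \<dots> =
      cmp ?E (cmp ?E (Nc t (Fo ?F' ?y)) (Fa ?G (Fa ?F' f))) (Fa ?G (Nc s ?x))"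
      by (rule C.assoc[symmetric]) (use s t st F f in simp_all)
    also have "\<dots> = cmp ?E (cmp ?E (Fa ?G' (Fa ?F' f)) (Nc t (Fo ?F' ?x))) (Fa ?G (Nc s ?x))"
      using nattr_natural[OF t refl, of "Fa ?F' f"] f st F by simp
    also have "\<dots> = cmp ?E (Fa ?G' (Fa ?F' f)) (cmp ?E (Nc t (Fo ?F' ?x)) (Fa ?G (Nc s ?x)))"
      by (rule C.assoc) (use s t st F f in simp_all)
    finally show "cmp (Ftgt (Nsrc (nhcomp t s))) (Nc (nhcomp t s) (tgt (Fsrc (Nsrc (nhcomp t s))) f))
        (Fa (Nsrc (nhcomp t s)) f) =
      cmp (Ftgt (Nsrc (nhcomp t s))) (Fa (Ntgt (nhcomp t s)) f)
        (Nc (nhcomp t s) (src (Fsrc (Nsrc (nhcomp t s))) f))"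
      using f F by simp
  qed (use s t st F in \<open>auto simp: nhcomp_def\<close>)
qed

text \<open>The identity factor contributes an identity arrow to each component, and this cancels.
  The whole record is computed, so that an equation of whiskered transformations splits into
  equations of functors and of component functions.\<close>

lemma nhcomp_nid_left:
  assumes "is_nattr s" "is_functor H" "Fsrc H = Ftgt (Nsrc s)"
  shows "nhcomp (nid H) s = \<lparr>Nsrc = H \<circ>\<^sub>F Nsrc s, Ntgt = H \<circ>\<^sub>F Ntgt s,
    Nc = (\<lambda>x\<in>Obj (Fsrc (Nsrc s)). Fa H (Nc s x))\<rparr>"
proof -
  note F = nattr_functor[OF assms(1)]
  interpret C: category "Ftgt H" using functor_category assms by blast
  show ?thesis unfolding nhcomp_def using assms F by (auto intro!: restrict_ext)
qed

lemma nhcomp_nid_right: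
  assumes "is_nattr t" "is_functor F" "Fsrc (Nsrc t) = Ftgt F"
  shows "nhcomp t (nid F) = \<lparr>Nsrc = Nsrc t \<circ>\<^sub>F F, Ntgt = Ntgt t \<circ>\<^sub>F F,
    Nc = (\<lambda>x\<in>Obj (Fsrc F). Nc t (Fo F x))\<rparr>"
proof -
  note F = nattr_functor[OF assms(1)]
  interpret C: category "Ftgt (Nsrc t)" using functor_category F by blast
  show ?thesis unfolding nhcomp_def using assms F by (auto intro!: restrict_ext)
qed


section \<open>Strict 2-categories\<close>

lemma cat01_simps [simp]:
  "Obj (cat01 K) = C0 K" "Arr (cat01 K) = C1 K" "src (cat01 K) = src1 K" "tgt (cat01 K) = tgt1 K"
  "idn (cat01 K) = id1 K" "cmp (cat01 K) = comp1 K"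
  by (simp_all add: cat01_def)

lemma cat12_simps [simp]:
  "Obj (cat12 K) = C1 K" "Arr (cat12 K) = C2 K" "src (cat12 K) = src2 K" "tgt (cat12 K) = tgt2 K"
  "idn (cat12 K) = id2 K" "cmp (cat12 K) = vcomp K"
  by (simp_all add: cat12_def)

lemma cat02_simps [simp]:
  "Obj (cat02 K) = C0 K" "Arr (cat02 K) = C2 K" "src (cat02 K) a = src1 K (src2 K a)"
  "tgt (cat02 K) a = tgt1 K (src2 K a)" "idn (cat02 K) x = id2 K (id1 K x)" "cmp (cat02 K) = hcomp K"
  by (simp_all add: cat02_def)

context two_category
begin

lemmas cell1_obj [simp] = category.obj_simps[OF cat01, simplified]
lemmas id1_simps [simp] = category.idn_simps[OF cat01, simplified]
lemmas comp1_simps [simp] = category.cmp_simps[OF cat01, simplified]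
lemmas comp1_id1 [simp] = category.cmp_idn[OF cat01, simplified]
lemmas comp1_assoc = category.assoc[OF cat01, simplified]

lemmas cell2_cell1 [simp] = category.obj_simps[OF cat12, simplified]
lemmas id2_simps [simp] = category.idn_simps[OF cat12, simplified]
lemmas vcomp_simps [simp] = category.cmp_simps[OF cat12, simplified]
lemmas vcomp_id2 [simp] = category.cmp_idn[OF cat12, simplified]
lemmas vcomp_assoc = category.assoc[OF cat12, simplified]

lemma globular [simp]:
  assumes "a \<in> C2 K"
  shows "src1 K (tgt2 K a) = src1 K (src2 K a)" "tgt1 K (tgt2 K a) = tgt1 K (src2 K a)"
  using assms globular_src globular_tgt by auto

lemma hcomp_simps [simp]:
  assumes "a \<in> C2 K" "b \<in> C2 K" "src1 K (src2 K b) = tgt1 K (src2 K a)"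
  shows "hcomp K b a \<in> C2 K" "src2 K (hcomp K b a) = comp1 K (src2 K b) (src2 K a)"
    "tgt2 K (hcomp K b a) = comp1 K (tgt2 K b) (tgt2 K a)"
  using assms category.cmp_simps[OF cat02, simplified, of a b] hcomp_src hcomp_tgt by auto

lemma hcomp_id2_id1 [simp]:
  assumes "a \<in> C2 K"
  shows "src1 K (src2 K a) = x \<Longrightarrow> hcomp K a (id2 K (id1 K x)) = a"
    "tgt1 K (src2 K a) = y \<Longrightarrow> hcomp K (id2 K (id1 K y)) a = a"
  using assms category.cmp_idn[OF cat02, simplified, of a] by auto

lemma hcomp_assoc:
  assumes "a \<in> C2 K" "b \<in> C2 K" "c \<in> C2 K" "src1 K (src2 K b) = tgt1 K (src2 K a)"
    "src1 K (src2 K c) = tgt1 K (src2 K b)"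
  shows "hcomp K (hcomp K c b) a = hcomp K c (hcomp K b a)"
  using assms category.assoc[OF cat02, simplified, of a b c] by auto

text \<open>Interchange in which one factor is an identity 2-cell, read as its own vertical
  composite with itself. This carries the compatibility condition of \<open>arrow_cells2\<close>
  from two 2-cells to their vertical composite.\<close>

lemma whisker_vcomp:
  assumes "a \<in> C2 K" "a' \<in> C2 K" "tgt2 K a = src2 K a'"
  shows "g \<in> C1 K \<Longrightarrow> src1 K g = tgt1 K (src2 K a) \<Longrightarrow>
      hcomp K (id2 K g) (vcomp K a' a) = vcomp K (hcomp K (id2 K g) a') (hcomp K (id2 K g) a)"
    and "f \<in> C1 K \<Longrightarrow> tgt1 K f = src1 K (src2 K a) \<Longrightarrow>
      hcomp K (vcomp K a' a) (id2 K f) = vcomp K (hcomp K a' (id2 K f)) (hcomp K a (id2 K f))"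
  using interchange[of a a' "id2 K g" "id2 K g"] interchange[of "id2 K f" "id2 K f" a a'] assms
  by auto

end

section \<open>The arrow 2-category of a 2-category\<close>

lemma arrow_2cat_simps [simp]:
  "C0 (arrow_2cat K) = C1 K" "C1 (arrow_2cat K) = arrow_cells1 K" "C2 (arrow_2cat K) = arrow_cells2 K"
  "src1 (arrow_2cat K) = dom1" "tgt1 (arrow_2cat K) = cod1"
  "src2 (arrow_2cat K) = dom2" "tgt2 (arrow_2cat K) = cod2"
  "id1 (arrow_2cat K) P = \<lparr>dom1 = P, cod1 = P, top1 = id1 K (src1 K P), bot1 = id1 K (tgt1 K P)\<rparr>"
  "id2 (arrow_2cat K) s = \<lparr>dom2 = s, cod2 = s, top2 = id2 K (top1 s), bot2 = id2 K (bot1 s)\<rparr>"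
  "comp1 (arrow_2cat K) = arrow_comp1 K"
  "vcomp (arrow_2cat K) d c = \<lparr>dom2 = dom2 c, cod2 = cod2 d,
       top2 = vcomp K (top2 d) (top2 c), bot2 = vcomp K (bot2 d) (bot2 c)\<rparr>"
  "hcomp (arrow_2cat K) d c = \<lparr>dom2 = arrow_comp1 K (dom2 d) (dom2 c),
      cod2 = arrow_comp1 K (cod2 d) (cod2 c),
      top2 = hcomp K (top2 d) (top2 c), bot2 = hcomp K (bot2 d) (bot2 c)\<rparr>"
  by (simp_all add: arrow_2cat_def)

lemma arrow_comp1_simps [simp]:
  "dom1 (arrow_comp1 K t s) = dom1 s" "cod1 (arrow_comp1 K t s) = cod1 t"
  "top1 (arrow_comp1 K t s) = comp1 K (top1 t) (top1 s)"
  "bot1 (arrow_comp1 K t s) = comp1 K (bot1 t) (bot1 s)"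
  by (simp_all add: arrow_comp1_def)

lemma arrow_cells1D:
  assumes "s \<in> arrow_cells1 K"
  shows "dom1 s \<in> C1 K" "cod1 s \<in> C1 K" "top1 s \<in> C1 K" "bot1 s \<in> C1 K"
     "src1 K (top1 s) = src1 K (dom1 s)" "tgt1 K (top1 s) = src1 K (cod1 s)"
     "src1 K (bot1 s) = tgt1 K (dom1 s)" "tgt1 K (bot1 s) = tgt1 K (cod1 s)"
     "comp1 K (cod1 s) (top1 s) = comp1 K (bot1 s) (dom1 s)"
  using assms by (auto simp: arrow_cells1_def)

lemma arrow_cells2D:
  assumes "c \<in> arrow_cells2 K"
  shows "dom2 c \<in> arrow_cells1 K" "cod2 c \<in> arrow_cells1 K"
     "dom1 (cod2 c) = dom1 (dom2 c)" "cod1 (cod2 c) = cod1 (dom2 c)"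
     "top2 c \<in> C2 K" "src2 K (top2 c) = top1 (dom2 c)" "tgt2 K (top2 c) = top1 (cod2 c)"
     "bot2 c \<in> C2 K" "src2 K (bot2 c) = bot1 (dom2 c)" "tgt2 K (bot2 c) = bot1 (cod2 c)"
     "hcomp K (id2 K (cod1 (dom2 c))) (top2 c) = hcomp K (bot2 c) (id2 K (dom1 (dom2 c)))"
  using assms by (auto simp: arrow_cells2_def)

lemma sq1_eqI:
  "dom1 s = dom1 t \<Longrightarrow> cod1 s = cod1 t \<Longrightarrow> top1 s = top1 t \<Longrightarrow> bot1 s = bot1 t \<Longrightarrow> s = (t :: 'm sq1)"
  by simp

lemma sq2_eqI:
  "dom2 s = dom2 t \<Longrightarrow> cod2 s = cod2 t \<Longrightarrow> top2 s = top2 t \<Longrightarrow> bot2 s = bot2 t \<Longrightarrow>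
    s = (t :: ('m, 'c) sq2)"
  by simp

context two_category
begin

lemma arrow_comp1_closed:
  assumes s: "s \<in> arrow_cells1 K" and t: "t \<in> arrow_cells1 K" and st: "dom1 t = cod1 s"
  shows "arrow_comp1 K t s \<in> arrow_cells1 K"
proof -
  note S = arrow_cells1D[OF s] note T = arrow_cells1D[OF t]
  have "comp1 K (cod1 t) (comp1 K (top1 t) (top1 s)) = comp1 K (comp1 K (bot1 t) (dom1 t)) (top1 s)"
    using S T st by (simp add: comp1_assoc[symmetric])
  also have "\<dots> = comp1 K (bot1 t) (comp1 K (bot1 s) (dom1 s))"
    using S T st by (simp add: comp1_assoc)
  also have "\<dots> = comp1 K (comp1 K (bot1 t) (bot1 s)) (dom1 s)"
    using S T st by (simp add: comp1_assoc)
  finally show ?thesis using S T st by (simp add: arrow_cells1_def)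
qed

lemma arrow_vcomp_closed:
  assumes c: "c \<in> arrow_cells2 K" and d: "d \<in> arrow_cells2 K" and cd: "dom2 d = cod2 c"
  shows "vcomp (arrow_2cat K) d c \<in> arrow_cells2 K"
proof -
  note C = arrow_cells2D[OF c] note D = arrow_cells2D[OF d]
  note S = arrow_cells1D[OF C(1)] arrow_cells1D[OF C(2)] arrow_cells1D[OF D(2)]
  show ?thesis unfolding arrow_cells2_def using C D S cd
    by (simp add: whisker_vcomp)
qed

text \<open>Associativity of \<open>hcomp\<close> moves the identity on the middle 1-cell
  \<open>dom1 (dom2 d) = cod1 (dom2 c)\<close> from \<open>d\<close> to \<open>c\<close>, so that
  the compatibility equations of \<open>d\<close> and of \<open>c\<close> apply one after the
  other.\<close>

lemma arrow_hcomp_closed: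
  assumes c: "c \<in> arrow_cells2 K" and d: "d \<in> arrow_cells2 K" and cd: "dom1 (dom2 d) = cod1 (dom2 c)"
  shows "hcomp (arrow_2cat K) d c \<in> arrow_cells2 K"
proof -
  note C = arrow_cells2D[OF c] note D = arrow_cells2D[OF d]
  note S = arrow_cells1D[OF C(1)] arrow_cells1D[OF C(2)] arrow_cells1D[OF D(1)] arrow_cells1D[OF D(2)]
  have "hcomp K (id2 K (cod1 (dom2 d))) (hcomp K (top2 d) (top2 c)) =
      hcomp K (hcomp K (bot2 d) (id2 K (dom1 (dom2 d)))) (top2 c)"
    using C D S cd by (simp add: hcomp_assoc[symmetric])
  also have "\<dots> = hcomp K (bot2 d) (hcomp K (bot2 c) (id2 K (dom1 (dom2 c))))"
    using C D S cd by (simp add: hcomp_assoc)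
  also have "\<dots> = hcomp K (hcomp K (bot2 d) (bot2 c)) (id2 K (dom1 (dom2 c)))"
    using C D S cd by (simp add: hcomp_assoc)
  finally show ?thesis using C D S cd by (simp add: arrow_cells2_def arrow_comp1_closed)
qed

text \<open>The operations are those of \<open>K\<close> on tops and bottoms, so the laws are
  inherited component by component; the content lies in closure of the cells under the
  operations.\<close>

lemma arrow_2cat: "two_category (arrow_2cat K)"
proof (rule two_category.intro)
  show "category (cat01 (arrow_2cat K))"
    by (rule categoryI)
      (auto simp: arrow_comp1_closed arrow_cells1D comp1_assoc intro!: sq1_eqI,
       auto simp: arrow_cells1_def)
  show "category (cat12 (arrow_2cat K))"
  proof (rule categoryI, goal_cases)
    \<comment> \<open>Among the goals of \<open>categoryI\<close>, number 6 is closure under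
      composition, 9 and 10 are the unit laws, and 11 is associativity.\<close>
    case (6 f g) then show ?case using arrow_vcomp_closed[of f g] by simp
  qed (auto simp: arrow_cells2D arrow_cells1D vcomp_assoc intro!: sq2_eqI,
       auto simp: arrow_cells2_def arrow_cells1D hcomp_id2)
  show "category (cat02 (arrow_2cat K))"
  proof (rule categoryI, goal_cases)
    case (6 f g) then show ?case using arrow_hcomp_closed[of f g] by simp
  next
    case (9 f)
    then have f: "f \<in> arrow_cells2 K" by simp
    note c = arrow_cells2D[OF f]
    show ?case using c arrow_cells1D[OF c(1)] arrow_cells1D[OF c(2)]
      by (auto intro!: sq2_eqI sq1_eqI)
  next
    case (10 f)
    then have f: "f \<in> arrow_cells2 K" by simp
    note c = arrow_cells2D[OF f]
    show ?case using c arrow_cells1D[OF c(1)] arrow_cells1D[OF c(2)]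
      by (auto intro!: sq2_eqI sq1_eqI)
  next
    case (11 f g h)
    then show ?case
      by (auto simp: arrow_cells2D arrow_cells1D comp1_assoc hcomp_assoc intro!: sq2_eqI sq1_eqI)
  qed (auto simp: arrow_cells2D arrow_cells1D,
       auto simp: arrow_cells2_def arrow_cells1_def hcomp_id2)
qed (auto simp: arrow_cells2D arrow_cells1D hcomp_id2 interchange intro!: sq1_eqI sq2_eqI)

lemma tfid: "two_functor K K tfid"
  by unfold_locales (auto simp: tfid_def)

lemma dom_2functor: "two_functor (arrow_2cat K) K (dom_2functor K)"
proof -
  interpret A: two_category "arrow_2cat K" by (rule arrow_2cat)
  show ?thesis by unfold_locales (auto simp: dom_2functor_def arrow_cells1D arrow_cells2D)
qed

end

lemma tfcomp_simps [simp]: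
  "on0 (G \<circ>\<^sub>2 F) x = on0 G (on0 F x)" "on1 (G \<circ>\<^sub>2 F) f = on1 G (on1 F f)"
  "on2 (G \<circ>\<^sub>2 F) a = on2 G (on2 F a)"
  by (simp_all add: tfcomp_def)

lemma tfid_simps [simp]: "on0 tfid x = x" "on1 tfid f = f" "on2 tfid a = a"
  by (simp_all add: tfid_def)

lemma tfcomp:
  assumes "two_functor K L F" "two_functor L M G"
  shows "two_functor K M (G \<circ>\<^sub>2 F)"
proof -
  interpret F: two_functor K L F by fact
  interpret G: two_functor L M G by fact
  show ?thesis
    by unfold_locales (auto simp: F.on0_closed F.on1_closed F.on2_closed F.on1_src F.on1_tgt F.on2_src
        F.on2_tgt F.on1_id1 F.on2_id2 F.on1_comp1 F.on2_vcomp F.on2_hcomp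
        G.on0_closed G.on1_closed G.on2_closed G.on1_src G.on1_tgt G.on2_src
        G.on2_tgt G.on1_id1 G.on2_id2 G.on1_comp1 G.on2_vcomp G.on2_hcomp)
qed

section \<open>Pulling strict algebras back along a colax morphism\<close>

lemma (in colax_morphism) strict_algebra_pullback:
  assumes "strict_algebra K T X a"
  shows "strict_algebra L R (on0 V X) (pullback_action L V lam X a)"
proof -
  interpret A: strict_algebra K T X a by fact
  interpret V: two_functor K L V by (rule two_functor)
  interpret ET: two_functor K K "endo T" using T.unit_natural by (rule two_natural.axioms)
  interpret ER: two_functor L L "endo R" using R.unit_natural by (rule two_natural.axioms)
  interpret lam: two_natural K L "endo R \<circ>\<^sub>2 V" "V \<circ>\<^sub>2 endo T" lam by (rule two_natural)
  interpret \<eta>T: two_natural K K tfid "endo T" "unit T" by (rule T.unit_natural)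
  interpret \<mu>T: two_natural K K "endo T \<circ>\<^sub>2 endo T" "endo T" "mult T" by (rule T.mult_natural)
  interpret \<eta>R: two_natural L L tfid "endo R" "unit R" by (rule R.unit_natural)
  interpret \<mu>R: two_natural L L "endo R \<circ>\<^sub>2 endo R" "endo R" "mult R" by (rule R.mult_natural)
  let ?V = "on0 V X" and ?Va = "on1 V a" and ?l = "lam X"
  let ?TX = "on0 (endo T) X"
  note X = A.carrier A.action
  have TX: "?TX \<in> C0 K" using X ET.on0_closed by blast
  have VX: "?V \<in> C0 L" using X V.on0_closed by blast
  have Va: "?Va \<in> C1 L" "src1 L ?Va = on0 V ?TX" "tgt1 L ?Va = ?V"
    using X by (auto simp: V.on1_closed V.on1_src V.on1_tgt)
  have Ta: "on1 (endo T) a \<in> C1 K" "src1 K (on1 (endo T) a) = on0 (endo T) ?TX"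
      "tgt1 K (on1 (endo T) a) = ?TX"
    using X by (auto simp: ET.on1_closed ET.on1_src ET.on1_tgt)
  have RVa: "on1 (endo R) ?Va \<in> C1 L" "src1 L (on1 (endo R) ?Va) = on0 (endo R) (on0 V ?TX)"
      "tgt1 L (on1 (endo R) ?Va) = on0 (endo R) ?V"
    using Va by (auto simp: ER.on1_closed ER.on1_src ER.on1_tgt)
  have l: "?l \<in> C1 L" "src1 L ?l = on0 (endo R) ?V" "tgt1 L ?l = on0 V ?TX"
    using lam.component[OF X(1)] by auto
  have lT: "lam ?TX \<in> C1 L" "src1 L (lam ?TX) = on0 (endo R) (on0 V ?TX)"
      "tgt1 L (lam ?TX) = on0 V (on0 (endo T) ?TX)"
    using lam.component[OF TX] by auto
  have Rl: "on1 (endo R) ?l \<in> C1 L" "src1 L (on1 (endo R) ?l) = on0 (endo R) (on0 (endo R) ?V)"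
      "tgt1 L (on1 (endo R) ?l) = on0 (endo R) (on0 V ?TX)"
    using l by (auto simp: ER.on1_closed ER.on1_src ER.on1_tgt)
  have \<eta>: "unit R ?V \<in> C1 L" "src1 L (unit R ?V) = ?V" "tgt1 L (unit R ?V) = on0 (endo R) ?V"
    using \<eta>R.component[OF VX] by auto
  have \<eta>K: "unit T X \<in> C1 K" "src1 K (unit T X) = X" "tgt1 K (unit T X) = ?TX"
    using \<eta>T.component[OF X(1)] by auto
  have \<mu>: "mult R ?V \<in> C1 L" "src1 L (mult R ?V) = on0 (endo R) (on0 (endo R) ?V)"
      "tgt1 L (mult R ?V) = on0 (endo R) ?V"
    using \<mu>R.component[OF VX] by auto
  have \<mu>K: "mult T X \<in> C1 K" "src1 K (mult T X) = on0 (endo T) ?TX" "tgt1 K (mult T X) = ?TX"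
    using \<mu>T.component[OF X(1)] by auto
  have V\<mu>: "on1 V (mult T X) \<in> C1 L" "src1 L (on1 V (mult T X)) = on0 V (on0 (endo T) ?TX)"
      "tgt1 L (on1 V (mult T X)) = on0 V ?TX"
    using \<mu>K by (auto simp: V.on1_closed V.on1_src V.on1_tgt)
  have VTa: "on1 V (on1 (endo T) a) \<in> C1 L" "src1 L (on1 V (on1 (endo T) a)) = on0 V (on0 (endo T) ?TX)"
      "tgt1 L (on1 V (on1 (endo T) a)) = on0 V ?TX"
    using Ta by (auto simp: V.on1_closed V.on1_src V.on1_tgt)
  have unit: "comp1 L (comp1 L ?Va ?l) (unit R ?V) = id1 L ?V"
  proof -
    have "comp1 L (comp1 L ?Va ?l) (unit R ?V) = comp1 L ?Va (comp1 L ?l (unit R ?V))"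
      using Va l \<eta> by (simp add: R.comp1_assoc)
    also have "\<dots> = on1 V (comp1 K a (unit T X))"
      using X \<eta>K unit_eq by (simp add: V.on1_comp1)
    finally show ?thesis using X A.action_unit by (simp add: V.on1_id1)
  qed
  \<comment> \<open>With \<open>l\<close> for \<open>lam\<close> and composition by juxtaposition,
    the chain is \<open>(V a) l mu = (V a) (V mu) l_T (R l) = (V a) (V (T a)) l_T (R l) = (V a) l (R
    (V a)) (R l)\<close>. Its equalities use \<open>mult_eq\<close>, the multiplication law of
    \<open>a\<close> under \<open>V\<close>, and naturality of \<open>lam\<close> at
    \<open>a\<close>.\<close>
  have "comp1 L (comp1 L ?Va ?l) (mult R ?V) = comp1 L ?Va (comp1 L ?l (mult R ?V))"
    using Va l \<mu> by (simp add: R.comp1_assoc)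
  also have "\<dots> = comp1 L (comp1 L ?Va (on1 V (mult T X))) (comp1 L (lam ?TX) (on1 (endo R) ?l))"
    using X Va V\<mu> lT Rl mult_eq by (simp add: R.comp1_assoc)
  also have "comp1 L ?Va (on1 V (mult T X)) = comp1 L ?Va (on1 V (on1 (endo T) a))"
    using X \<mu>K Ta A.action_mult by (simp flip: V.on1_comp1)
  also have "comp1 L \<dots> (comp1 L (lam ?TX) (on1 (endo R) ?l)) =
      comp1 L ?Va (comp1 L (comp1 L (on1 V (on1 (endo T) a)) (lam ?TX)) (on1 (endo R) ?l))"
    using Va VTa lT Rl by (simp add: R.comp1_assoc)
  also have "comp1 L (on1 V (on1 (endo T) a)) (lam ?TX) = comp1 L ?l (on1 (endo R) ?Va)"
    using lam.natural1[OF X(2)] X by simp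
  also have "comp1 L ?Va (comp1 L \<dots> (on1 (endo R) ?l)) =
      comp1 L (comp1 L ?Va ?l) (comp1 L (on1 (endo R) ?Va) (on1 (endo R) ?l))"
    using Va l RVa Rl by (simp add: R.comp1_assoc)
  also have "comp1 L (on1 (endo R) ?Va) (on1 (endo R) ?l) = on1 (endo R) (comp1 L ?Va ?l)"
    using Va l by (simp add: ER.on1_comp1)
  finally show ?thesis
    unfolding pullback_action_def using VX Va l unit by unfold_locales auto
qed


section \<open>The 2-category of categories\<close>

lemma CAT_simps [simp]:
  "src1 CAT = Fsrc" "tgt1 CAT = Ftgt" "src2 CAT = Nsrc" "tgt2 CAT = Ntgt"
  "id1 CAT = fid" "id2 CAT = nid" "comp1 CAT = fcomp" "vcomp CAT = nvcomp" "hcomp CAT = nhcomp"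
  by (simp_all add: CAT_def Let_def)

lemma C0_CAT: "C \<in> C0 CAT \<longleftrightarrow> category C \<and> normalized C \<and> locally_small C"
  by (simp add: CAT_def Let_def)

lemma C1_CAT: "F \<in> C1 CAT \<longleftrightarrow> is_functor F \<and> Fsrc F \<in> C0 CAT \<and> Ftgt F \<in> C0 CAT"
  by (auto simp: CAT_def Let_def)

lemma C2_CAT: "t \<in> C2 CAT \<longleftrightarrow> is_nattr t \<and> Fsrc (Nsrc t) \<in> C0 CAT \<and> Ftgt (Nsrc t) \<in> C0 CAT"
  by (auto simp: CAT_def Let_def)

lemma CAT: "two_category CAT"
proof (rule two_category.intro)
  show "category (cat01 CAT)"
    by (rule categoryI) (auto simp: C1_CAT fcomp_assoc, auto simp: C0_CAT)
  show "category (cat12 CAT)"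
  proof (rule categoryI, goal_cases)
    case (9 t)
    then have t: "is_nattr t" by (simp add: C2_CAT)
    note F = nattr_functor[OF t]
    interpret C: category "Ftgt (Nsrc t)" using functor_category[OF F(1)] by simp
    show ?case using t F by (auto intro!: nattr_eqI)
  next
    case (10 t)
    then have t: "is_nattr t" by (simp add: C2_CAT)
    note F = nattr_functor[OF t]
    interpret C: category "Ftgt (Nsrc t)" using functor_category[OF F(1)] by simp
    show ?case using t F by (auto intro!: nattr_eqI)
  next
    case (11 s t u)
    then have t: "is_nattr s" "is_nattr t" "is_nattr u" "Nsrc t = Ntgt s" "Nsrc u = Ntgt t"
      by (auto simp: C2_CAT)
    note F = nattr_functor[OF t(1)] nattr_functor[OF t(2)] nattr_functor[OF t(3)]
    interpret C: category "Ftgt (Nsrc s)" using functor_category[OF F(1)] by simp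
    show ?case using t F by (auto intro!: nattr_eqI simp: C.assoc)
  qed (auto simp: C1_CAT C2_CAT nattr_functor)
  show "category (cat02 CAT)"
  proof (rule categoryI, goal_cases)
    case (9 t)
    then have t: "is_nattr t" by (simp add: C2_CAT)
    note F = nattr_functor[OF t]
    interpret C: category "Ftgt (Nsrc t)" using functor_category[OF F(1)] by simp
    show ?case using t F functor_category[OF F(1)]
      by (auto intro!: nattr_eqI)
  next
    case (10 t)
    then have t: "is_nattr t" by (simp add: C2_CAT)
    note F = nattr_functor[OF t]
    interpret C: category "Ftgt (Nsrc t)" using functor_category[OF F(1)] by simp
    show ?case using t F functor_category[OF F(1)]
      by (auto intro!: nattr_eqI)
  next
    case (11 s t u)
    then have t: "is_nattr s" "is_nattr t" "is_nattr u"
        "Fsrc (Nsrc t) = Ftgt (Nsrc s)" "Fsrc (Nsrc u) = Ftgt (Nsrc t)"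
      by (auto simp: C2_CAT)
    note F = nattr_functor[OF t(1)] nattr_functor[OF t(2)] nattr_functor[OF t(3)]
    interpret C: category "Ftgt (Nsrc u)" using functor_category[OF F(9)] by simp
    show ?case using t F by (auto intro!: nattr_eqI simp: C.assoc fcomp_assoc)
  qed (auto simp: C1_CAT C2_CAT nattr_functor, auto simp: C0_CAT)
next
  fix f g :: "'a func" assume "f \<in> C1 CAT" "g \<in> C1 CAT" "tgt1 CAT f = src1 CAT g"
  then have f: "is_functor f" "is_functor g" "Fsrc g = Ftgt f" by (auto simp: C1_CAT)
  interpret C: category "Ftgt g" using functor_category[OF f(2)] by simp
  show "hcomp CAT (id2 CAT g) (id2 CAT f) = id2 CAT (comp1 CAT g f)"
    using f by (auto intro!: nattr_eqI)
next
  fix a a' b b' :: "'a nattr"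
  assume "a \<in> C2 CAT" "a' \<in> C2 CAT" "b \<in> C2 CAT" "b' \<in> C2 CAT"
    "tgt2 CAT a = src2 CAT a'" "tgt2 CAT b = src2 CAT b'"
    "tgt1 CAT (src2 CAT a) = src1 CAT (src2 CAT b)"
  then have t: "is_nattr a" "is_nattr a'" "is_nattr b" "is_nattr b'"
      "Nsrc a' = Ntgt a" "Nsrc b' = Ntgt b" "Fsrc (Nsrc b) = Ftgt (Nsrc a)"
    by (auto simp: C2_CAT)
  note F = nattr_functor[OF t(1)] nattr_functor[OF t(2)] nattr_functor[OF t(3)] nattr_functor[OF t(4)]
  interpret C: category "Ftgt (Nsrc b)" using functor_category[OF F(9)] by simp
  show "hcomp CAT (vcomp CAT b' b) (vcomp CAT a' a) = vcomp CAT (hcomp CAT b' a') (hcomp CAT b a)"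
  proof (rule nattr_eqI)
    fix x assume "x \<in> Obj (Fsrc (Nsrc (hcomp CAT (vcomp CAT b' b) (vcomp CAT a' a))))"
    then have x: "x \<in> Obj (Fsrc (Nsrc a))" by simp
    let ?E = "Ftgt (Nsrc b)"
    let ?x' = "Fo (Ntgt a) x" and ?x'' = "Fo (Ntgt a') x"
    let ?b = "Nc b ?x''" and ?b' = "Nc b' ?x''"
    let ?u = "Fa (Nsrc b) (Nc a' x)" and ?v = "Fa (Nsrc b) (Nc a x)"
    have "cmp ?E (cmp ?E ?b' ?b) (cmp ?E ?u ?v) = cmp ?E ?b' (cmp ?E (cmp ?E ?b ?u) ?v)"
      using t F x by (simp add: C.assoc)
    \<comment> \<open>Naturality of \<open>b\<close> at the arrow \<open>Nc a' x\<close> exchanges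
      the two middle factors; the steps around it only move brackets.\<close>
    also have "cmp ?E ?b ?u = cmp ?E (Fa (Ntgt b) (Nc a' x)) (Nc b ?x')"
      using nattr_natural[OF t(3) refl, of "Nc a' x"] t F x by simp
    also have "cmp ?E ?b' (cmp ?E \<dots> ?v) =
        cmp ?E (cmp ?E ?b' (Fa (Ntgt b) (Nc a' x))) (cmp ?E (Nc b ?x') ?v)"
      using t F x by (simp add: C.assoc)
    finally show "Nc (hcomp CAT (vcomp CAT b' b) (vcomp CAT a' a)) x =
      Nc (vcomp CAT (hcomp CAT b' a') (hcomp CAT b a)) x"
      using t F x by simp
  qed (use t F in simp_all)
qed (auto simp: C1_CAT C2_CAT nattr_functor)

lemma CAT2: "two_category CAT2"
  unfolding CAT2_def by (rule two_category.arrow_2cat[OF CAT])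

lemma Dom: "two_functor CAT2 CAT Dom"
  unfolding CAT2_def Dom_def by (rule two_category.dom_2functor[OF CAT])

text \<open>The two whiskerings of a 2-cell \<open>a\<close> have equal sources and equal targets by
  \<open>nat1\<close> at the source and at the target of \<open>a\<close>. They are then equal as
  soon as their components are, so 2-naturality comes down to the equation of arrows
  \<open>nat2\<close>.\<close>

lemma CAT_two_naturalI:
  assumes F: "two_functor K CAT F" and G: "two_functor K CAT G"
    and comp: "\<And>x. x \<in> C0 K \<Longrightarrow> is_functor (lam x) \<and> Fsrc (lam x) = on0 F x \<and> Ftgt (lam x) = on0 G x"
    and nat1: "\<And>f. f \<in> C1 K \<Longrightarrow> lam (tgt1 K f) \<circ>\<^sub>F on1 F f = on1 G f \<circ>\<^sub>F lam (src1 K f)"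
    and nat2: "\<And>a x. a \<in> C2 K \<Longrightarrow> x \<in> Obj (on0 F (src1 K (src2 K a))) \<Longrightarrow>
      Fa (lam (tgt1 K (src2 K a))) (Nc (on2 F a) x) = Nc (on2 G a) (Fo (lam (src1 K (src2 K a))) x)"
  shows "two_natural K CAT F G lam"
proof -
  interpret F: two_functor K CAT F by fact
  interpret G: two_functor K CAT G by fact
  show ?thesis
  proof
    fix x assume x: "x \<in> C0 K"
    show "lam x \<in> C1 CAT \<and> src1 CAT (lam x) = on0 F x \<and> tgt1 CAT (lam x) = on0 G x"
      using comp[OF x] F.on0_closed[OF x] G.on0_closed[OF x] by (simp add: C1_CAT)
  next
    fix f assume f: "f \<in> C1 K"
    show "comp1 CAT (lam (tgt1 K f)) (on1 F f) = comp1 CAT (on1 G f) (lam (src1 K f))"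
      using nat1[OF f] by simp
  next
    fix a assume a: "a \<in> C2 K"
    let ?x = "src1 K (src2 K a)" and ?y = "tgt1 K (src2 K a)"
    have xy: "?x \<in> C0 K" "?y \<in> C0 K" using a by auto
    have s: "src2 K a \<in> C1 K" "tgt2 K a \<in> C1 K" using a by auto
    have Fa: "is_nattr (on2 F a)" "Nsrc (on2 F a) = on1 F (src2 K a)" "Ntgt (on2 F a) = on1 F (tgt2 K a)"
      using F.on2_closed[OF a] F.on2_src[OF a] F.on2_tgt[OF a] by (auto simp: C2_CAT)
    have Ga: "is_nattr (on2 G a)" "Nsrc (on2 G a) = on1 G (src2 K a)" "Ntgt (on2 G a) = on1 G (tgt2 K a)"
      using G.on2_closed[OF a] G.on2_src[OF a] G.on2_tgt[OF a] by (auto simp: C2_CAT)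
    have st: "Fsrc (on1 F (src2 K a)) = on0 F ?x" "Ftgt (on1 F (src2 K a)) = on0 F ?y"
      "Fsrc (on1 G (src2 K a)) = on0 G ?x" "Ftgt (on1 G (src2 K a)) = on0 G ?y"
      using F.on1_src[OF s(1)] F.on1_tgt[OF s(1)] G.on1_src[OF s(1)] G.on1_tgt[OF s(1)] by auto
    show "hcomp CAT (id2 CAT (lam ?y)) (on2 F a) = hcomp CAT (on2 G a) (id2 CAT (lam ?x))"
      using Fa Ga st comp[OF xy(1)] comp[OF xy(2)] nat1[OF s(1)] nat1[OF s(2)] nat2[OF a] a
      by (auto simp: nhcomp_nid_left nhcomp_nid_right intro!: restrict_ext)
  qed
qed


section \<open>Categories whose arrows are pairs of arrows\<close>

lemma pair_cat_simps [simp]: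
  "Obj (pair_cat C D p q Os As) = Os" "Arr (pair_cat C D p q Os As) = As"
  "a \<in> As \<Longrightarrow> src (pair_cat C D p q Os As) a = psrc a"
  "a \<in> As \<Longrightarrow> tgt (pair_cat C D p q Os As) a = ptgt a"
  "X \<in> Os \<Longrightarrow> idn (pair_cat C D p q Os As) X = parr X X (idn C (p X)) (idn D (q X))"
  "a \<in> As \<Longrightarrow> b \<in> As \<Longrightarrow> psrc b = ptgt a \<Longrightarrow> cmp (pair_cat C D p q Os As) b a =
    parr (psrc a) (ptgt b) (cmp C (pfst b) (pfst a)) (cmp D (psnd b) (psnd a))"
  by (simp_all add: pair_cat_def)

text \<open>In both instances \<open>R\<close> says that a square commutes. The arrow set is a
  parameter described by \<open>As_eq\<close>, so that an instance can take
  \<open>Arr (arrow_cat E)\<close> or \<open>Arr (comma P)\<close> for it and leave the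
  comprehension folded. \<open>R_cmp\<close> assumes membership in \<open>As\<close> and not just
  \<open>R\<close>, because pasting two squares uses the endpoints of their sides.\<close>

locale pair_category = C: category C + D: category D for C D :: "'u::universe ucat" +
  fixes p q :: "'u \<Rightarrow> 'u" and Os As :: "'u set" and R :: "'u \<Rightarrow> 'u \<Rightarrow> 'u \<Rightarrow> 'u \<Rightarrow> bool"
  assumes p_closed [simp]: "X \<in> Os \<Longrightarrow> p X \<in> Obj C"
    and q_closed [simp]: "X \<in> Os \<Longrightarrow> q X \<in> Obj D"
    and As_eq: "As = {parr X Y f g |X Y f g. X \<in> Os \<and> Y \<in> Os \<and>
      f \<in> hom C (p X) (p Y) \<and> g \<in> hom D (q X) (q Y) \<and> R X Y f g}"
    and R_idn: "X \<in> Os \<Longrightarrow> R X X (idn C (p X)) (idn D (q X))"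
    and R_cmp: "parr X Y f g \<in> As \<Longrightarrow> parr Y Z f' g' \<in> As \<Longrightarrow> R X Z (cmp C f' f) (cmp D g' g)"
begin

abbreviation "PC \<equiv> pair_cat C D p q Os As"

lemma parr_in_As:
  "parr X Y f g \<in> As \<longleftrightarrow> X \<in> Os \<and> Y \<in> Os \<and> f \<in> Arr C \<and> src C f = p X \<and> tgt C f = p Y \<and>
    g \<in> Arr D \<and> src D g = q X \<and> tgt D g = q Y \<and> R X Y f g"
  by (auto simp: As_eq in_hom_iff)

lemma As_E:
  assumes "a \<in> As"
  obtains X Y f g where "a = parr X Y f g" "X \<in> Os" "Y \<in> Os" "f \<in> Arr C" "src C f = p X" "tgt C f = p Y"
    "g \<in> Arr D" "src D g = q X" "tgt D g = q Y" "R X Y f g"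
  using assms by (auto simp: As_eq in_hom_iff)

lemma category: "category PC"
proof (rule categoryI, goal_cases)
  case (6 f g)
  then show ?case using R_cmp by (auto elim!: As_E simp: parr_in_As)
next
  case (7 f g)
  then have "cmp PC g f \<in> As" using R_cmp by (auto elim!: As_E simp: parr_in_As)
  then show ?case using 7 by simp
next
  case (8 f g)
  then have "cmp PC g f \<in> As" using R_cmp by (auto elim!: As_E simp: parr_in_As)
  then show ?case using 8 by simp
next
  case (9 f)
  \<comment> \<open>The identity must be known to be an arrow before the rule for \<open>cmp\<close>
    applies to it.\<close>
  have "parr X X (idn C (p X)) (idn D (q X)) \<in> As" if "X \<in> Os" for X
    using that R_idn by (simp add: parr_in_As)
  then show ?case using 9 by (auto elim!: As_E simp: parr_in_As)
next
  case (10 f)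
  have "parr X X (idn C (p X)) (idn D (q X)) \<in> As" if "X \<in> Os" for X
    using that R_idn by (simp add: parr_in_As)
  then show ?case using 10 by (auto elim!: As_E simp: parr_in_As)
next
  case (11 f g h)
  then obtain W X Y Z f1 f2 g1 g2 h1 h2 where fgh: "f = parr W X f1 f2" "g = parr X Y g1 g2" "h = parr Y Z h1 h2"
    by (auto elim!: As_E)
  have in_As: "f \<in> As" "g \<in> As" "h \<in> As" using 11 by simp_all
  have "parr W Y (cmp C g1 f1) (cmp D g2 f2) \<in> As" "parr X Z (cmp C h1 g1) (cmp D h2 g2) \<in> As"
    using R_cmp[of W X f1 f2 Y g1 g2] R_cmp[of X Y g1 g2 Z h1 h2] in_As fgh by (auto simp: parr_in_As)
  \<comment> \<open>Two passes: the first evaluates the compositions while the memberships in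
    \<open>As\<close> are intact, the second unfolds these memberships into the endpoint equations
    that \<open>assoc\<close> asks for.\<close>
  then show ?case using in_As unfolding fgh
    by (simp, simp add: parr_in_As C.assoc D.assoc)
qed (auto elim!: As_E simp: parr_in_As R_idn)

lemma normalized: "normalized PC"
  by (auto simp: normalized_def pair_cat_def)

text \<open>The code of an arrow \<open>X\<close> to \<open>Y\<close> pairs the fixed
  \<open>upair X Y\<close> with a pair from two small hom classes. The hom class therefore embeds in
  a product of a singleton with a product of small classes.\<close>

lemma locally_small:
  assumes "locally_small C" "locally_small D"
  shows "locally_small PC"
  unfolding locally_small_def
proof (intro ballI)
  fix X Y assume XY: "X \<in> Obj PC" "Y \<in> Obj PC"
  let ?H = "{upair f g |f g. f \<in> hom C (p X) (p Y) \<and> g \<in> hom D (q X) (q Y)}"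
  have "small ?H"
    using XY assms by (intro small_product) (auto simp: locally_small_def)
  then have "small {upair z h |z h. z \<in> {upair X Y} \<and> h \<in> ?H}"
    by (rule small_product[OF small_singleton])
  moreover have "hom PC X Y \<subseteq> {upair z h |z h. z \<in> {upair X Y} \<and> h \<in> ?H}"
  proof
    fix a assume "a \<in> hom PC X Y"
    then have a: "a \<in> As" "psrc a = X" "ptgt a = Y" by (auto simp: hom_def)
    then obtain f g where "a = parr X Y f g" "f \<in> hom C (p X) (p Y)" "g \<in> hom D (q X) (q Y)"
      by (auto elim!: As_E simp: in_hom_iff)
    then show "a \<in> {upair z h |z h. z \<in> {upair X Y} \<and> h \<in> ?H}"
      unfolding parr_def by blast
  qed
  ultimately show "small (hom PC X Y)" by (rule small_subset)
qed

text \<open>The endpoints of \<open>Fa F f\<close> are prescribed by \<open>Fo F\<close>, so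
  functoriality splits into that of \<open>u\<close> and that of \<open>v\<close>, while
  \<open>R\<close> places the value in \<open>As\<close>.\<close>

lemma functorI:
  assumes A: "category A" and tgt: "Ftgt F = PC" and src: "Fsrc F = A"
    and Fo: "Fo F \<in> extensional (Obj A)" and Fa: "Fa F \<in> extensional (Arr A)"
    and parr: "\<And>f. f \<in> Arr A \<Longrightarrow> Fa F f = parr (Fo F (src A f)) (Fo F (tgt A f)) (u f) (v f)"
    and obj: "\<And>x. x \<in> Obj A \<Longrightarrow> Fo F x \<in> Os"
    and u: "\<And>f. f \<in> Arr A \<Longrightarrow> u f \<in> Arr C"
      "\<And>f. f \<in> Arr A \<Longrightarrow> src C (u f) = p (Fo F (src A f))"
      "\<And>f. f \<in> Arr A \<Longrightarrow> tgt C (u f) = p (Fo F (tgt A f))"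
      "\<And>x. x \<in> Obj A \<Longrightarrow> u (idn A x) = idn C (p (Fo F x))"
      "\<And>f g. f \<in> Arr A \<Longrightarrow> g \<in> Arr A \<Longrightarrow> src A g = tgt A f \<Longrightarrow> u (cmp A g f) = cmp C (u g) (u f)"
    and v: "\<And>f. f \<in> Arr A \<Longrightarrow> v f \<in> Arr D"
      "\<And>f. f \<in> Arr A \<Longrightarrow> src D (v f) = q (Fo F (src A f))"
      "\<And>f. f \<in> Arr A \<Longrightarrow> tgt D (v f) = q (Fo F (tgt A f))"
      "\<And>x. x \<in> Obj A \<Longrightarrow> v (idn A x) = idn D (q (Fo F x))"
      "\<And>f g. f \<in> Arr A \<Longrightarrow> g \<in> Arr A \<Longrightarrow> src A g = tgt A f \<Longrightarrow> v (cmp A g f) = cmp D (v g) (v f)"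
    and R: "\<And>f. f \<in> Arr A \<Longrightarrow> R (Fo F (src A f)) (Fo F (tgt A f)) (u f) (v f)"
  shows "is_functor F"
proof -
  interpret A: category A by fact
  have arr: "Fa F f \<in> As" if "f \<in> Arr A" for f
    using that u v R obj by (simp add: parr parr_in_As)
  show ?thesis
  proof (rule is_functorI)
    fix f g assume "f \<in> Arr (Fsrc F)" "g \<in> Arr (Fsrc F)" "src (Fsrc F) g = tgt (Fsrc F) f"
    then show "Fa F (cmp (Fsrc F) g f) = cmp (Ftgt F) (Fa F g) (Fa F f)"
      using arr[of f] arr[of g] u v by (simp add: tgt src parr)
  next
    fix f assume f: "f \<in> Arr (Fsrc F)"
    show "src (Ftgt F) (Fa F f) = Fo F (src (Fsrc F) f)" "tgt (Ftgt F) (Fa F f) = Fo F (tgt (Fsrc F) f)"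
      using arr[of f] f parr[of f] by (simp_all add: tgt src)
  qed (use arr obj Fo Fa u v A category in \<open>auto simp: tgt src parr\<close>)
qed

lemma nattrI:
  assumes F: "is_functor (Nsrc t)" "Fsrc (Nsrc t) = A" "Ftgt (Nsrc t) = PC"
    and G: "is_functor (Ntgt t)" "Fsrc (Ntgt t) = A" "Ftgt (Ntgt t) = PC"
    and ext: "Nc t \<in> extensional (Obj A)"
    and parr: "\<And>x. x \<in> Obj A \<Longrightarrow> Nc t x = parr (Fo (Nsrc t) x) (Fo (Ntgt t) x) (u x) (v x)"
    and u: "\<And>x. x \<in> Obj A \<Longrightarrow> u x \<in> Arr C"
      "\<And>x. x \<in> Obj A \<Longrightarrow> src C (u x) = p (Fo (Nsrc t) x)"
      "\<And>x. x \<in> Obj A \<Longrightarrow> tgt C (u x) = p (Fo (Ntgt t) x)"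
      "\<And>f. f \<in> Arr A \<Longrightarrow> cmp C (u (tgt A f)) (pfst (Fa (Nsrc t) f)) = cmp C (pfst (Fa (Ntgt t) f)) (u (src A f))"
    and v: "\<And>x. x \<in> Obj A \<Longrightarrow> v x \<in> Arr D"
      "\<And>x. x \<in> Obj A \<Longrightarrow> src D (v x) = q (Fo (Nsrc t) x)"
      "\<And>x. x \<in> Obj A \<Longrightarrow> tgt D (v x) = q (Fo (Ntgt t) x)"
      "\<And>f. f \<in> Arr A \<Longrightarrow> cmp D (v (tgt A f)) (psnd (Fa (Nsrc t) f)) = cmp D (psnd (Fa (Ntgt t) f)) (v (src A f))"
    and R: "\<And>x. x \<in> Obj A \<Longrightarrow> R (Fo (Nsrc t) x) (Fo (Ntgt t) x) (u x) (v x)"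
  shows "is_nattr t"
proof -
  interpret A: category A using functor_category[OF F(1)] F by simp
  have obj: "Fo (Nsrc t) x \<in> Os" "Fo (Ntgt t) x \<in> Os" if "x \<in> Obj A" for x
    using functor_obj[OF F(1,3)] functor_obj[OF G(1,3)] that F G by simp_all
  have arr: "Nc t x \<in> As" if "x \<in> Obj A" for x
    using that u v R obj by (simp add: parr parr_in_As)
  \<comment> \<open>Composition in \<open>PC\<close> reads endpoints from the code, whereas
    functoriality speaks of \<open>src\<close> and \<open>tgt\<close>; on \<open>As\<close> the two
    agree.\<close>
  have fa: "Fa F f \<in> As" "psrc (Fa F f) = Fo F (src A f)" "ptgt (Fa F f) = Fo F (tgt A f)"
    if "is_functor F" "Fsrc F = A" "Ftgt F = PC" "f \<in> Arr A" for F f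
  proof -
    show "Fa F f \<in> As" using functor_arr[OF that(1,3), of f] that by simp
    then have "psrc (Fa F f) = src PC (Fa F f)" "ptgt (Fa F f) = tgt PC (Fa F f)"
      by (simp_all only: pair_cat_simps)
    then show "psrc (Fa F f) = Fo F (src A f)" "ptgt (Fa F f) = Fo F (tgt A f)"
      using that functor_arr(2,3)[OF that(1,3), of f] by auto
  qed
  show ?thesis
  proof (rule is_nattrI)
    fix f assume f: "f \<in> Arr (Fsrc (Nsrc t))"
    then show "cmp (Ftgt (Nsrc t)) (Nc t (tgt (Fsrc (Nsrc t)) f)) (Fa (Nsrc t) f) =
      cmp (Ftgt (Nsrc t)) (Fa (Ntgt t) f) (Nc t (src (Fsrc (Nsrc t)) f))"
      using arr[of "src A f"] arr[of "tgt A f"] fa[OF F, of f] fa[OF G, of f] u(4)[of f] v(4)[of f]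
      by (simp add: F parr)
  next
    fix x assume x: "x \<in> Obj (Fsrc (Nsrc t))"
    then show "src (Ftgt (Nsrc t)) (Nc t x) = Fo (Nsrc t) x" "tgt (Ftgt (Nsrc t)) (Nc t x) = Fo (Ntgt t) x"
      using arr[of x] parr[of x] F by simp_all
  qed (use F G ext arr in auto)
qed

end


section \<open>The squaring 2-monad\<close>

lemma pair_category_arrow_cat:
  assumes "category E"
  shows "pair_category E E (src E) (tgt E) (Arr E) (Arr (arrow_cat E)) (\<lambda>f g r s. cmp E s f = cmp E g r)"
proof -
  interpret E: category E by fact
  show ?thesis
  proof
    fix X Y f g Z f' g'
    assume "parr X Y f g \<in> Arr (arrow_cat E)" "parr Y Z f' g' \<in> Arr (arrow_cat E)"
    then have a: "X \<in> Arr E" "Y \<in> Arr E" "f \<in> Arr E" "g \<in> Arr E" "Z \<in> Arr E" "f' \<in> Arr E" "g' \<in> Arr E"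
       "src E f = src E X" "tgt E f = src E Y" "src E g = tgt E X" "tgt E g = tgt E Y"
       "src E f' = src E Y" "tgt E f' = src E Z" "src E g' = tgt E Y" "tgt E g' = tgt E Z"
       "cmp E g X = cmp E Y f" "cmp E g' Y = cmp E Z f'"
      by (auto simp: arrow_cat_def in_hom_iff)
    \<comment> \<open>Two squares are pasted along \<open>Y\<close>. The equation of the second
      square is kept out of this step, so that \<open>cmp E g' Y\<close> survives until the next
      one.\<close>
    have "cmp E (cmp E g' g) X = cmp E (cmp E g' Y) f"
      using a(1-16) by (simp add: E.assoc)
    then show "cmp E (cmp E g' g) X = cmp E Z (cmp E f' f)"
      using a by (simp add: E.assoc)
  qed (auto simp: arrow_cat_def)
qed

text \<open>The right-hand side mentions \<open>arrow_cat E\<close> again, so this is not a default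
  rewrite rule. It exhibits \<open>arrow_cat E\<close> as the category \<open>PC\<close> of an
  instance of \<open>pair_category\<close>.\<close>

lemma arrow_cat_pair_cat: "arrow_cat E = pair_cat E E (src E) (tgt E) (Arr E) (Arr (arrow_cat E))"
  by (simp add: arrow_cat_def)

lemma arrow_cat_arrE:
  assumes "a \<in> Arr (arrow_cat E)"
  obtains f g r s where "a = parr f g r s" "f \<in> Arr E" "g \<in> Arr E"
    "r \<in> Arr E" "src E r = src E f" "tgt E r = src E g"
    "s \<in> Arr E" "src E s = tgt E f" "tgt E s = tgt E g" "cmp E s f = cmp E g r"
  using assms by (auto simp: arrow_cat_def in_hom_iff)

lemma arrow_cat_simps [simp]:
  "Obj (arrow_cat E) = Arr E"
  "a \<in> Arr (arrow_cat E) \<Longrightarrow> src (arrow_cat E) a = psrc a"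
  "a \<in> Arr (arrow_cat E) \<Longrightarrow> tgt (arrow_cat E) a = ptgt a"
  "f \<in> Arr E \<Longrightarrow> idn (arrow_cat E) f = parr f f (idn E (src E f)) (idn E (tgt E f))"
  "a \<in> Arr (arrow_cat E) \<Longrightarrow> b \<in> Arr (arrow_cat E) \<Longrightarrow> psrc b = ptgt a \<Longrightarrow> cmp (arrow_cat E) b a =
    parr (psrc a) (ptgt b) (cmp E (pfst b) (pfst a)) (cmp E (psnd b) (psnd a))"
  by (subst arrow_cat_pair_cat, simp)+

lemma arrow_cat_arr:
  assumes "a \<in> Arr (arrow_cat E)"
  shows "psrc a \<in> Arr E" "ptgt a \<in> Arr E"
    "pfst a \<in> Arr E" "src E (pfst a) = src E (psrc a)" "tgt E (pfst a) = src E (ptgt a)"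
    "psnd a \<in> Arr E" "src E (psnd a) = tgt E (psrc a)" "tgt E (psnd a) = tgt E (ptgt a)"
    "cmp E (psnd a) (psrc a) = cmp E (ptgt a) (pfst a)"
    "parr (psrc a) (ptgt a) (pfst a) (psnd a) = a"
  using assms by (auto elim!: arrow_cat_arrE)

lemma arrow_cat_category [simp]: "category E \<Longrightarrow> category (arrow_cat E)"
  by (subst arrow_cat_pair_cat) (rule pair_category.category[OF pair_category_arrow_cat])

lemma arrow_cat_C0:
  assumes "E \<in> C0 CAT"
  shows "arrow_cat E \<in> C0 CAT"
proof -
  interpret pair_category E E "src E" "tgt E" "Arr E" "Arr (arrow_cat E)" "\<lambda>f g r s. cmp E s f = cmp E g r"
    using assms by (intro pair_category_arrow_cat) (simp add: C0_CAT)
  show ?thesis using assms category normalized locally_small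
    by (simp add: C0_CAT flip: arrow_cat_pair_cat)
qed

section \<open>Squaring on functors and natural transformations\<close>

lemma arrow_fun_simps [simp]:
  "Fsrc (arrow_fun T) = arrow_cat (Fsrc T)" "Ftgt (arrow_fun T) = arrow_cat (Ftgt T)"
  "f \<in> Arr (Fsrc T) \<Longrightarrow> Fo (arrow_fun T) f = Fa T f"
  "a \<in> Arr (arrow_cat (Fsrc T)) \<Longrightarrow> Fa (arrow_fun T) a =
     parr (Fa T (psrc a)) (Fa T (ptgt a)) (Fa T (pfst a)) (Fa T (psnd a))"
  by (simp_all add: arrow_fun_def)

lemma arrow_fun_functor [simp]:
  assumes T: "is_functor T"
  shows "is_functor (arrow_fun T)"
proof -
  interpret E: category "Fsrc T" using functor_category[OF T] by simp
  interpret E': category "Ftgt T" using functor_category[OF T] by simp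
  interpret pair_category "Ftgt T" "Ftgt T" "src (Ftgt T)" "tgt (Ftgt T)" "Arr (Ftgt T)"
      "Arr (arrow_cat (Ftgt T))" "\<lambda>f g r s. cmp (Ftgt T) s f = cmp (Ftgt T) g r"
    by (intro pair_category_arrow_cat E'.category_axioms)
  have cmp: "cmp (arrow_cat (Fsrc T)) b a \<in> Arr (arrow_cat (Fsrc T))"
    if "a \<in> Arr (arrow_cat (Fsrc T))" "b \<in> Arr (arrow_cat (Fsrc T))" "psrc b = ptgt a" for a b
    using that category.cmp_simps[OF arrow_cat_category[OF E.category_axioms]] by simp
  show ?thesis
  proof (rule functorI[where A = "arrow_cat (Fsrc T)" and u = "\<lambda>a. Fa T (pfst a)" and v = "\<lambda>a. Fa T (psnd a)"])
    fix a assume "a \<in> Arr (arrow_cat (Fsrc T))"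
    note a = this arrow_cat_arr[OF this]
    have "Fa T (cmp (Fsrc T) (psnd a) (psrc a)) = Fa T (cmp (Fsrc T) (ptgt a) (pfst a))"
      using a by simp
    then show "cmp (Ftgt T) (Fa T (psnd a)) (Fo (arrow_fun T) (src (arrow_cat (Fsrc T)) a)) =
         cmp (Ftgt T) (Fo (arrow_fun T) (tgt (arrow_cat (Fsrc T)) a)) (Fa T (pfst a))"
      using T a(1-9) by simp
  qed (use T arrow_cat_pair_cat E.category_axioms in \<open>auto simp: arrow_cat_arr\<close>,
       auto simp: arrow_fun_def)
qed

lemma arrow_nattr_simps [simp]:
  "Nsrc (arrow_nattr b) = arrow_fun (Nsrc b)" "Ntgt (arrow_nattr b) = arrow_fun (Ntgt b)"
  "f \<in> Arr (Fsrc (Nsrc b)) \<Longrightarrow> Nc (arrow_nattr b) f =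
    parr (Fa (Nsrc b) f) (Fa (Ntgt b) f) (Nc b (src (Fsrc (Nsrc b)) f)) (Nc b (tgt (Fsrc (Nsrc b)) f))"
  by (simp_all add: arrow_nattr_def Let_def)

text \<open>The component at an object \<open>f\<close> of the arrow category is the naturality
  square of \<open>b\<close> at \<open>f\<close>, so the relation \<open>R\<close> there is
  naturality of \<open>b\<close>. Naturality in \<open>f\<close> is naturality of \<open>b\<close>
  again, at the two sides of a square.\<close>

lemma arrow_nattr_nattr [simp]:
  assumes b: "is_nattr b"
  shows "is_nattr (arrow_nattr b)"
proof -
  note F = nattr_functor[OF b]
  let ?E = "Fsrc (Nsrc b)" and ?D = "Ftgt (Nsrc b)"
  interpret E: category ?E using functor_category[OF F(1)] by simp
  interpret E': category ?D using functor_category[OF F(1)] by simp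
  interpret pair_category ?D ?D "src ?D" "tgt ?D" "Arr ?D"
      "Arr (arrow_cat ?D)" "\<lambda>f g r s. cmp ?D s f = cmp ?D g r"
    by (intro pair_category_arrow_cat E'.category_axioms)
  have natural: "cmp ?D (Nc b y) (Fa (Nsrc b) f) = cmp ?D (Fa (Ntgt b) f) (Nc b x)"
    if "f \<in> Arr ?E" "src ?E f = x" "tgt ?E f = y" for f x y
    using nattr_natural[OF b refl, of f x y] that by simp
  show ?thesis
    by (rule nattrI[where A = "arrow_cat ?E" and u = "\<lambda>f. Nc b (src ?E f)" and v = "\<lambda>f. Nc b (tgt ?E f)"])
      (use b F natural arrow_cat_pair_cat in \<open>auto simp: arrow_cat_arr\<close>,
       auto simp: arrow_nattr_def Let_def)
qed

lemma Squaring_simps [simp]: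
  "on0 (endo Squaring) = arrow_cat" "on1 (endo Squaring) = arrow_fun" "on2 (endo Squaring) = arrow_nattr"
  "unit Squaring = I_fun" "mult Squaring = m_fun"
  by (simp_all add: Squaring_def)

lemma Squaring_endo: "two_functor CAT CAT (endo Squaring)"
proof -
  interpret two_category CAT by (rule CAT)
  show ?thesis
  proof (unfold_locales, goal_cases)
    \<comment> \<open>Goals 8 to 12 are preservation of identity 1-cells, identity 2-cells,
      composites of 1-cells, vertical composites and horizontal composites; those before them
      concern closure and endpoints.\<close>
    case (8 C)
    then interpret C: category C by (simp add: C0_CAT)
    show ?case by (auto intro!: func_eqI simp: C.category_axioms arrow_cat_arr)
  next
    case (9 F)
    then have F: "is_functor F" by (simp add: C1_CAT)
    interpret C: category "Fsrc F" using functor_category[OF F] by simp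
    show ?case using F by (auto intro!: nattr_eqI)
  next
    case (10 F G)
    then have F: "is_functor F" "is_functor G" "Fsrc G = Ftgt F" by (simp_all add: C1_CAT)
    then show ?case using functor_arr[OF arrow_fun_functor[OF F(1)] refl]
      by (auto intro!: func_eqI simp: arrow_cat_arr)
  next
    case (11 a b)
    then have t: "is_nattr a" "is_nattr b" "Nsrc b = Ntgt a" by (simp_all add: C2_CAT)
    note F = nattr_functor[OF t(1)] nattr_functor[OF t(2)]
    interpret C: category "Fsrc (Nsrc a)" using functor_category[OF F(1)] by simp
    show ?case using t F nattr_arr[OF arrow_nattr_nattr[OF t(1)] refl]
       nattr_arr[OF arrow_nattr_nattr[OF t(2)] refl] by (auto intro!: nattr_eqI)
  next
    case (12 a b)
    then have t: "is_nattr a" "is_nattr b" "Fsrc (Nsrc b) = Ftgt (Nsrc a)" by (simp_all add: C2_CAT)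
    note F = nattr_functor[OF t(1)] nattr_functor[OF t(2)]
    interpret C: category "Fsrc (Nsrc a)" using functor_category[OF F(1)] by simp
    have comp: "arrow_fun (G \<circ>\<^sub>F H) = arrow_fun G \<circ>\<^sub>F arrow_fun H"
      if "is_functor H" "is_functor G" "Fsrc G = Ftgt H" for G H :: "'a func"
      using that functor_arr[OF arrow_fun_functor[OF that(1)] refl]
      by (auto intro!: func_eqI simp: arrow_cat_arr)
    show ?case
    proof (rule nattr_eqI)
      fix f assume "f \<in> Obj (Fsrc (Nsrc (on2 (endo Squaring) (hcomp CAT b a))))"
      then have f: "f \<in> Arr (Fsrc (Nsrc a))" by simp
      \<comment> \<open>The horizontal composite is evaluated in an arrow category, so its factors
        must first be recognised as arrows there. For the image under
        \<open>arrow_fun (Nsrc b)\<close> the evaluation rules are deleted, so that it is still seen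
        as the value of a functor.\<close>
      have "Nc (arrow_nattr a) f \<in> Arr (arrow_cat (Ftgt (Nsrc a)))"
        using nattr_arr[OF arrow_nattr_nattr[OF t(1)] refl, of f] f by simp
      moreover from this have "Fa (arrow_fun (Nsrc b)) (Nc (arrow_nattr a) f) \<in> Arr (arrow_cat (Ftgt (Nsrc b)))"
        using F t by (simp del: arrow_fun_simps(4) arrow_nattr_simps(3))
      moreover have "Nc (arrow_nattr b) (Fa (Ntgt a) f) \<in> Arr (arrow_cat (Ftgt (Nsrc b)))"
        using nattr_arr[OF arrow_nattr_nattr[OF t(2)] refl, of "Fa (Ntgt a) f"] f t F by simp
      ultimately show "Nc (on2 (endo Squaring) (hcomp CAT b a)) f =
        Nc (hcomp CAT (on2 (endo Squaring) b) (on2 (endo Squaring) a)) f"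
        using t F f by simp
    qed (use t F in \<open>auto simp: comp\<close>)
  qed (auto simp: C1_CAT C2_CAT arrow_cat_C0)
qed

section \<open>Unit and multiplication of squaring, and their naturality\<close>

lemma I_fun_simps [simp]:
  "Fsrc (I_fun E) = E" "Ftgt (I_fun E) = arrow_cat E"
  "x \<in> Obj E \<Longrightarrow> Fo (I_fun E) x = idn E x"
  "f \<in> Arr E \<Longrightarrow> Fa (I_fun E) f = parr (idn E (src E f)) (idn E (tgt E f)) f f"
  by (simp_all add: I_fun_def)

lemma I_fun_functor [simp]:
  assumes "category E"
  shows "is_functor (I_fun E)"
proof -
  interpret E: category E by fact
  interpret pair_category E E "src E" "tgt E" "Arr E" "Arr (arrow_cat E)" "\<lambda>f g r s. cmp E s f = cmp E g r"
    by (intro pair_category_arrow_cat E.category_axioms)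
  show ?thesis
    by (rule functorI[where A = E and u = "\<lambda>f. f" and v = "\<lambda>f. f"])
      (use E.category_axioms arrow_cat_pair_cat in auto, auto simp: I_fun_def)
qed

text \<open>Such an arrow is a commutative cube. \<open>psrc a\<close>, \<open>ptgt a\<close>,
  \<open>pfst a\<close> and \<open>psnd a\<close> are four of its faces; the commutation condition
  between them, taken in each component, gives the remaining two.\<close>

lemma arrow_cat2_arr:
  assumes "a \<in> Arr (arrow_cat (arrow_cat E))"
  shows "psrc (pfst a) = psrc (psrc a)" "ptgt (pfst a) = psrc (ptgt a)"
    "psrc (psnd a) = ptgt (psrc a)" "ptgt (psnd a) = ptgt (ptgt a)"
    "cmp E (pfst (psnd a)) (pfst (psrc a)) = cmp E (pfst (ptgt a)) (pfst (pfst a))"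
    "cmp E (psnd (psnd a)) (psnd (psrc a)) = cmp E (psnd (ptgt a)) (psnd (pfst a))"
proof -
  note a = arrow_cat_arr[OF assms]
  show 1: "psrc (pfst a) = psrc (psrc a)" "ptgt (pfst a) = psrc (ptgt a)"
    "psrc (psnd a) = ptgt (psrc a)" "ptgt (psnd a) = ptgt (ptgt a)"
    using a(4,5,7,8) a(1-3,6) by simp_all
  show "cmp E (pfst (psnd a)) (pfst (psrc a)) = cmp E (pfst (ptgt a)) (pfst (pfst a))"
    "cmp E (psnd (psnd a)) (psnd (psrc a)) = cmp E (psnd (ptgt a)) (psnd (pfst a))"
    using a(9) a(1-3,6) 1 by simp_all
qed

lemma m_fun_simps [simp]:
  "Fsrc (m_fun E) = arrow_cat (arrow_cat E)" "Ftgt (m_fun E) = arrow_cat E"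
  "z \<in> Arr (arrow_cat E) \<Longrightarrow> Fo (m_fun E) z = cmp E (psnd z) (psrc z)"
  "a \<in> Arr (arrow_cat (arrow_cat E)) \<Longrightarrow> Fa (m_fun E) a =
    parr (cmp E (psnd (psrc a)) (psrc (psrc a))) (cmp E (psnd (ptgt a)) (psrc (ptgt a)))
      (pfst (pfst a)) (psnd (psnd a))"
  by (simp_all add: m_fun_def m_obj_def)

lemma m_fun_functor [simp]:
  assumes "category E"
  shows "is_functor (m_fun E)"
proof -
  interpret E: category E by fact
  interpret pair_category E E "src E" "tgt E" "Arr E" "Arr (arrow_cat E)" "\<lambda>f g r s. cmp E s f = cmp E g r"
    by (intro pair_category_arrow_cat E.category_axioms)
  show ?thesis
  proof (rule functorI[where A = "arrow_cat (arrow_cat E)" and u = "\<lambda>a. pfst (pfst a)" and v = "\<lambda>a. psnd (psnd a)"])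
    fix a assume "a \<in> Arr (arrow_cat (arrow_cat E))"
    note a = this arrow_cat_arr[OF this] arrow_cat2_arr[OF this]
    note b = arrow_cat_arr(1-8)[OF a(2)] arrow_cat_arr(1-8)[OF a(3)] arrow_cat_arr(1-8)[OF a(4)] arrow_cat_arr(1-8)[OF a(7)]
    \<comment> \<open>The square between the two diagonals is pasted from the face of the cube
      formed by the second components and the face \<open>pfst a\<close>.\<close>
    have "cmp E (psnd (psnd a)) (cmp E (psnd (psrc a)) (psrc (psrc a))) =
        cmp E (cmp E (psnd (psnd a)) (psnd (psrc a))) (psrc (psrc a))"
      using a(1,2,3,4,7,12-15) b by (simp add: E.assoc)
    also have "\<dots> = cmp E (psnd (ptgt a)) (cmp E (psnd (pfst a)) (psrc (pfst a)))"
      unfolding a(17) using a(1,2,3,4,7,12-15) b by (simp add: E.assoc)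
    also have "\<dots> = cmp E (cmp E (psnd (ptgt a)) (psrc (ptgt a))) (pfst (pfst a))"
      unfolding arrow_cat_arr(9)[OF a(4)] using a(1,2,3,4,7,12-15) b by (simp add: E.assoc)
    finally show "cmp E (psnd (psnd a)) (Fo (m_fun E) (src (arrow_cat (arrow_cat E)) a)) =
         cmp E (Fo (m_fun E) (tgt (arrow_cat (arrow_cat E)) a)) (pfst (pfst a))"
      using a(1-4) by simp
  qed (use E.category_axioms arrow_cat_pair_cat in \<open>auto simp: arrow_cat_arr arrow_cat2_arr\<close>,
       auto simp: m_fun_def)
qed

text \<open>Membership in \<open>Arr (arrow_cat E)\<close> guards the rewrite rules of that
  category. This form supplies it for a value that is still folded, before the simplifier evaluates
  the functor.\<close>

lemma functor_arr_arrow_cat: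
  assumes "is_functor F" "Ftgt F = arrow_cat E" "a \<in> Arr (Fsrc F)"
  shows "Fa F a \<in> Arr (arrow_cat E)"
  using assms by simp

lemma I_natural: "two_natural CAT CAT tfid (endo Squaring) (unit Squaring)"
proof (rule CAT_two_naturalI)
  show "two_functor CAT CAT tfid" by (rule two_category.tfid[OF CAT])
next
  fix F :: "'a func" assume "F \<in> C1 CAT"
  then have F: "is_functor F" by (simp add: C1_CAT)
  interpret S: category "Fsrc F" using functor_category[OF F] by simp
  interpret T: category "Ftgt F" using functor_category[OF F] by simp
  have "parr (idn (Fsrc F) (src (Fsrc F) f)) (idn (Fsrc F) (tgt (Fsrc F) f)) f f \<in> Arr (arrow_cat (Fsrc F))"
    if "f \<in> Arr (Fsrc F)" for f
    using functor_arr(1)[OF I_fun_functor[OF S.category_axioms] refl] that by simp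
  then show "unit Squaring (tgt1 CAT F) \<circ>\<^sub>F on1 tfid F = on1 (endo Squaring) F \<circ>\<^sub>F unit Squaring (src1 CAT F)"
    using F S.category_axioms T.category_axioms by (auto intro!: func_eqI)
next
  fix a :: "'a nattr" and x
  assume a: "a \<in> C2 CAT" and x: "x \<in> Obj (on0 tfid (src1 CAT (src2 CAT a)))"
  then have t: "is_nattr a" by (simp add: C2_CAT)
  note F = nattr_functor[OF t]
  interpret S: category "Fsrc (Nsrc a)" using functor_category[OF F(1)] by simp
  interpret T: category "Ftgt (Nsrc a)" using functor_category[OF F(1)] by simp
  show "Fa (unit Squaring (tgt1 CAT (src2 CAT a))) (Nc (on2 tfid a) x) =
        Nc (on2 (endo Squaring) a) (Fo (unit Squaring (src1 CAT (src2 CAT a))) x)"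
    using x t F by simp
qed (auto simp: Squaring_endo C0_CAT)

text \<open>A functor preserves composites, hence sends diagonals to diagonals. On 2-cells, the
  component at a square \<open>z\<close> is a cube, from which the multiplication retains the
  components of \<open>a\<close> at the initial and the terminal vertex of \<open>z\<close>.\<close>

lemma m_natural: "two_natural CAT CAT (endo Squaring \<circ>\<^sub>2 endo Squaring) (endo Squaring) (mult Squaring)"
proof (rule CAT_two_naturalI)
  show "two_functor CAT CAT (endo Squaring \<circ>\<^sub>2 endo Squaring)" by (rule tfcomp[OF Squaring_endo Squaring_endo])
next
  fix F :: "'a func" assume "F \<in> C1 CAT"
  then have F: "is_functor F" by (simp add: C1_CAT)
  interpret S: category "Fsrc F" using functor_category[OF F] by simp
  interpret T: category "Ftgt F" using functor_category[OF F] by simp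
  have 1: "parr (Fa F (psrc z)) (Fa F (ptgt z)) (Fa F (pfst z)) (Fa F (psnd z)) \<in> Arr (arrow_cat (Ftgt F))"
    if "z \<in> Arr (arrow_cat (Fsrc F))" for z
    using functor_arr_arrow_cat[OF arrow_fun_functor[OF F] _, of "Ftgt F" z] that by simp
  have 2: "Fa (arrow_fun (arrow_fun F)) z \<in> Arr (arrow_cat (arrow_cat (Ftgt F)))"
    if "z \<in> Arr (arrow_cat (arrow_cat (Fsrc F)))" for z
    using functor_arr_arrow_cat[OF arrow_fun_functor[OF arrow_fun_functor[OF F]] _, of "arrow_cat (Ftgt F)" z] that by simp
  have 3: "Fa (m_fun (Fsrc F)) z \<in> Arr (arrow_cat (Fsrc F))"
    if "z \<in> Arr (arrow_cat (arrow_cat (Fsrc F)))" for z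
    using functor_arr_arrow_cat[OF m_fun_functor[OF S.category_axioms] _, of "Fsrc F" z] that by simp
  show "mult Squaring (tgt1 CAT F) \<circ>\<^sub>F on1 (endo Squaring \<circ>\<^sub>2 endo Squaring) F =
        on1 (endo Squaring) F \<circ>\<^sub>F mult Squaring (src1 CAT F)"
  proof (rule func_eqI)
    fix a assume "a \<in> Arr (Fsrc (mult Squaring (tgt1 CAT F) \<circ>\<^sub>F on1 (endo Squaring \<circ>\<^sub>2 endo Squaring) F))"
    then have "a \<in> Arr (arrow_cat (arrow_cat (Fsrc F)))" by simp
    note a = this 2[OF this] 3[OF this] arrow_cat_arr(1-9)[OF this] arrow_cat2_arr[OF this]
    note b = arrow_cat_arr(1-8)[OF a(4)] arrow_cat_arr(1-8)[OF a(5)] arrow_cat_arr(1-8)[OF a(6)] arrow_cat_arr(1-8)[OF a(9)]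
    show "Fa (mult Squaring (tgt1 CAT F) \<circ>\<^sub>F on1 (endo Squaring \<circ>\<^sub>2 endo Squaring) F) a =
      Fa (on1 (endo Squaring) F \<circ>\<^sub>F mult Squaring (src1 CAT F)) a"
      using F a b by simp
  qed (use F S.category_axioms T.category_axioms 1 in \<open>auto simp: arrow_cat_arr(1-8)\<close>)
next
  fix a :: "'a nattr" and z
  assume a: "a \<in> C2 CAT" and "z \<in> Obj (on0 (endo Squaring \<circ>\<^sub>2 endo Squaring) (src1 CAT (src2 CAT a)))"
  then have t: "is_nattr a" and z: "z \<in> Arr (arrow_cat (Fsrc (Nsrc a)))" by (simp_all add: C2_CAT)
  note F = nattr_functor[OF t]
  note z' = arrow_cat_arr(1-8)[OF z]
  interpret S: category "Fsrc (Nsrc a)" using functor_category[OF F(1)] by simp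
  interpret T: category "Ftgt (Nsrc a)" using functor_category[OF F(1)] by simp
  have "Nc (arrow_nattr (arrow_nattr a)) z \<in> Arr (arrow_cat (arrow_cat (Ftgt (Nsrc a))))"
    using nattr_arr(1)[OF arrow_nattr_nattr[OF arrow_nattr_nattr[OF t]] refl, of z] z by simp
  then show "Fa (mult Squaring (tgt1 CAT (src2 CAT a))) (Nc (on2 (endo Squaring \<circ>\<^sub>2 endo Squaring) a) z) =
        Nc (on2 (endo Squaring) a) (Fo (mult Squaring (src1 CAT (src2 CAT a))) z)"
    using z z' t F by simp
qed (auto simp: Squaring_endo C0_CAT)

section \<open>Monad laws of squaring\<close>

lemma Squaring: "two_monad CAT Squaring"
proof (rule two_monad.intro[OF CAT], rule two_monad_axioms.intro)
  fix E :: "'a ucat" assume "E \<in> C0 CAT"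
  then have cat: "category E" by (simp add: C0_CAT)
  interpret E: category E by (rule cat)
  have 1: "Fa (I_fun (arrow_cat E)) a \<in> Arr (arrow_cat (arrow_cat E))" if "a \<in> Arr (arrow_cat E)" for a
    using functor_arr_arrow_cat[of "I_fun (arrow_cat E)" "arrow_cat E" a] that cat by simp
  have 2: "Fa (arrow_fun (I_fun E)) a \<in> Arr (arrow_cat (arrow_cat E))" if "a \<in> Arr (arrow_cat E)" for a
    using functor_arr_arrow_cat[of "arrow_fun (I_fun E)" "arrow_cat E" a] that cat by simp
  have 3: "Fo (I_fun (arrow_cat E)) f \<in> Arr (arrow_cat E)" "Fa (I_fun E) f \<in> Arr (arrow_cat E)" if "f \<in> Arr E" for f
    using functor_obj[of "I_fun (arrow_cat E)" "arrow_cat (arrow_cat E)" f] functor_arr_arrow_cat[of "I_fun E" E f] that cat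
    by simp_all
  \<comment> \<open>The identity square on \<open>f\<close> has diagonal \<open>1 f\<close>; in the
    next law, the square \<open>(f, f)\<close> between identities has diagonal
    \<open>f 1\<close>.\<close>
  show "comp1 CAT (mult Squaring E) (unit Squaring (on0 (endo Squaring) E)) = id1 CAT (on0 (endo Squaring) E)"
    using cat 1 3 by (auto intro!: func_eqI simp: arrow_cat_arr)
  show "comp1 CAT (mult Squaring E) (on1 (endo Squaring) (unit Squaring E)) = id1 CAT (on0 (endo Squaring) E)"
    using cat 2 3 by (auto intro!: func_eqI simp: arrow_cat_arr)
  have 4: "Fa (m_fun E) z \<in> Arr (arrow_cat E)" "Fo (m_fun (arrow_cat E)) z \<in> Arr (arrow_cat E)"
    if "z \<in> Arr (arrow_cat (arrow_cat E))" for z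
    using functor_arr_arrow_cat[of "m_fun E" E z] functor_obj[of "m_fun (arrow_cat E)" "arrow_cat (arrow_cat E)" z] that cat
    by simp_all
  have 5: "Fa (m_fun (arrow_cat E)) z \<in> Arr (arrow_cat (arrow_cat E))"
      "Fa (arrow_fun (m_fun E)) z \<in> Arr (arrow_cat (arrow_cat E))"
    if "z \<in> Arr (arrow_cat (arrow_cat (arrow_cat E)))" for z
    using functor_arr_arrow_cat[of "m_fun (arrow_cat E)" "arrow_cat E" z] functor_arr_arrow_cat[of "arrow_fun (m_fun E)" "arrow_cat E" z] that cat
    by simp_all
  show "comp1 CAT (mult Squaring E) (mult Squaring (on0 (endo Squaring) E)) =
         comp1 CAT (mult Squaring E) (on1 (endo Squaring) (mult Squaring E))"
  proof (rule func_eqI)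
    \<comment> \<open>The object \<open>z\<close> is a commutative cube, and either order of taking
      diagonals yields the composite from its initial to its terminal vertex.\<close>
    have obj: "cmp E (psnd (cmp (arrow_cat E) (psnd z) (psrc z))) (psrc (cmp (arrow_cat E) (psnd z) (psrc z))) =
        cmp E (psnd (psnd z)) (cmp E (psnd (psrc z)) (psrc (psrc z)))"
      if "z \<in> Arr (arrow_cat (arrow_cat E))" for z
      using that arrow_cat_arr(1-8)[OF that] arrow_cat2_arr(1-4)[OF that] arrow_cat_arr(1-8)[of "psrc z" E] arrow_cat_arr(1-8)[of "psnd z" E]
      by (simp add: E.assoc)
    show "Fo (comp1 CAT (mult Squaring E) (mult Squaring (on0 (endo Squaring) E))) z =
       Fo (comp1 CAT (mult Squaring E) (on1 (endo Squaring) (mult Squaring E))) z"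
      if "z \<in> Obj (Fsrc (comp1 CAT (mult Squaring E) (mult Squaring (on0 (endo Squaring) E))))" for z
      using obj[of z] that 4[of z] by simp
    show "Fa (comp1 CAT (mult Squaring E) (mult Squaring (on0 (endo Squaring) E))) a =
       Fa (comp1 CAT (mult Squaring E) (on1 (endo Squaring) (mult Squaring E))) a"
      if "a \<in> Arr (Fsrc (comp1 CAT (mult Squaring E) (mult Squaring (on0 (endo Squaring) E))))" for a
    proof -
      have a: "a \<in> Arr (arrow_cat (arrow_cat (arrow_cat E)))" using that by simp
      show ?thesis using a 5[OF a] obj[of "psrc a"] obj[of "ptgt a"]
          arrow_cat_arr[OF a] arrow_cat2_arr[OF a]
        by simp
    qed
  qed (use cat in simp_all)
qed (use I_natural m_natural in simp_all)


section \<open>2-functors into an arrow 2-category\<close>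

text \<open>The counterpart of \<open>dom_2functor\<close>: a cell of the arrow 2-category with
  given boundary is determined by its images under the two projections.\<close>

definition cod_2functor ::
    "('o, 'm, 'c) twocat \<Rightarrow> ('m, 'm sq1, ('m, 'c) sq2, 'o, 'm, 'c) twofun" where
  "cod_2functor K = \<lparr>on0 = tgt1 K, on1 = bot1, on2 = bot2\<rparr>"

lemma cod_2functor_simps [simp]:
  "on0 (cod_2functor K) = tgt1 K" "on1 (cod_2functor K) = bot1" "on2 (cod_2functor K) = bot2"
  by (simp_all add: cod_2functor_def)

lemma dom_2functor_simps [simp]:
  "on0 (dom_2functor K) = src1 K" "on1 (dom_2functor K) = top1" "on2 (dom_2functor K) = top2"
  by (simp_all add: dom_2functor_def)

lemma (in two_category) cod_2functor: "two_functor (arrow_2cat K) K (cod_2functor K)"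
proof -
  interpret A: two_category "arrow_2cat K" by (rule arrow_2cat)
  show ?thesis by unfold_locales (auto simp: arrow_cells1D arrow_cells2D)
qed

text \<open>The projections detect equality of cells with equal boundary, so the equational axioms
  come from \<open>dom\<close> and \<open>cod\<close>. The \<open>cells\<close> hypotheses provide
  the boundaries and the commutation conditions.\<close>

lemma arrow_two_functorI:
  assumes dom: "two_functor K L (dom_2functor L \<circ>\<^sub>2 F)" and cod: "two_functor K L (cod_2functor L \<circ>\<^sub>2 F)"
    and cells0: "\<And>x. x \<in> C0 K \<Longrightarrow> on0 F x \<in> C1 L"
    and cells1: "\<And>f. f \<in> C1 K \<Longrightarrow> on1 F f \<in> arrow_cells1 L"
      "\<And>f. f \<in> C1 K \<Longrightarrow> dom1 (on1 F f) = on0 F (src1 K f)"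
      "\<And>f. f \<in> C1 K \<Longrightarrow> cod1 (on1 F f) = on0 F (tgt1 K f)"
    and cells2: "\<And>a. a \<in> C2 K \<Longrightarrow> on2 F a \<in> arrow_cells2 L"
      "\<And>a. a \<in> C2 K \<Longrightarrow> dom2 (on2 F a) = on1 F (src2 K a)"
      "\<And>a. a \<in> C2 K \<Longrightarrow> cod2 (on2 F a) = on1 F (tgt2 K a)"
  shows "two_functor K (arrow_2cat L) F"
proof -
  interpret P: two_functor K L "dom_2functor L \<circ>\<^sub>2 F" by (rule dom)
  interpret Q: two_functor K L "cod_2functor L \<circ>\<^sub>2 F" by (rule cod)
  interpret A: two_category "arrow_2cat L" by (rule P.L.arrow_2cat)
  have comp1: "on1 F (comp1 K g f) = arrow_comp1 L (on1 F g) (on1 F f)"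
    if "f \<in> C1 K" "g \<in> C1 K" "tgt1 K f = src1 K g" for f g
    using that P.on1_comp1[OF that] Q.on1_comp1[OF that] by (auto simp: cells1 intro!: sq1_eqI)
  show ?thesis
  proof (unfold_locales, goal_cases)
    case (8 x)
    then show ?case using P.on1_id1[of x] Q.on1_id1[of x] by (auto simp: cells1 intro!: sq1_eqI)
  next
    case (9 f)
    then show ?case using P.on2_id2[of f] Q.on2_id2[of f] by (auto simp: cells2 intro!: sq2_eqI)
  next
    case (10 f g)
    then show ?case using comp1 by simp
  next
    case (11 a b)
    then show ?case using P.on2_vcomp[of a b] Q.on2_vcomp[of a b]
      by (auto simp: cells2 intro!: sq2_eqI)
  next
    case (12 a b)
    then show ?case using P.on2_hcomp[of a b] Q.on2_hcomp[of a b]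
      by (auto simp: cells2 comp1 intro!: sq2_eqI)
  qed (auto simp: cells0 cells1 cells2)
qed

lemma arrow_two_naturalI:
  assumes F: "two_functor K (arrow_2cat L) F" and G: "two_functor K (arrow_2cat L) G"
    and cell: "\<And>x. x \<in> C0 K \<Longrightarrow> lam x \<in> arrow_cells1 L \<and> dom1 (lam x) = on0 F x \<and> cod1 (lam x) = on0 G x"
    and dom: "two_natural K L (dom_2functor L \<circ>\<^sub>2 F) (dom_2functor L \<circ>\<^sub>2 G) (\<lambda>x. top1 (lam x))"
    and cod: "two_natural K L (cod_2functor L \<circ>\<^sub>2 F) (cod_2functor L \<circ>\<^sub>2 G) (\<lambda>x. bot1 (lam x))"
  shows "two_natural K (arrow_2cat L) F G lam"
proof -
  interpret F: two_functor K "arrow_2cat L" F by (rule F)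
  interpret G: two_functor K "arrow_2cat L" G by (rule G)
  interpret P: two_natural K L "dom_2functor L \<circ>\<^sub>2 F" "dom_2functor L \<circ>\<^sub>2 G" "\<lambda>x. top1 (lam x)" by (rule dom)
  interpret Q: two_natural K L "cod_2functor L \<circ>\<^sub>2 F" "cod_2functor L \<circ>\<^sub>2 G" "\<lambda>x. bot1 (lam x)" by (rule cod)
  have nat1: "arrow_comp1 L (lam (tgt1 K f)) (on1 F f) = arrow_comp1 L (on1 G f) (lam (src1 K f))"
    if f: "f \<in> C1 K" for f
    using P.natural1[OF f] Q.natural1[OF f] cell[of "src1 K f"] cell[of "tgt1 K f"] f
      F.on1_src[OF f] G.on1_tgt[OF f] by (auto intro!: sq1_eqI)
  show ?thesis
  proof (unfold_locales, goal_cases)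
    case (3 a)
    \<comment> \<open>The boundary of a whiskered 2-cell consists of composite 1-cells, so
      \<open>nat1\<close> enters at the source and at the target of \<open>a\<close>.\<close>
    then show ?case using P.natural2[of a] Q.natural2[of a] nat1[of "src2 K a"] nat1[of "tgt2 K a"]
        F.on2_src[of a] F.on2_tgt[of a] G.on2_src[of a] G.on2_tgt[of a]
      by (auto intro!: sq2_eqI)
  qed (use cell nat1 in auto)
qed

text \<open>Meant for the codomain side of the unit and the multiplication of \<open>Comma\<close>,
  whose bottom 1-cells are \<open>fid (Ftgt P)\<close>.\<close>

lemma two_natural_id:
  assumes F: "two_functor K L F" and lam: "\<And>x. x \<in> C0 K \<Longrightarrow> lam x = id1 L (on0 F x)"
  shows "two_natural K L F F lam"
proof -
  interpret F: two_functor K L F by (rule F)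
  show ?thesis
    by unfold_locales
      (auto simp: lam F.on0_closed F.on1_closed F.on1_src F.on1_tgt F.on2_closed F.on2_src F.on2_tgt)
qed

section \<open>Cells of \<open>CAT2\<close> in terms of objects and arrows\<close>

lemma CAT2_simps [simp]:
  "C0 CAT2 = C1 CAT" "C1 CAT2 = arrow_cells1 CAT" "C2 CAT2 = arrow_cells2 CAT"
  "src1 CAT2 = dom1" "tgt1 CAT2 = cod1" "src2 CAT2 = dom2" "tgt2 CAT2 = cod2"
  by (simp_all add: CAT2_def)

lemma CAT2_cell1D:
  assumes "s \<in> arrow_cells1 CAT"
  shows "is_functor (dom1 s)" "is_functor (cod1 s)" "is_functor (top1 s)" "is_functor (bot1 s)"
    "Fsrc (top1 s) = Fsrc (dom1 s)" "Ftgt (top1 s) = Fsrc (cod1 s)"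
    "Fsrc (bot1 s) = Ftgt (dom1 s)" "Ftgt (bot1 s) = Ftgt (cod1 s)"
    "x \<in> Obj (Fsrc (dom1 s)) \<Longrightarrow> Fo (cod1 s) (Fo (top1 s) x) = Fo (bot1 s) (Fo (dom1 s) x)"
    "f \<in> Arr (Fsrc (dom1 s)) \<Longrightarrow> Fa (cod1 s) (Fa (top1 s) f) = Fa (bot1 s) (Fa (dom1 s) f)"
proof -
  note s = arrow_cells1D[OF assms]
  show st: "Fsrc (top1 s) = Fsrc (dom1 s)" "Ftgt (top1 s) = Fsrc (cod1 s)"
    "Fsrc (bot1 s) = Ftgt (dom1 s)" "Ftgt (bot1 s) = Ftgt (cod1 s)" using s by simp_all
  show "is_functor (dom1 s)" "is_functor (cod1 s)" "is_functor (top1 s)" "is_functor (bot1 s)"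
    using s by (simp_all add: C1_CAT)
  have eq: "cod1 s \<circ>\<^sub>F top1 s = bot1 s \<circ>\<^sub>F dom1 s" using s by simp
  show "Fo (cod1 s) (Fo (top1 s) x) = Fo (bot1 s) (Fo (dom1 s) x)" if "x \<in> Obj (Fsrc (dom1 s))"
    using arg_cong[OF eq, of "\<lambda>H. Fo H x"] that st by simp
  show "Fa (cod1 s) (Fa (top1 s) f) = Fa (bot1 s) (Fa (dom1 s) f)" if "f \<in> Arr (Fsrc (dom1 s))"
    using arg_cong[OF eq, of "\<lambda>H. Fa H f"] that st by simp
qed

lemma CAT2_cell1I:
  assumes "dom1 s \<in> C1 CAT" "cod1 s \<in> C1 CAT" "is_functor (top1 s)" "is_functor (bot1 s)"
    "Fsrc (top1 s) = Fsrc (dom1 s)" "Ftgt (top1 s) = Fsrc (cod1 s)"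
    "Fsrc (bot1 s) = Ftgt (dom1 s)" "Ftgt (bot1 s) = Ftgt (cod1 s)"
    "\<And>x. x \<in> Obj (Fsrc (dom1 s)) \<Longrightarrow> Fo (cod1 s) (Fo (top1 s) x) = Fo (bot1 s) (Fo (dom1 s) x)"
    "\<And>f. f \<in> Arr (Fsrc (dom1 s)) \<Longrightarrow> Fa (cod1 s) (Fa (top1 s) f) = Fa (bot1 s) (Fa (dom1 s) f)"
  shows "s \<in> arrow_cells1 CAT"
  unfolding arrow_cells1_def using assms by (auto simp: C1_CAT intro!: func_eqI)

text \<open>The last fact is \<open>Q beta = alpha P\<close> evaluated at \<open>x\<close>: the
  whiskering formulas turn both sides into explicit component functions, which are then compared at
  a point.\<close>

lemma CAT2_cell2D:
  assumes "c \<in> arrow_cells2 CAT"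
  shows "dom2 c \<in> arrow_cells1 CAT" "cod2 c \<in> arrow_cells1 CAT"
    "dom1 (cod2 c) = dom1 (dom2 c)" "cod1 (cod2 c) = cod1 (dom2 c)"
    "is_nattr (top2 c)" "Nsrc (top2 c) = top1 (dom2 c)" "Ntgt (top2 c) = top1 (cod2 c)"
    "is_nattr (bot2 c)" "Nsrc (bot2 c) = bot1 (dom2 c)" "Ntgt (bot2 c) = bot1 (cod2 c)"
    "x \<in> Obj (Fsrc (dom1 (dom2 c))) \<Longrightarrow>
      Fa (cod1 (dom2 c)) (Nc (top2 c) x) = Nc (bot2 c) (Fo (dom1 (dom2 c)) x)"
proof -
  note c = arrow_cells2D[OF assms]
  note s = CAT2_cell1D[OF c(1)]
  show "dom2 c \<in> arrow_cells1 CAT" "cod2 c \<in> arrow_cells1 CAT"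
    "dom1 (cod2 c) = dom1 (dom2 c)" "cod1 (cod2 c) = cod1 (dom2 c)"
    "Nsrc (top2 c) = top1 (dom2 c)" "Ntgt (top2 c) = top1 (cod2 c)"
    "Nsrc (bot2 c) = bot1 (dom2 c)" "Ntgt (bot2 c) = bot1 (cod2 c)"
    using c by simp_all
  show n: "is_nattr (top2 c)" "is_nattr (bot2 c)" using c by (simp_all add: C2_CAT)
  have eq: "nhcomp (nid (cod1 (dom2 c))) (top2 c) = nhcomp (bot2 c) (nid (dom1 (dom2 c)))"
    using c by simp
  have "(\<lambda>x\<in>Obj (Fsrc (dom1 (dom2 c))). Fa (cod1 (dom2 c)) (Nc (top2 c) x)) =
      (\<lambda>x\<in>Obj (Fsrc (dom1 (dom2 c))). Nc (bot2 c) (Fo (dom1 (dom2 c)) x))"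
    using eq s c n by (simp add: nhcomp_nid_left nhcomp_nid_right)
  from fun_cong[OF this, of x]
  show "Fa (cod1 (dom2 c)) (Nc (top2 c) x) = Nc (bot2 c) (Fo (dom1 (dom2 c)) x)"
    if "x \<in> Obj (Fsrc (dom1 (dom2 c)))" using that by simp
qed

lemma CAT2_cell2I:
  assumes "dom2 c \<in> arrow_cells1 CAT" "cod2 c \<in> arrow_cells1 CAT"
    "dom1 (cod2 c) = dom1 (dom2 c)" "cod1 (cod2 c) = cod1 (dom2 c)"
    "is_nattr (top2 c)" "Nsrc (top2 c) = top1 (dom2 c)" "Ntgt (top2 c) = top1 (cod2 c)"
    "is_nattr (bot2 c)" "Nsrc (bot2 c) = bot1 (dom2 c)" "Ntgt (bot2 c) = bot1 (cod2 c)"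
    "\<And>x. x \<in> Obj (Fsrc (dom1 (dom2 c))) \<Longrightarrow>
      Fa (cod1 (dom2 c)) (Nc (top2 c) x) = Nc (bot2 c) (Fo (dom1 (dom2 c)) x)"
  shows "c \<in> arrow_cells2 CAT"
proof -
  note s = CAT2_cell1D[OF assms(1)] arrow_cells1D[OF assms(1)] arrow_cells1D[OF assms(2)]
  have "nhcomp (nid (cod1 (dom2 c))) (top2 c) = nhcomp (bot2 c) (nid (dom1 (dom2 c)))"
    using assms s by (auto simp: nhcomp_nid_left nhcomp_nid_right intro!: restrict_ext)
  then show ?thesis using assms s by (simp add: arrow_cells2_def C1_CAT C2_CAT)
qed


section \<open>The comma 2-monad\<close>

lemma comma_obj_upair:
  "upair x u \<in> comma_obj P \<longleftrightarrow> x \<in> Obj (Fsrc P) \<and> u \<in> Arr (Ftgt P) \<and> src (Ftgt P) u = Fo P x"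
  by (auto simp: comma_obj_def upair_inject)

lemma comma_objD:
  assumes "X \<in> comma_obj P" "Fsrc P = E" "Ftgt P = B"
  shows "ufst X \<in> Obj E" "usnd X \<in> Arr B" "src B (usnd X) = Fo P (ufst X)" "upair (ufst X) (usnd X) = X"
  using assms by (auto simp: comma_obj_def)

lemma comma_pair_cat:
  "comma P = pair_cat (Fsrc P) (Ftgt P) ufst (\<lambda>X. tgt (Ftgt P) (usnd X)) (comma_obj P) (Arr (comma P))"
  by (simp add: comma_def Let_def)

lemma comma_parr: "parr X Y f v \<in> Arr (comma P) \<longleftrightarrow> X \<in> comma_obj P \<and> Y \<in> comma_obj P \<and>
    f \<in> Arr (Fsrc P) \<and> src (Fsrc P) f = ufst X \<and> tgt (Fsrc P) f = ufst Y \<and>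
    v \<in> Arr (Ftgt P) \<and> src (Ftgt P) v = tgt (Ftgt P) (usnd X) \<and> tgt (Ftgt P) v = tgt (Ftgt P) (usnd Y) \<and>
    cmp (Ftgt P) v (usnd X) = cmp (Ftgt P) (usnd Y) (Fa P f)"
  by (auto simp: comma_def Let_def in_hom_iff comma_obj_upair) (auto simp: comma_obj_def upair_inject)

lemma comma_arr_surj:
  assumes "a \<in> Arr (comma P)"
  shows "parr (psrc a) (ptgt a) (pfst a) (psnd a) = a"
  using assms by (auto simp: comma_def Let_def)

lemma comma_arr:
  assumes "a \<in> Arr (comma P)" "Fsrc P = E" "Ftgt P = B"
  shows "psrc a \<in> comma_obj P" "ptgt a \<in> comma_obj P"
    "pfst a \<in> Arr E" "src E (pfst a) = ufst (psrc a)" "tgt E (pfst a) = ufst (ptgt a)"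
    "psnd a \<in> Arr B" "src B (psnd a) = tgt B (usnd (psrc a))" "tgt B (psnd a) = tgt B (usnd (ptgt a))"
    "cmp B (psnd a) (usnd (psrc a)) = cmp B (usnd (ptgt a)) (Fa P (pfst a))"
  using assms comma_parr[of "psrc a" "ptgt a" "pfst a" "psnd a" P] comma_arr_surj[OF assms(1)] by auto

text \<open>The functor \<open>bar_fun\<close> rebuilds the endpoints of an arrow as pairs. For the
  identity square, preservation of identities needs that this rebuilding changes nothing.\<close>

lemma comma_arr_parr_upair:
  assumes a: "a \<in> Arr (comma P)"
  shows "parr (upair (ufst (psrc a)) (usnd (psrc a))) (upair (ufst (ptgt a)) (usnd (ptgt a)))
        (pfst a) (psnd a) = a"
  using comma_objD(4)[OF comma_arr(1)[OF a refl refl] refl refl]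
    comma_objD(4)[OF comma_arr(2)[OF a refl refl] refl refl] comma_arr_surj[OF a] by simp

lemma pair_category_comma:
  assumes P: "is_functor P"
  shows "pair_category (Fsrc P) (Ftgt P) ufst (\<lambda>X. tgt (Ftgt P) (usnd X)) (comma_obj P) (Arr (comma P))
    (\<lambda>X Y f v. cmp (Ftgt P) v (usnd X) = cmp (Ftgt P) (usnd Y) (Fa P f))"
proof -
  interpret E: category "Fsrc P" using functor_category[OF P] by simp
  interpret B: category "Ftgt P" using functor_category[OF P] by simp
  show ?thesis
  proof (unfold_locales, goal_cases)
    \<comment> \<open>The definition of \<open>comma\<close> lists arrows with decomposed endpoints
      \<open>upair x u\<close>, while \<open>As_eq\<close> speaks of objects \<open>X\<close>;
      decoding passes from one to the other.\<close>
    case 3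
    show ?case
    proof (intro set_eqI iffI)
      fix a assume a: "a \<in> Arr (comma P)"
      show "a \<in> {parr X Y f g |X Y f g. X \<in> comma_obj P \<and> Y \<in> comma_obj P \<and>
          f \<in> hom (Fsrc P) (ufst X) (ufst Y) \<and> g \<in> hom (Ftgt P) (tgt (Ftgt P) (usnd X)) (tgt (Ftgt P) (usnd Y)) \<and>
          cmp (Ftgt P) g (usnd X) = cmp (Ftgt P) (usnd Y) (Fa P f)}"
        using comma_arr[OF a refl refl] comma_arr_surj[OF a]
        by (intro CollectI exI[of _ "psrc a"] exI[of _ "ptgt a"] exI[of _ "pfst a"] exI[of _ "psnd a"])
          (simp add: in_hom_iff)
    qed (auto simp: comma_parr in_hom_iff)
  next
    case (4 X)
    then show ?case using P comma_objD[OF 4 refl refl] by simp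
  next
    case (5 X Y f v Z f' v')
    let ?B = "Ftgt P"
    have a: "X \<in> comma_obj P" "Y \<in> comma_obj P" "Z \<in> comma_obj P"
      "f \<in> Arr (Fsrc P)" "src (Fsrc P) f = ufst X" "tgt (Fsrc P) f = ufst Y"
      "v \<in> Arr ?B" "src ?B v = tgt ?B (usnd X)" "tgt ?B v = tgt ?B (usnd Y)"
      "f' \<in> Arr (Fsrc P)" "src (Fsrc P) f' = ufst Y" "tgt (Fsrc P) f' = ufst Z"
      "v' \<in> Arr ?B" "src ?B v' = tgt ?B (usnd Y)" "tgt ?B v' = tgt ?B (usnd Z)"
      and eq: "cmp ?B v (usnd X) = cmp ?B (usnd Y) (Fa P f)" "cmp ?B v' (usnd Y) = cmp ?B (usnd Z) (Fa P f')"
      using 5 by (auto simp: comma_parr)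
    note o = comma_objD[OF a(1) refl refl] comma_objD[OF a(2) refl refl] comma_objD[OF a(3) refl refl]
    \<comment> \<open>Two squares are pasted along \<open>usnd Y\<close>; functoriality of
      \<open>P\<close> then combines \<open>Fa P f'\<close> and \<open>Fa P f\<close>.\<close>
    have "cmp ?B (cmp ?B v' v) (usnd X) = cmp ?B (cmp ?B v' (usnd Y)) (Fa P f)"
      using P a o eq(1) by (simp add: B.assoc)
    also have "\<dots> = cmp ?B (usnd Z) (Fa P (cmp (Fsrc P) f' f))"
      unfolding eq(2) using P a o by (simp add: B.assoc)
    finally show ?case .
  qed (auto simp: comma_objD)
qed

lemma comma_simps [simp]:
  "Obj (comma P) = comma_obj P"
  "a \<in> Arr (comma P) \<Longrightarrow> src (comma P) a = psrc a"
  "a \<in> Arr (comma P) \<Longrightarrow> tgt (comma P) a = ptgt a"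
  "X \<in> comma_obj P \<Longrightarrow> idn (comma P) X = parr X X (idn (Fsrc P) (ufst X)) (idn (Ftgt P) (tgt (Ftgt P) (usnd X)))"
  "a \<in> Arr (comma P) \<Longrightarrow> b \<in> Arr (comma P) \<Longrightarrow> psrc b = ptgt a \<Longrightarrow> cmp (comma P) b a =
    parr (psrc a) (ptgt b) (cmp (Fsrc P) (pfst b) (pfst a)) (cmp (Ftgt P) (psnd b) (psnd a))"
  by (subst comma_pair_cat, simp)+

lemma comma_category [simp]: "is_functor P \<Longrightarrow> category (comma P)"
  by (subst comma_pair_cat) (rule pair_category.category[OF pair_category_comma])

lemma comma_C0:
  assumes P: "P \<in> C1 CAT"
  shows "comma P \<in> C0 CAT"
proof -
  interpret pair_category "Fsrc P" "Ftgt P" ufst "\<lambda>X. tgt (Ftgt P) (usnd X)" "comma_obj P" "Arr (comma P)"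
      "\<lambda>X Y f v. cmp (Ftgt P) v (usnd X) = cmp (Ftgt P) (usnd Y) (Fa P f)"
    using P by (intro pair_category_comma) (simp add: C1_CAT)
  show ?thesis using P category normalized locally_small
    by (simp add: C1_CAT C0_CAT flip: comma_pair_cat)
qed

section \<open>The codomain functor and the comma construction on cells of
  \<open>CAT2\<close>\<close>

lemma Cod_fun_simps [simp]:
  "Fsrc (Cod_fun P) = comma P" "Ftgt (Cod_fun P) = Ftgt P"
  "X \<in> comma_obj P \<Longrightarrow> Fo (Cod_fun P) X = tgt (Ftgt P) (usnd X)"
  "a \<in> Arr (comma P) \<Longrightarrow> Fa (Cod_fun P) a = psnd a"
  by (simp_all add: Cod_fun_def)

lemma Cod_fun_functor [simp]:
  assumes P: "is_functor P"
  shows "is_functor (Cod_fun P)"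
proof -
  interpret B: category "Ftgt P" using functor_category[OF P] by simp
  interpret K: category "comma P" using P by simp
  show ?thesis
  proof (rule is_functorI)
    fix f g assume "f \<in> Arr (Fsrc (Cod_fun P))" "g \<in> Arr (Fsrc (Cod_fun P))"
      "src (Fsrc (Cod_fun P)) g = tgt (Fsrc (Cod_fun P)) f"
    then have fg: "f \<in> Arr (comma P)" "g \<in> Arr (comma P)" "psrc g = ptgt f" by simp_all
    have "cmp (comma P) g f \<in> Arr (comma P)" using K.cmp_simps(1)[of f g] fg by simp
    then show "Fa (Cod_fun P) (cmp (Fsrc (Cod_fun P)) g f) =
      cmp (Ftgt (Cod_fun P)) (Fa (Cod_fun P) g) (Fa (Cod_fun P) f)" using fg by simp
  next
    fix x assume "x \<in> Obj (Fsrc (Cod_fun P))"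
    then have "idn (comma P) x \<in> Arr (comma P)" "x \<in> comma_obj P" using K.idn_simps(1) by simp_all
    then show "Fa (Cod_fun P) (idn (Fsrc (Cod_fun P)) x) = idn (Ftgt (Cod_fun P)) (Fo (Cod_fun P) x)"
      by simp
  qed (use K.category_axioms B.category_axioms in \<open>auto simp: comma_arr comma_objD\<close>, auto simp: Cod_fun_def)
qed

lemma Cod_fun_C1: "P \<in> C1 CAT \<Longrightarrow> Cod_fun P \<in> C1 CAT"
  using comma_C0[of P] by (simp add: C1_CAT)

text \<open>The endpoints of an arrow value are written with \<open>Fo (bar_fun s)\<close> and not
  with \<open>bar_obj\<close>, so that object equations proved beforehand rewrite them
  directly.\<close>

lemma bar_fun_simps [simp]:
  "Fsrc (bar_fun s) = comma (dom1 s)" "Ftgt (bar_fun s) = comma (cod1 s)"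
  "X \<in> comma_obj (dom1 s) \<Longrightarrow> Fo (bar_fun s) X = upair (Fo (top1 s) (ufst X)) (Fa (bot1 s) (usnd X))"
  "a \<in> Arr (comma (dom1 s)) \<Longrightarrow> Fa (bar_fun s) a =
    parr (Fo (bar_fun s) (psrc a)) (Fo (bar_fun s) (ptgt a)) (Fa (top1 s) (pfst a)) (Fa (bot1 s) (psnd a))"
  by (simp_all add: bar_fun_def bar_obj_def comma_arr[OF _ refl refl])

lemma bar_fun_functor [simp]:
  assumes s: "s \<in> arrow_cells1 CAT"
  shows "is_functor (bar_fun s)"
proof -
  note S = CAT2_cell1D[OF s]
  let ?P = "dom1 s" and ?Q = "cod1 s"
  interpret B: category "Ftgt ?P" using functor_category[OF S(1)] by simp
  interpret E: category "Fsrc ?P" using functor_category[OF S(1)] by simp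
  interpret C: category "Ftgt ?Q" using functor_category[OF S(2)] by simp
  interpret K: category "comma ?P" using S by simp
  interpret pair_category "Fsrc ?Q" "Ftgt ?Q" ufst "\<lambda>X. tgt (Ftgt ?Q) (usnd X)" "comma_obj ?Q" "Arr (comma ?Q)"
      "\<lambda>X Y f v. cmp (Ftgt ?Q) v (usnd X) = cmp (Ftgt ?Q) (usnd Y) (Fa ?Q f)"
    using S by (intro pair_category_comma)
  show ?thesis
  proof (rule functorI[where A = "comma ?P" and u = "\<lambda>a. Fa (top1 s) (pfst a)" and v = "\<lambda>a. Fa (bot1 s) (psnd a)"])
    fix a assume "a \<in> Arr (comma ?P)"
    note a = this comma_arr[OF this refl refl]
    note o = comma_objD[OF a(2) refl refl] comma_objD[OF a(3) refl refl]
    \<comment> \<open>With \<open>S\<close> for the bottom and \<open>T\<close> for the top of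
      \<open>s\<close>: applying \<open>S\<close> to \<open>v u = w (P f)\<close> gives
      \<open>(S v) (S u) = (S w) (S P f)\<close>, and \<open>S P f = Q T f\<close> because
      \<open>s\<close> commutes.\<close>
    have "Fa (bot1 s) (cmp (Ftgt ?P) (psnd a) (usnd (psrc a))) = Fa (bot1 s) (cmp (Ftgt ?P) (usnd (ptgt a)) (Fa ?P (pfst a)))"
      using a by simp
    then show "cmp (Ftgt ?Q) (Fa (bot1 s) (psnd a)) (usnd (Fo (bar_fun s) (src (comma ?P) a))) =
      cmp (Ftgt ?Q) (usnd (Fo (bar_fun s) (tgt (comma ?P) a))) (Fa ?Q (Fa (top1 s) (pfst a)))"
      using S a(1-9) o by simp
  qed (use S comma_pair_cat K.category_axioms in
       \<open>auto simp: comma_arr[OF _ refl refl] comma_objD[OF _ refl refl] comma_obj_upair\<close>,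
       auto simp: bar_fun_def)
qed

lemma bar_nattr_simps [simp]:
  "Nsrc (bar_nattr c) = bar_fun (dom2 c)" "Ntgt (bar_nattr c) = bar_fun (cod2 c)"
  "X \<in> comma_obj (dom1 (dom2 c)) \<Longrightarrow> dom1 (cod2 c) = dom1 (dom2 c) \<Longrightarrow> Nc (bar_nattr c) X =
    parr (Fo (bar_fun (dom2 c)) X) (Fo (bar_fun (cod2 c)) X)
      (Nc (top2 c) (ufst X)) (Nc (bot2 c) (tgt (Ftgt (dom1 (dom2 c))) (usnd X)))"
  by (simp_all add: bar_nattr_def bar_obj_def Let_def)

text \<open>At \<open>(x, u)\<close> with \<open>u\<close> from \<open>P x\<close> to
  \<open>b\<close>, the relation \<open>R\<close> reads
  \<open>alpha_b (S u) = (S' u) (Q beta_x)\<close>. This is naturality of \<open>alpha\<close> at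
  \<open>u\<close>, since \<open>Q beta_x\<close> is the component of \<open>alpha\<close> at
  \<open>P x\<close>.\<close>

lemma bar_nattr_nattr [simp]:
  assumes c: "c \<in> arrow_cells2 CAT"
  shows "is_nattr (bar_nattr c)"
proof -
  note D = CAT2_cell2D[OF c]
  note S = CAT2_cell1D[OF D(1)] CAT2_cell1D[OF D(2)]
  let ?P = "dom1 (dom2 c)" and ?Q = "cod1 (dom2 c)"
  let ?B = "Ftgt ?P"
  interpret B: category "Ftgt ?P" using functor_category[OF S(1)] by simp
  interpret E: category "Fsrc ?P" using functor_category[OF S(1)] by simp
  interpret C: category "Ftgt ?Q" using functor_category[OF S(2)] by simp
  interpret pair_category "Fsrc ?Q" "Ftgt ?Q" ufst "\<lambda>X. tgt (Ftgt ?Q) (usnd X)" "comma_obj ?Q" "Arr (comma ?Q)"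
      "\<lambda>X Y f v. cmp (Ftgt ?Q) v (usnd X) = cmp (Ftgt ?Q) (usnd Y) (Fa ?Q f)"
    using S by (intro pair_category_comma)
  have natural_top: "cmp (Fsrc ?Q) (Nc (top2 c) y) (Fa (top1 (dom2 c)) f) = cmp (Fsrc ?Q) (Fa (top1 (cod2 c)) f) (Nc (top2 c) x)"
    if "f \<in> Arr (Fsrc ?P)" "src (Fsrc ?P) f = x" "tgt (Fsrc ?P) f = y" for f x y
    using nattr_natural[OF D(5), of "Fsrc ?Q" f x y] D S that by simp
  have natural_bot: "cmp (Ftgt ?Q) (Nc (bot2 c) y) (Fa (bot1 (dom2 c)) f) = cmp (Ftgt ?Q) (Fa (bot1 (cod2 c)) f) (Nc (bot2 c) x)"
    if "f \<in> Arr ?B" "src ?B f = x" "tgt ?B f = y" for f x y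
    using nattr_natural[OF D(8), of "Ftgt ?Q" f x y] D S that by simp
  show ?thesis
    by (rule nattrI[where A = "comma ?P" and u = "\<lambda>X. Nc (top2 c) (ufst X)" and v = "\<lambda>X. Nc (bot2 c) (tgt ?B (usnd X))"])
      (use D S natural_top natural_bot comma_pair_cat in
       \<open>auto simp: comma_arr[OF _ refl refl] comma_objD[OF _ refl refl]\<close>,
       auto simp: bar_nattr_def Let_def)
qed

lemma functor_arr_comma:
  assumes "is_functor F" "Ftgt F = comma P" "a \<in> Arr (Fsrc F)"
  shows "Fa F a \<in> Arr (comma P)"
  using assms by simp

lemma functor_obj_comma:
  assumes "is_functor F" "Ftgt F = comma P" "a \<in> Obj (Fsrc F)"
  shows "Fo F a \<in> comma_obj P"
  using functor_obj[OF assms] by simp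

lemma nattr_arr_comma:
  assumes "is_nattr t" "Ftgt (Nsrc t) = comma P" "x \<in> Obj (Fsrc (Nsrc t))"
  shows "Nc t x \<in> Arr (comma P)"
  using assms by simp

lemma comma_fun_simps [simp]:
  "dom1 (comma_fun s) = Cod_fun (dom1 s)" "cod1 (comma_fun s) = Cod_fun (cod1 s)"
  "top1 (comma_fun s) = bar_fun s" "bot1 (comma_fun s) = bot1 s"
  by (simp_all add: comma_fun_def)

lemma comma_nattr_simps [simp]:
  "dom2 (comma_nattr c) = comma_fun (dom2 c)" "cod2 (comma_nattr c) = comma_fun (cod2 c)"
  "top2 (comma_nattr c) = bar_nattr c" "bot2 (comma_nattr c) = bot2 c"
  by (simp_all add: comma_nattr_def)

lemma Comma_simps [simp]:
  "on0 (endo Comma) = Cod_fun" "on1 (endo Comma) = comma_fun" "on2 (endo Comma) = comma_nattr"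
  "unit Comma P = \<lparr>dom1 = P, cod1 = Cod_fun P, top1 = H_fun P, bot1 = fid (Ftgt P)\<rparr>"
  "mult Comma P = \<lparr>dom1 = Cod_fun (Cod_fun P), cod1 = Cod_fun P, top1 = M_fun P, bot1 = fid (Ftgt P)\<rparr>"
  by (simp_all add: Comma_def)

lemma comma_fun_cell:
  assumes s: "s \<in> arrow_cells1 CAT"
  shows "comma_fun s \<in> arrow_cells1 CAT"
proof (rule CAT2_cell1I)
  note S = CAT2_cell1D[OF s]
  have obj: "Fo (bar_fun s) X \<in> comma_obj (cod1 s)" if "X \<in> comma_obj (dom1 s)" for X
    using functor_obj_comma[OF bar_fun_functor[OF s], of "cod1 s" X] that by simp
  have arr: "Fa (bar_fun s) a \<in> Arr (comma (cod1 s))" if "a \<in> Arr (comma (dom1 s))" for a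
    using functor_arr_comma[OF bar_fun_functor[OF s], of "cod1 s" a] that by simp
  show "Fo (cod1 (comma_fun s)) (Fo (top1 (comma_fun s)) X) = Fo (bot1 (comma_fun s)) (Fo (dom1 (comma_fun s)) X)"
    if "X \<in> Obj (Fsrc (dom1 (comma_fun s)))" for X
    using that S obj[of X] comma_objD[of X "dom1 s"] by simp
  show "Fa (cod1 (comma_fun s)) (Fa (top1 (comma_fun s)) a) = Fa (bot1 (comma_fun s)) (Fa (dom1 (comma_fun s)) a)"
    if "a \<in> Arr (Fsrc (dom1 (comma_fun s)))" for a
    using that S arr[of a] comma_arr[of a "dom1 s"] by simp
qed (use s CAT2_cell1D[OF s] arrow_cells1D[OF s] in \<open>simp_all add: Cod_fun_C1\<close>)

lemma comma_nattr_cell: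
  assumes c: "c \<in> arrow_cells2 CAT"
  shows "comma_nattr c \<in> arrow_cells2 CAT"
proof (rule CAT2_cell2I)
  note D = CAT2_cell2D[OF c]
  fix X assume "X \<in> Obj (Fsrc (dom1 (dom2 (comma_nattr c))))"
  then have X: "X \<in> comma_obj (dom1 (dom2 c))" by simp
  have "Nc (bar_nattr c) X \<in> Arr (comma (cod1 (dom2 c)))"
    using nattr_arr_comma[OF bar_nattr_nattr[OF c], of "cod1 (dom2 c)" X] X by simp
  then show "Fa (cod1 (dom2 (comma_nattr c))) (Nc (top2 (comma_nattr c)) X) =
      Nc (bot2 (comma_nattr c)) (Fo (dom1 (dom2 (comma_nattr c))) X)"
    using X D by simp
qed (use c CAT2_cell2D[OF c] in \<open>simp_all add: comma_fun_cell\<close>)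

text \<open>Both sides send \<open>(x, u)\<close> to the iterated images of \<open>x\<close> and
  \<open>u\<close>. Besides preservation of composite 1-cells, this gives the sources and targets of
  horizontal composites of 2-cells.\<close>

lemma bar_fun_comp:
  assumes s: "s \<in> arrow_cells1 CAT" and t: "t \<in> arrow_cells1 CAT" and st: "dom1 t = cod1 s"
  shows "bar_fun (arrow_comp1 CAT t s) = bar_fun t \<circ>\<^sub>F bar_fun s"
proof (rule func_eqI)
  note S = CAT2_cell1D[OF s] and T = CAT2_cell1D[OF t]
  have ts: "arrow_comp1 CAT t s \<in> arrow_cells1 CAT"
    using two_category.arrow_comp1_closed[OF CAT s t st] .
  show "is_functor (bar_fun (arrow_comp1 CAT t s))" "is_functor (bar_fun t \<circ>\<^sub>F bar_fun s)"
    using s t ts st by simp_all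
  have obj: "Fo (bar_fun s) X \<in> comma_obj (cod1 s)" if "X \<in> comma_obj (dom1 s)" for X
    using functor_obj_comma[OF bar_fun_functor[OF s], of "cod1 s" X] that by simp
  show Fo: "Fo (bar_fun (arrow_comp1 CAT t s)) X = Fo (bar_fun t \<circ>\<^sub>F bar_fun s) X"
    if "X \<in> Obj (Fsrc (bar_fun (arrow_comp1 CAT t s)))" for X
    using that S st obj[of X] comma_objD[of X "dom1 s"] by simp
  show "Fa (bar_fun (arrow_comp1 CAT t s)) a = Fa (bar_fun t \<circ>\<^sub>F bar_fun s) a"
    if a: "a \<in> Arr (Fsrc (bar_fun (arrow_comp1 CAT t s)))" for a
  proof -
    have a: "a \<in> Arr (comma (dom1 s))" using a by simp
    have "Fa (bar_fun s) a \<in> Arr (comma (cod1 s))"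
      using functor_arr_comma[OF bar_fun_functor[OF s], of "cod1 s" a] a by simp
    then show ?thesis using a S st Fo[of "psrc a"] Fo[of "ptgt a"] comma_arr[OF a refl refl]
      by (simp del: bar_fun_simps(3))
  qed
qed (use st in simp_all)

lemma bar_two_functor: "two_functor CAT2 CAT (dom_2functor CAT \<circ>\<^sub>2 endo Comma)"
proof -
  interpret K: two_category "CAT2" by (rule CAT2)
  interpret L: two_category "CAT" by (rule CAT)
  show ?thesis
  proof (unfold_locales, goal_cases)
    case (1 P)
    then show ?case by (simp add: comma_C0)
  next
    case (2 s)
    then show ?case using arrow_cells1D(3)[OF comma_fun_cell, of s] by simp
  next
    case (3 c)
    then show ?case using arrow_cells2D(5)[OF comma_nattr_cell, of c] by simp
  next
    case (8 P)
    then have P: "P \<in> C1 CAT" by simp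
    have id: "id1 CAT2 P \<in> arrow_cells1 CAT" using K.id1_simps(1)[of P] P by simp
    interpret B: category "Ftgt P" using P functor_category by (auto simp: C1_CAT)
    show ?case
      using id P comma_arr_parr_upair by (auto intro!: func_eqI simp: CAT2_def comma_objD[OF _ refl refl] C1_CAT
        comma_arr(1-8)[OF _ refl refl] comma_arr_surj)
  next
    case (9 s)
    then have s: "s \<in> arrow_cells1 CAT" by simp
    note S = CAT2_cell1D[OF s]
    have id: "id2 CAT2 s \<in> arrow_cells2 CAT" using K.id2_simps(1)[of s] s by simp
    interpret E: category "Fsrc (cod1 s)" using functor_category S by blast
    interpret B: category "Ftgt (dom1 s)" using functor_category S by blast
    have "Fo (bar_fun s) X \<in> comma_obj (cod1 s)" if "X \<in> comma_obj (dom1 s)" for X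
      using functor_obj_comma[OF bar_fun_functor[OF s], of "cod1 s" X] that by simp
    then show ?case
      using id s S bar_nattr_nattr[OF id] by (auto intro!: nattr_eqI simp: CAT2_def comma_objD[OF _ refl refl])
  next
    case (10 s t)
    then show ?case using bar_fun_comp[of s t] by (simp add: CAT2_def)
  next
    case (11 c d)
    then have c: "c \<in> arrow_cells2 CAT" and d: "d \<in> arrow_cells2 CAT" and cd: "dom2 d = cod2 c" by simp_all
    note C = CAT2_cell2D[OF c] and D = CAT2_cell2D[OF d]
    note S = CAT2_cell1D[OF C(1)] CAT2_cell1D[OF C(2)] CAT2_cell1D[OF D(2)]
    have dc: "vcomp CAT2 d c \<in> arrow_cells2 CAT" using K.vcomp_simps(1)[of c d] c d cd by simp
    interpret B: category "Ftgt (dom1 (dom2 c))" using functor_category S by blast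
    show ?case unfolding tfcomp_simps dom_2functor_simps Comma_simps comma_nattr_simps CAT_simps
    proof (rule nattr_eqI)
      fix X assume "X \<in> Obj (Fsrc (Nsrc (bar_nattr (vcomp CAT2 d c))))"
      then have X: "X \<in> comma_obj (dom1 (dom2 c))" by (simp add: CAT2_def)
      have "Nc (bar_nattr c) X \<in> Arr (comma (cod1 (dom2 c)))" "Nc (bar_nattr d) X \<in> Arr (comma (cod1 (dom2 c)))"
        using nattr_arr_comma[OF bar_nattr_nattr[OF c], of "cod1 (dom2 c)" X]
          nattr_arr_comma[OF bar_nattr_nattr[OF d], of "cod1 (dom2 c)" X] X C D cd by simp_all
      then show "Nc (bar_nattr (vcomp CAT2 d c)) X = Nc (nvcomp (bar_nattr d) (bar_nattr c)) X"
        using X C D S cd comma_objD[OF X refl refl] by (simp add: CAT2_def)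
    qed (use c d cd dc in \<open>simp_all add: CAT2_def\<close>)
  next
    case (12 c d)
    then have c: "c \<in> arrow_cells2 CAT" and d: "d \<in> arrow_cells2 CAT" and cd: "dom1 (dom2 d) = cod1 (dom2 c)" by simp_all
    note C = CAT2_cell2D[OF c] and D = CAT2_cell2D[OF d]
    note S = CAT2_cell1D[OF C(1)] CAT2_cell1D[OF C(2)] CAT2_cell1D[OF D(1)] CAT2_cell1D[OF D(2)]
    have dc: "hcomp CAT2 d c \<in> arrow_cells2 CAT" using K.hcomp_simps(1)[of c d] c d cd by simp
    interpret B: category "Ftgt (dom1 (dom2 c))" using functor_category S by blast
    show ?case unfolding tfcomp_simps dom_2functor_simps Comma_simps comma_nattr_simps CAT_simps
    proof (rule nattr_eqI)
      show Nsrc: "Nsrc (bar_nattr (hcomp CAT2 d c)) = Nsrc (nhcomp (bar_nattr d) (bar_nattr c))"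
        and Ntgt: "Ntgt (bar_nattr (hcomp CAT2 d c)) = Ntgt (nhcomp (bar_nattr d) (bar_nattr c))"
        using bar_fun_comp[OF C(1) D(1)] bar_fun_comp[OF C(2) D(2)] cd C D by (simp_all add: CAT2_def)
      fix X assume "X \<in> Obj (Fsrc (Nsrc (bar_nattr (hcomp CAT2 d c))))"
      then have X: "X \<in> comma_obj (dom1 (dom2 c))" by (simp add: CAT2_def)
      \<comment> \<open>The component at \<open>X\<close> is a composite in
        \<open>comma (cod1 (dom2 d))\<close>. Facts 2 and 4 place its factors there; 1 and 3 allow
        the arguments inside them to be evaluated.\<close>
      have 1: "Nc (bar_nattr c) X \<in> Arr (comma (cod1 (dom2 c)))"
        using nattr_arr_comma[OF bar_nattr_nattr[OF c], of "cod1 (dom2 c)" X] X by simp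
      then have 2: "Fa (bar_fun (dom2 d)) (Nc (bar_nattr c) X) \<in> Arr (comma (cod1 (dom2 d)))"
        using functor_arr_comma[OF bar_fun_functor[OF D(1)], of "cod1 (dom2 d)"] cd by simp
      have 3: "Fo (bar_fun (dom2 c)) X \<in> comma_obj (cod1 (dom2 c))" "Fo (bar_fun (cod2 c)) X \<in> comma_obj (cod1 (dom2 c))"
        using functor_obj_comma[OF bar_fun_functor[OF C(1)], of "cod1 (dom2 c)" X]
          functor_obj_comma[OF bar_fun_functor[OF C(2)], of "cod1 (dom2 c)" X] X C by simp_all
      then have 4: "Nc (bar_nattr d) (Fo (bar_fun (cod2 c)) X) \<in> Arr (comma (cod1 (dom2 d)))"
        using nattr_arr_comma[OF bar_nattr_nattr[OF d], of "cod1 (dom2 d)" "Fo (bar_fun (cod2 c)) X"] cd by simp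
      show "Nc (bar_nattr (hcomp CAT2 d c)) X = Nc (nhcomp (bar_nattr d) (bar_nattr c)) X"
        using X C D S cd comma_objD[OF X refl refl] 1 2 3 4
        by (simp add: CAT2_def)
    qed (use c d cd dc C in \<open>simp_all add: CAT2_def\<close>)
  qed (auto simp: CAT2_def)
qed

text \<open>The construction leaves the base category and the cells over it unchanged, so the
  codomain half of the 2-functor axioms for \<open>endo Comma\<close> is that of the projection
  itself.\<close>

lemma cod_Comma: "cod_2functor CAT \<circ>\<^sub>2 endo Comma = cod_2functor CAT"
  by (simp add: tfcomp_def cod_2functor_def)

lemma Comma_endo: "two_functor CAT2 CAT2 (endo Comma)"
proof -
  have "two_functor CAT2 (arrow_2cat CAT) (endo Comma)"
  proof (rule arrow_two_functorI[OF bar_two_functor])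
    show "two_functor CAT2 CAT (cod_2functor CAT \<circ>\<^sub>2 endo Comma)"
      unfolding cod_Comma CAT2_def by (rule two_category.cod_2functor[OF CAT])
  qed (auto simp: Cod_fun_C1 comma_fun_cell comma_nattr_cell)
  then show ?thesis by (simp add: CAT2_def)
qed

section \<open>Unit and multiplication of the comma 2-monad, and their naturality\<close>

lemma H_fun_simps [simp]:
  "Fsrc (H_fun P) = Fsrc P" "Ftgt (H_fun P) = comma P"
  "x \<in> Obj (Fsrc P) \<Longrightarrow> Fo (H_fun P) x = upair x (idn (Ftgt P) (Fo P x))"
  "f \<in> Arr (Fsrc P) \<Longrightarrow> Fa (H_fun P) f =
    parr (H_obj P (src (Fsrc P) f)) (H_obj P (tgt (Fsrc P) f)) f (Fa P f)"
  by (simp_all add: H_fun_def H_obj_def Let_def)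

lemma H_fun_functor [simp]:
  assumes P: "is_functor P"
  shows "is_functor (H_fun P)"
proof -
  interpret E: category "Fsrc P" using functor_category[OF P] by simp
  interpret B: category "Ftgt P" using functor_category[OF P] by simp
  interpret pair_category "Fsrc P" "Ftgt P" ufst "\<lambda>X. tgt (Ftgt P) (usnd X)" "comma_obj P" "Arr (comma P)"
      "\<lambda>X Y f v. cmp (Ftgt P) v (usnd X) = cmp (Ftgt P) (usnd Y) (Fa P f)"
    using P by (intro pair_category_comma)
  show ?thesis
    by (rule functorI[where A = "Fsrc P" and u = "\<lambda>f. f" and v = "\<lambda>f. Fa P f"])
      (use P E.category_axioms comma_pair_cat in \<open>auto simp: comma_obj_upair H_obj_def\<close>,
       auto simp: H_fun_def Let_def)
qed

lemma M_fun_simps [simp]: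
  "Fsrc (M_fun P) = comma (Cod_fun P)" "Ftgt (M_fun P) = comma P"
  "Z \<in> comma_obj (Cod_fun P) \<Longrightarrow> Fo (M_fun P) Z = M_obj P Z"
  "a \<in> Arr (comma (Cod_fun P)) \<Longrightarrow> Fa (M_fun P) a =
    parr (M_obj P (psrc a)) (M_obj P (ptgt a)) (pfst (pfst a)) (psnd a)"
  by (simp_all add: M_fun_def)

text \<open>An object of the iterated comma category is \<open>((x, u), v)\<close> with
  \<open>v\<close> starting where \<open>u\<close> ends; this is what makes \<open>M_obj\<close> a
  genuine composite.\<close>

lemma comma_Cod_objD:
  assumes "Z \<in> comma_obj (Cod_fun P)" "Fsrc P = E" "Ftgt P = B"
  shows "ufst Z \<in> comma_obj P" "ufst (ufst Z) \<in> Obj E" "usnd (ufst Z) \<in> Arr B"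
    "src B (usnd (ufst Z)) = Fo P (ufst (ufst Z))" "usnd Z \<in> Arr B"
    "src B (usnd Z) = tgt B (usnd (ufst Z))"
proof -
  show Z: "ufst Z \<in> comma_obj P" using comma_objD[OF assms(1) refl refl] by simp
  show "ufst (ufst Z) \<in> Obj E" "usnd (ufst Z) \<in> Arr B"
    "src B (usnd (ufst Z)) = Fo P (ufst (ufst Z))" "usnd Z \<in> Arr B"
    "src B (usnd Z) = tgt B (usnd (ufst Z))"
    using comma_objD[OF Z assms(2,3)] comma_objD(2,3)[OF assms(1) refl refl] Z assms(3) by auto
qed

lemma comma_Cod_arr:
  assumes "a \<in> Arr (comma (Cod_fun P))" "Fsrc P = E" "Ftgt P = B"
  shows "psrc a \<in> comma_obj (Cod_fun P)" "ptgt a \<in> comma_obj (Cod_fun P)" "pfst a \<in> Arr (comma P)"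
    "psrc (pfst a) = ufst (psrc a)" "ptgt (pfst a) = ufst (ptgt a)"
    "psnd a \<in> Arr B" "src B (psnd a) = tgt B (usnd (psrc a))" "tgt B (psnd a) = tgt B (usnd (ptgt a))"
    "cmp B (psnd a) (usnd (psrc a)) = cmp B (usnd (ptgt a)) (psnd (pfst a))"
  using comma_arr[OF assms(1) refl refl] assms(2,3) by auto

lemma M_fun_functor [simp]:
  assumes P: "is_functor P"
  shows "is_functor (M_fun P)"
proof -
  let ?B = "Ftgt P"
  interpret E: category "Fsrc P" using functor_category[OF P] by simp
  interpret B: category "Ftgt P" using functor_category[OF P] by simp
  interpret K: category "comma (Cod_fun P)" using P by simp
  interpret pair_category "Fsrc P" "Ftgt P" ufst "\<lambda>X. tgt (Ftgt P) (usnd X)" "comma_obj P" "Arr (comma P)"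
      "\<lambda>X Y f v. cmp (Ftgt P) v (usnd X) = cmp (Ftgt P) (usnd Y) (Fa P f)"
    using P by (intro pair_category_comma)
  show ?thesis
  proof (rule functorI[where A = "comma (Cod_fun P)" and u = "\<lambda>a. pfst (pfst a)" and v = "psnd"])
    fix a assume "a \<in> Arr (comma (Cod_fun P))"
    note a = this comma_Cod_arr[OF this refl refl]
    note b = comma_arr[OF a(4) refl refl]
    note o = comma_Cod_objD[OF a(2) refl refl] comma_Cod_objD[OF a(3) refl refl]
    \<comment> \<open>For an arrow from \<open>((x, u), v)\<close> to \<open>((y, u'), v')\<close>,
      the square from \<open>v\<close> to \<open>v'\<close> is pasted onto the square from
      \<open>u\<close> to \<open>u'\<close>, giving the square from \<open>v u\<close> to
      \<open>v' u'\<close>.\<close>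
    have "cmp ?B (psnd a) (cmp ?B (usnd (psrc a)) (usnd (ufst (psrc a)))) =
      cmp ?B (cmp ?B (usnd (ptgt a)) (psnd (pfst a))) (usnd (ufst (psrc a)))"
      unfolding a(10)[symmetric] using a(1-9) b(1-8) o by (simp add: B.assoc)
    also have "\<dots> = cmp ?B (usnd (ptgt a)) (cmp ?B (psnd (pfst a)) (usnd (psrc (pfst a))))"
      using a(1-9) b(1-8) o by (simp add: B.assoc)
    also have "\<dots> = cmp ?B (cmp ?B (usnd (ptgt a)) (usnd (ufst (ptgt a)))) (Fa P (pfst (pfst a)))"
      unfolding b(9) using P a(1-9) b(1-8) o by (simp add: B.assoc)
    finally show "cmp ?B (psnd a) (usnd (Fo (M_fun P) (src (comma (Cod_fun P)) a))) =
         cmp ?B (usnd (Fo (M_fun P) (tgt (comma (Cod_fun P)) a))) (Fa P (pfst (pfst a)))"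
      using a(1-9) by (simp add: M_obj_def)
  qed (use P K.category_axioms comma_pair_cat in
      \<open>auto simp: comma_Cod_arr[OF _ refl refl] comma_Cod_objD[OF _ refl refl] comma_arr[OF _ refl refl]
        comma_obj_upair M_obj_def\<close>,
      auto simp: M_fun_def)
qed

lemma unit_cell:
  assumes P: "P \<in> C1 CAT"
  shows "unit Comma P \<in> arrow_cells1 CAT"
proof (rule CAT2_cell1I)
  have P': "is_functor P" using P by (simp add: C1_CAT)
  interpret E: category "Fsrc P" using functor_category[OF P'] by simp
  interpret B: category "Ftgt P" using functor_category[OF P'] by simp
  have obj: "Fo (H_fun P) x \<in> comma_obj P" if "x \<in> Obj (Fsrc P)" for x
    using functor_obj_comma[OF H_fun_functor[OF P'], of P x] that by simp
  have arr: "Fa (H_fun P) a \<in> Arr (comma P)" if "a \<in> Arr (Fsrc P)" for a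
    using functor_arr_comma[OF H_fun_functor[OF P'], of P a] that by simp
  show "is_functor (top1 (unit Comma P))" "is_functor (bot1 (unit Comma P))"
    using P' B.category_axioms by simp_all
  show "Fo (cod1 (unit Comma P)) (Fo (top1 (unit Comma P)) x) = Fo (bot1 (unit Comma P)) (Fo (dom1 (unit Comma P)) x)"
    if "x \<in> Obj (Fsrc (dom1 (unit Comma P)))" for x using that P' obj[of x] by simp
  show "Fa (cod1 (unit Comma P)) (Fa (top1 (unit Comma P)) a) = Fa (bot1 (unit Comma P)) (Fa (dom1 (unit Comma P)) a)"
    if "a \<in> Arr (Fsrc (dom1 (unit Comma P)))" for a using that P' arr[of a] by simp
qed (use P in \<open>simp_all add: Cod_fun_C1\<close>)

lemma mult_cell:
  assumes P: "P \<in> C1 CAT"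
  shows "mult Comma P \<in> arrow_cells1 CAT"
proof (rule CAT2_cell1I)
  have P': "is_functor P" using P by (simp add: C1_CAT)
  interpret B: category "Ftgt P" using functor_category[OF P'] by simp
  have obj: "Fo (M_fun P) Z \<in> comma_obj P" if "Z \<in> comma_obj (Cod_fun P)" for Z
    using functor_obj_comma[OF M_fun_functor[OF P'], of P Z] that by simp
  have arr: "Fa (M_fun P) a \<in> Arr (comma P)" if "a \<in> Arr (comma (Cod_fun P))" for a
    using functor_arr_comma[OF M_fun_functor[OF P'], of P a] that by simp
  show "is_functor (top1 (mult Comma P))" "is_functor (bot1 (mult Comma P))"
    using P' B.category_axioms by simp_all
  show "Fo (cod1 (mult Comma P)) (Fo (top1 (mult Comma P)) Z) = Fo (bot1 (mult Comma P)) (Fo (dom1 (mult Comma P)) Z)"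
    if "Z \<in> Obj (Fsrc (dom1 (mult Comma P)))" for Z
    using that P' obj[of Z] comma_Cod_objD[of Z P, OF _ refl refl] by (simp add: M_obj_def)
  show "Fa (cod1 (mult Comma P)) (Fa (top1 (mult Comma P)) a) = Fa (bot1 (mult Comma P)) (Fa (dom1 (mult Comma P)) a)"
    if "a \<in> Arr (Fsrc (dom1 (mult Comma P)))" for a
    using that P' arr[of a] comma_Cod_arr(6)[of a P, OF _ refl refl] by simp
qed (use P in \<open>simp_all add: Cod_fun_C1\<close>)

text \<open>On objects this is \<open>S 1 = 1\<close> together with \<open>S P x = Q T x\<close>; on
  2-cells it is \<open>Q beta_x = alpha_(P x)\<close>.\<close>

lemma H_natural: "two_natural CAT2 CAT (dom_2functor CAT \<circ>\<^sub>2 tfid) (dom_2functor CAT \<circ>\<^sub>2 endo Comma)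
    (\<lambda>P. top1 (unit Comma P))"
proof (rule CAT_two_naturalI)
  show "two_functor CAT2 CAT (dom_2functor CAT \<circ>\<^sub>2 tfid)"
    using Dom two_category.tfid[OF CAT2] unfolding Dom_def by (rule tfcomp[rotated])
  show "two_functor CAT2 CAT (dom_2functor CAT \<circ>\<^sub>2 endo Comma)" by (rule bar_two_functor)
next
  fix s :: "'a functor_square" assume "s \<in> C1 CAT2"
  then have s: "s \<in> arrow_cells1 CAT" by simp
  note S = CAT2_cell1D[OF s]
  interpret E: category "Fsrc (dom1 s)" using functor_category S by blast
  interpret B: category "Ftgt (dom1 s)" using functor_category S by blast
  have obj: "upair x (idn (Ftgt (dom1 s)) (Fo (dom1 s) x)) \<in> comma_obj (dom1 s)" if "x \<in> Obj (Fsrc (dom1 s))" for x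
    using functor_obj_comma[OF H_fun_functor[OF S(1)], of "dom1 s" x] that by simp
  have arr: "Fa (H_fun (dom1 s)) a \<in> Arr (comma (dom1 s))" if "a \<in> Arr (Fsrc (dom1 s))" for a
    using functor_arr_comma[OF H_fun_functor[OF S(1)], of "dom1 s" a] that by simp
  have "H_fun (cod1 s) \<circ>\<^sub>F top1 s = bar_fun s \<circ>\<^sub>F H_fun (dom1 s)"
  proof (rule func_eqI)
    fix a assume "a \<in> Arr (Fsrc (H_fun (cod1 s) \<circ>\<^sub>F top1 s))"
    then show "Fa (H_fun (cod1 s) \<circ>\<^sub>F top1 s) a = Fa (bar_fun s \<circ>\<^sub>F H_fun (dom1 s)) a"
      using S arr[of a] obj[of "src (Fsrc (dom1 s)) a"] obj[of "tgt (Fsrc (dom1 s)) a"]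
      by (simp add: H_obj_def)
  qed (use S s obj in simp_all)
  then show "top1 (unit Comma (tgt1 CAT2 s)) \<circ>\<^sub>F on1 (dom_2functor CAT \<circ>\<^sub>2 tfid) s =
        on1 (dom_2functor CAT \<circ>\<^sub>2 endo Comma) s \<circ>\<^sub>F top1 (unit Comma (src1 CAT2 s))"
    by simp
next
  fix c :: "'a nattr_square" and x
  assume "c \<in> C2 CAT2" and x: "x \<in> Obj (on0 (dom_2functor CAT \<circ>\<^sub>2 tfid) (src1 CAT2 (src2 CAT2 c)))"
  then have c: "c \<in> arrow_cells2 CAT" by simp
  note D = CAT2_cell2D[OF c]
  note S = CAT2_cell1D[OF D(1)] CAT2_cell1D[OF D(2)]
  interpret B: category "Ftgt (dom1 (dom2 c))" using functor_category S by blast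
  have x: "x \<in> Obj (Fsrc (dom1 (dom2 c)))" using x by simp
  have "upair x (idn (Ftgt (dom1 (dom2 c))) (Fo (dom1 (dom2 c)) x)) \<in> comma_obj (dom1 (dom2 c))"
    using functor_obj_comma[OF H_fun_functor[OF S(1)], of "dom1 (dom2 c)" x] x by simp
  then show "Fa (top1 (unit Comma (tgt1 CAT2 (src2 CAT2 c)))) (Nc (on2 (dom_2functor CAT \<circ>\<^sub>2 tfid) c) x) =
        Nc (on2 (dom_2functor CAT \<circ>\<^sub>2 endo Comma) c) (Fo (top1 (unit Comma (src1 CAT2 (src2 CAT2 c)))) x)"
    using x D S by (simp add: H_obj_def)
qed (auto simp: C1_CAT)

lemma unit_natural: "two_natural CAT2 CAT2 tfid (endo Comma) (unit Comma)"
proof -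
  have "two_natural CAT2 (arrow_2cat CAT) tfid (endo Comma) (unit Comma)"
  proof (rule arrow_two_naturalI[OF _ _ _ H_natural])
    show "two_functor CAT2 (arrow_2cat CAT) tfid" "two_functor CAT2 (arrow_2cat CAT) (endo Comma)"
      using two_category.tfid[OF CAT2] Comma_endo by (simp_all add: CAT2_def)
    have "two_natural CAT2 CAT (cod_2functor CAT) (cod_2functor CAT) (\<lambda>P. bot1 (unit Comma P))"
      unfolding CAT2_def by (rule two_natural_id[OF two_category.cod_2functor[OF CAT]]) simp
    then show "two_natural CAT2 CAT (cod_2functor CAT \<circ>\<^sub>2 tfid) (cod_2functor CAT \<circ>\<^sub>2 endo Comma)
        (\<lambda>P. bot1 (unit Comma P))"
      by (simp add: tfcomp_def tfid_def cod_2functor_def)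
  qed (use unit_cell in auto)
  then show ?thesis by (simp add: CAT2_def)
qed

text \<open>The bottom functor preserves the composite \<open>v u\<close>. On 2-cells,
  \<open>((x, u), v)\<close> and \<open>(x, v u)\<close> give the same pair of components, because
  \<open>v\<close> and \<open>v u\<close> have the same target.\<close>

lemma M_natural: "two_natural CAT2 CAT (dom_2functor CAT \<circ>\<^sub>2 (endo Comma \<circ>\<^sub>2 endo Comma))
    (dom_2functor CAT \<circ>\<^sub>2 endo Comma) (\<lambda>P. top1 (mult Comma P))"
proof (rule CAT_two_naturalI)
  have "two_functor CAT2 CAT ((dom_2functor CAT \<circ>\<^sub>2 endo Comma) \<circ>\<^sub>2 endo Comma)"
    by (rule tfcomp[OF Comma_endo bar_two_functor])
  then show "two_functor CAT2 CAT (dom_2functor CAT \<circ>\<^sub>2 (endo Comma \<circ>\<^sub>2 endo Comma))"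
    by (simp add: tfcomp_def)
  show "two_functor CAT2 CAT (dom_2functor CAT \<circ>\<^sub>2 endo Comma)" by (rule bar_two_functor)
next
  fix s :: "'a functor_square" assume "s \<in> C1 CAT2"
  then have s: "s \<in> arrow_cells1 CAT" by simp
  note S = CAT2_cell1D[OF s]
  have cs: "comma_fun s \<in> arrow_cells1 CAT" by (rule comma_fun_cell[OF s])
  let ?P = "dom1 s" and ?Q = "cod1 s"
  have obj: "M_obj ?P Z \<in> comma_obj ?P" if "Z \<in> comma_obj (Cod_fun ?P)" for Z
    using functor_obj_comma[OF M_fun_functor[OF S(1)], of ?P Z] that by simp
  have obj': "Fo (bar_fun (comma_fun s)) Z \<in> comma_obj (Cod_fun ?Q)" if "Z \<in> comma_obj (Cod_fun ?P)" for Z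
    using functor_obj_comma[OF bar_fun_functor[OF cs], of "Cod_fun ?Q" Z] that by simp
  have Fo: "M_obj ?Q (Fo (bar_fun (comma_fun s)) Z) = Fo (bar_fun s) (M_obj ?P Z)"
    if Z: "Z \<in> comma_obj (Cod_fun ?P)" for Z
    using Z S obj[OF Z] comma_Cod_objD[OF Z refl refl] by (simp add: M_obj_def)
  have "M_fun ?Q \<circ>\<^sub>F bar_fun (comma_fun s) = bar_fun s \<circ>\<^sub>F M_fun ?P"
  proof (rule func_eqI)
    fix a assume "a \<in> Arr (Fsrc (M_fun ?Q \<circ>\<^sub>F bar_fun (comma_fun s)))"
    then have a: "a \<in> Arr (comma (Cod_fun ?P))" by simp
    note A = comma_Cod_arr[OF a refl refl]
    have "Fa (bar_fun (comma_fun s)) a \<in> Arr (comma (Cod_fun ?Q))"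
      using functor_arr_comma[OF bar_fun_functor[OF cs], of "Cod_fun ?Q" a] a by simp
    moreover have "Fa (M_fun ?P) a \<in> Arr (comma ?P)"
      using functor_arr_comma[OF M_fun_functor[OF S(1)], of ?P a] a by simp
    ultimately show "Fa (M_fun ?Q \<circ>\<^sub>F bar_fun (comma_fun s)) a = Fa (bar_fun s \<circ>\<^sub>F M_fun ?P) a"
      using a A S Fo[OF A(1)] Fo[OF A(2)] by (simp del: bar_fun_simps(3))
  qed (use S s cs obj obj' Fo in \<open>simp_all del: bar_fun_simps(3)\<close>)
  then show "top1 (mult Comma (tgt1 CAT2 s)) \<circ>\<^sub>F on1 (dom_2functor CAT \<circ>\<^sub>2 (endo Comma \<circ>\<^sub>2 endo Comma)) s =
        on1 (dom_2functor CAT \<circ>\<^sub>2 endo Comma) s \<circ>\<^sub>F top1 (mult Comma (src1 CAT2 s))"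
    by simp
next
  fix c :: "'a nattr_square" and Z
  assume "c \<in> C2 CAT2" and Z: "Z \<in> Obj (on0 (dom_2functor CAT \<circ>\<^sub>2 (endo Comma \<circ>\<^sub>2 endo Comma)) (src1 CAT2 (src2 CAT2 c)))"
  then have c: "c \<in> arrow_cells2 CAT" by simp
  note D = CAT2_cell2D[OF c]
  note S = CAT2_cell1D[OF D(1)] CAT2_cell1D[OF D(2)]
  let ?P = "dom1 (dom2 c)" and ?Q = "cod1 (dom2 c)"
  have cc: "comma_nattr c \<in> arrow_cells2 CAT" by (rule comma_nattr_cell[OF c])
  interpret B: category "Ftgt ?P" using functor_category S by blast
  have Z: "Z \<in> comma_obj (Cod_fun ?P)" using Z by simp
  have M: "M_obj ?P Z \<in> comma_obj ?P"
    using functor_obj_comma[OF M_fun_functor[OF S(1)], of ?P Z] Z by simp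
  have N: "Nc (bar_nattr (comma_nattr c)) Z \<in> Arr (comma (Cod_fun ?Q))"
    using nattr_arr_comma[OF bar_nattr_nattr[OF cc], of "Cod_fun ?Q" Z] Z by simp
  show "Fa (top1 (mult Comma (tgt1 CAT2 (src2 CAT2 c))))
      (Nc (on2 (dom_2functor CAT \<circ>\<^sub>2 (endo Comma \<circ>\<^sub>2 endo Comma)) c) Z) =
        Nc (on2 (dom_2functor CAT \<circ>\<^sub>2 endo Comma) c) (Fo (top1 (mult Comma (src1 CAT2 (src2 CAT2 c)))) Z)"
    using Z M N D S comma_Cod_objD[OF Z refl refl] by (simp add: M_obj_def)
qed (auto simp: C1_CAT)

lemma mult_natural: "two_natural CAT2 CAT2 (endo Comma \<circ>\<^sub>2 endo Comma) (endo Comma) (mult Comma)"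
proof -
  have "two_natural CAT2 (arrow_2cat CAT) (endo Comma \<circ>\<^sub>2 endo Comma) (endo Comma) (mult Comma)"
  proof (rule arrow_two_naturalI[OF _ _ _ M_natural])
    show "two_functor CAT2 (arrow_2cat CAT) (endo Comma \<circ>\<^sub>2 endo Comma)" "two_functor CAT2 (arrow_2cat CAT) (endo Comma)"
      using tfcomp[OF Comma_endo Comma_endo] Comma_endo by (simp_all add: CAT2_def)
    have "two_natural CAT2 CAT (cod_2functor CAT) (cod_2functor CAT) (\<lambda>P. bot1 (mult Comma P))"
      unfolding CAT2_def by (rule two_natural_id[OF two_category.cod_2functor[OF CAT]]) simp
    then show "two_natural CAT2 CAT (cod_2functor CAT \<circ>\<^sub>2 (endo Comma \<circ>\<^sub>2 endo Comma)) (cod_2functor CAT \<circ>\<^sub>2 endo Comma)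
        (\<lambda>P. bot1 (mult Comma P))"
      by (simp add: tfcomp_def cod_2functor_def)
  qed (use mult_cell in auto)
  then show ?thesis by (simp add: CAT2_def)
qed

section \<open>Monad laws of the comma 2-monad\<close>

lemma Comma: "two_monad CAT2 Comma"
proof (rule two_monad.intro[OF CAT2], rule two_monad_axioms.intro)
  fix P :: "'a func" assume "P \<in> C0 CAT2"
  then have PC: "P \<in> C1 CAT" by simp
  then have P: "is_functor P" by (simp add: C1_CAT)
  interpret B: category "Ftgt P" using functor_category[OF P] by simp
  interpret E: category "Fsrc P" using functor_category[OF P] by simp
  have uc: "unit Comma P \<in> arrow_cells1 CAT" and mc: "mult Comma P \<in> arrow_cells1 CAT"
    using unit_cell[OF PC] mult_cell[OF PC] .
  \<comment> \<open>The object \<open>(x, u)\<close> goes to \<open>((x, u), 1)\<close> and back to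
    \<open>(x, 1 u)\<close>.\<close>
  have "M_fun P \<circ>\<^sub>F H_fun (Cod_fun P) = fid (comma P)"
  proof (rule func_eqI)
    have obj: "upair X (idn (Ftgt P) (tgt (Ftgt P) (usnd X))) \<in> comma_obj (Cod_fun P)" if "X \<in> comma_obj P" for X
      using functor_obj_comma[OF H_fun_functor[OF Cod_fun_functor[OF P]], of "Cod_fun P" X] that by simp
    show "Fo (M_fun P \<circ>\<^sub>F H_fun (Cod_fun P)) X = Fo (fid (comma P)) X"
      if "X \<in> Obj (Fsrc (M_fun P \<circ>\<^sub>F H_fun (Cod_fun P)))" for X
      using that obj[of X] comma_objD[of X P, OF _ refl refl] by (simp add: M_obj_def)
    show "Fa (M_fun P \<circ>\<^sub>F H_fun (Cod_fun P)) a = Fa (fid (comma P)) a"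
      if "a \<in> Arr (Fsrc (M_fun P \<circ>\<^sub>F H_fun (Cod_fun P)))" for a
    proof -
      have a: "a \<in> Arr (comma P)" using that by simp
      note A = comma_arr[OF a refl refl]
      have "Fa (H_fun (Cod_fun P)) a \<in> Arr (comma (Cod_fun P))"
        using functor_arr_comma[OF H_fun_functor[OF Cod_fun_functor[OF P]], of "Cod_fun P" a] a by simp
      then show ?thesis using a A comma_objD[OF A(1) refl refl] comma_objD[OF A(2) refl refl] comma_arr_surj[OF a]
        by (simp add: M_obj_def H_obj_def)
    qed
  qed (use P in simp_all)
  then show "comp1 CAT2 (mult Comma P) (unit Comma (on0 (endo Comma) P)) = id1 CAT2 (on0 (endo Comma) P)"
    using B.category_axioms by (auto simp: CAT2_def intro!: sq1_eqI)
  \<comment> \<open>Here the identity is inserted on the other side: \<open>(x, u)\<close> goes to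
    \<open>((x, 1), u)\<close> and back to \<open>(x, u 1)\<close>.\<close>
  have "M_fun P \<circ>\<^sub>F bar_fun (unit Comma P) = fid (comma P)"
  proof (rule func_eqI)
    have obj: "Fo (bar_fun (unit Comma P)) X \<in> comma_obj (Cod_fun P)" if "X \<in> comma_obj P" for X
      using functor_obj_comma[OF bar_fun_functor[OF uc], of "Cod_fun P" X] that by simp
    show Fo: "Fo (M_fun P \<circ>\<^sub>F bar_fun (unit Comma P)) X = Fo (fid (comma P)) X"
      if "X \<in> Obj (Fsrc (M_fun P \<circ>\<^sub>F bar_fun (unit Comma P)))" for X
      using that obj[of X] comma_objD[of X P, OF _ refl refl] by (simp add: M_obj_def)
    show "Fa (M_fun P \<circ>\<^sub>F bar_fun (unit Comma P)) a = Fa (fid (comma P)) a"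
      if "a \<in> Arr (Fsrc (M_fun P \<circ>\<^sub>F bar_fun (unit Comma P)))" for a
    proof -
      have a: "a \<in> Arr (comma P)" using that by simp
      note A = comma_arr[OF a refl refl]
      have "Fa (bar_fun (unit Comma P)) a \<in> Arr (comma (Cod_fun P))"
        using functor_arr_comma[OF bar_fun_functor[OF uc], of "Cod_fun P" a] a by simp
      then show ?thesis using a A comma_objD[OF A(1) refl refl] comma_objD[OF A(2) refl refl] comma_arr_surj[OF a]
        by (simp add: M_obj_def H_obj_def)
    qed
  qed (use P uc bar_fun_functor[OF uc] in simp_all)
  then show "comp1 CAT2 (mult Comma P) (on1 (endo Comma) (unit Comma P)) = id1 CAT2 (on0 (endo Comma) P)"
    using B.category_axioms by (auto simp: CAT2_def intro!: sq1_eqI)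
  have "M_fun P \<circ>\<^sub>F M_fun (Cod_fun P) = M_fun P \<circ>\<^sub>F bar_fun (mult Comma P)"
  proof (rule func_eqI)
    let ?CC = "Cod_fun (Cod_fun P)"
    have CP: "is_functor (Cod_fun P)" using P by simp
    have obj: "M_obj (Cod_fun P) Z \<in> comma_obj (Cod_fun P)" "Fo (bar_fun (mult Comma P)) Z \<in> comma_obj (Cod_fun P)"
      if "Z \<in> comma_obj ?CC" for Z
      using functor_obj_comma[OF M_fun_functor[OF CP], of "Cod_fun P" Z]
        functor_obj_comma[OF bar_fun_functor[OF mc], of "Cod_fun P" Z] that by simp_all
    \<comment> \<open>The object \<open>Z\<close> holds three consecutive arrows of the base, and
      the two sides bracket their composite differently.\<close>
    have Fo: "M_obj P (M_obj (Cod_fun P) Z) = M_obj P (Fo (bar_fun (mult Comma P)) Z)"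
      if Z: "Z \<in> comma_obj ?CC" for Z
    proof -
      note o = comma_Cod_objD[OF Z refl refl]
      note o' = comma_Cod_objD[OF o(1) refl refl]
      show ?thesis using Z o o' by (simp add: M_obj_def B.assoc)
    qed
    show "Fo (M_fun P \<circ>\<^sub>F M_fun (Cod_fun P)) Z = Fo (M_fun P \<circ>\<^sub>F bar_fun (mult Comma P)) Z"
      if "Z \<in> Obj (Fsrc (M_fun P \<circ>\<^sub>F M_fun (Cod_fun P)))" for Z
      using that obj[of Z] Fo[of Z] by (simp del: bar_fun_simps(3))
    show "Fa (M_fun P \<circ>\<^sub>F M_fun (Cod_fun P)) a = Fa (M_fun P \<circ>\<^sub>F bar_fun (mult Comma P)) a"
      if "a \<in> Arr (Fsrc (M_fun P \<circ>\<^sub>F M_fun (Cod_fun P)))" for a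
    proof -
      have a: "a \<in> Arr (comma ?CC)" using that by simp
      note A = comma_Cod_arr[OF a refl refl]
      have "Fa (M_fun (Cod_fun P)) a \<in> Arr (comma (Cod_fun P))" "Fa (bar_fun (mult Comma P)) a \<in> Arr (comma (Cod_fun P))"
        using functor_arr_comma[OF M_fun_functor[OF CP], of "Cod_fun P" a]
          functor_arr_comma[OF bar_fun_functor[OF mc], of "Cod_fun P" a] a by simp_all
      then show ?thesis using a A Fo[OF A(1)] Fo[OF A(2)]
        by (simp del: bar_fun_simps(3))
    qed
  qed (use P mc bar_fun_functor[OF mc] in simp_all)
  then show "comp1 CAT2 (mult Comma P) (mult Comma (on0 (endo Comma) P)) =
         comp1 CAT2 (mult Comma P) (on1 (endo Comma) (mult Comma P))"
    by (auto simp: CAT2_def intro!: sq1_eqI)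
qed (use unit_natural mult_natural in simp_all)


section \<open>The comparison functors\<close>

lemma kappa_simps [simp]:
  "Fsrc (kappa P) = arrow_cat (Fsrc P)" "Ftgt (kappa P) = comma P"
  "f \<in> Arr (Fsrc P) \<Longrightarrow> Fo (kappa P) f = upair (src (Fsrc P) f) (Fa P f)"
  "a \<in> Arr (arrow_cat (Fsrc P)) \<Longrightarrow> Fa (kappa P) a =
    parr (Fo (kappa P) (psrc a)) (Fo (kappa P) (ptgt a)) (pfst a) (Fa P (psnd a))"
  by (simp_all add: kappa_def kappa_obj_def Let_def arrow_cat_arr)

lemma kappa_functor [simp]:
  assumes P: "is_functor P"
  shows "is_functor (kappa P)"
proof -
  let ?E = "Fsrc P"
  interpret E: category "Fsrc P" using functor_category[OF P] by simp
  interpret B: category "Ftgt P" using functor_category[OF P] by simp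
  interpret pair_category "Fsrc P" "Ftgt P" ufst "\<lambda>X. tgt (Ftgt P) (usnd X)" "comma_obj P" "Arr (comma P)"
      "\<lambda>X Y f v. cmp (Ftgt P) v (usnd X) = cmp (Ftgt P) (usnd Y) (Fa P f)"
    using P by (intro pair_category_comma)
  show ?thesis
  proof (rule functorI[where A = "arrow_cat ?E" and u = pfst and v = "\<lambda>a. Fa P (psnd a)"])
    fix a assume "a \<in> Arr (arrow_cat ?E)"
    note a = this arrow_cat_arr[OF this]
    \<comment> \<open>The commutation condition for the pair \<open>(r, P s)\<close> is the image
      under \<open>P\<close> of \<open>s f = g r\<close>.\<close>
    have "Fa P (cmp ?E (psnd a) (psrc a)) = Fa P (cmp ?E (ptgt a) (pfst a))"
      using a by simp
    then show "cmp (Ftgt P) (Fa P (psnd a)) (usnd (Fo (kappa P) (src (arrow_cat ?E) a))) =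
       cmp (Ftgt P) (usnd (Fo (kappa P) (tgt (arrow_cat ?E) a))) (Fa P (pfst a))"
      using P a(1-9) by simp
  qed (use P E.category_axioms comma_pair_cat in \<open>auto simp: arrow_cat_arr(1-8) comma_obj_upair\<close>,
       auto simp: kappa_def Let_def)
qed

section \<open>The unit and multiplication equations for \<open>kappa\<close>\<close>

lemma kappa_unit:
  assumes P: "is_functor P"
  shows "kappa P \<circ>\<^sub>F I_fun (Fsrc P) = H_fun P"
proof (rule func_eqI)
  interpret E: category "Fsrc P" using functor_category[OF P] by simp
  show "is_functor (kappa P \<circ>\<^sub>F I_fun (Fsrc P))" "is_functor (H_fun P)" using P E.category_axioms by simp_all
  show "Fa (kappa P \<circ>\<^sub>F I_fun (Fsrc P)) f = Fa (H_fun P) f" if "f \<in> Arr (Fsrc (kappa P \<circ>\<^sub>F I_fun (Fsrc P)))" for f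
    using that P functor_arr_arrow_cat[of "I_fun (Fsrc P)" "Fsrc P" f] E.category_axioms by (simp add: H_obj_def)
qed (use P functor_category[OF P] in \<open>auto simp: category.idn_simps\<close>)

text \<open>A square \<open>(r, s)\<close> from \<open>f\<close> to \<open>g\<close>, with
  \<open>f\<close> starting at \<open>x\<close>, becomes the arrow \<open>(r, P s)\<close> out of
  \<open>(x, P f)\<close>, then the object \<open>((x, P f), P s)\<close>, then
  \<open>(x, (P s) (P f))\<close>. By functoriality of \<open>P\<close> this is the image
  \<open>(x, P (s f))\<close> of the diagonal.\<close>

lemma kappa_mult:
  assumes P: "is_functor P"
  shows "kappa P \<circ>\<^sub>F m_fun (Fsrc P) = M_fun P \<circ>\<^sub>F kappa (Cod_fun P) \<circ>\<^sub>F arrow_fun (kappa P)"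
proof (rule func_eqI)
  let ?E = "Fsrc P"
  interpret E: category ?E using functor_category[OF P] by simp
  have Fo: "Fo (kappa P) (cmp ?E (psnd z) (psrc z)) = M_obj P (Fo (kappa (Cod_fun P)) (Fa (kappa P) z))"
    and Fa: "Fa (kappa P) z \<in> Arr (comma P)"
    and obj: "Fo (kappa (Cod_fun P)) (Fa (kappa P) z) \<in> comma_obj (Cod_fun P)" if z: "z \<in> Arr (arrow_cat ?E)" for z
  proof -
    show Fa: "Fa (kappa P) z \<in> Arr (comma P)"
      using functor_arr_comma[OF kappa_functor[OF P], of P z] z by simp
    then show "Fo (kappa (Cod_fun P)) (Fa (kappa P) z) \<in> comma_obj (Cod_fun P)"
      using functor_obj_comma[OF kappa_functor[OF Cod_fun_functor[OF P]], of "Cod_fun P"] by simp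
    show "Fo (kappa P) (cmp ?E (psnd z) (psrc z)) = M_obj P (Fo (kappa (Cod_fun P)) (Fa (kappa P) z))"
      using z P Fa arrow_cat_arr(1-8)[OF z] by (simp add: M_obj_def)
  qed
  show "is_functor (kappa P \<circ>\<^sub>F m_fun ?E)" "is_functor (M_fun P \<circ>\<^sub>F kappa (Cod_fun P) \<circ>\<^sub>F arrow_fun (kappa P))"
    using P E.category_axioms by simp_all
  show "Fo (kappa P \<circ>\<^sub>F m_fun ?E) z = Fo (M_fun P \<circ>\<^sub>F kappa (Cod_fun P) \<circ>\<^sub>F arrow_fun (kappa P)) z"
    if "z \<in> Obj (Fsrc (kappa P \<circ>\<^sub>F m_fun ?E))" for z
    using that Fo[of z] obj[of z] Fa[of z] by (simp del: kappa_simps(3,4))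
  show "Fa (kappa P \<circ>\<^sub>F m_fun ?E) a = Fa (M_fun P \<circ>\<^sub>F kappa (Cod_fun P) \<circ>\<^sub>F arrow_fun (kappa P)) a"
    if "a \<in> Arr (Fsrc (kappa P \<circ>\<^sub>F m_fun ?E))" for a
  proof -
    have a: "a \<in> Arr (arrow_cat (arrow_cat ?E))" using that by simp
    note A = arrow_cat_arr[OF a] arrow_cat2_arr[OF a]
    have m: "Fa (m_fun ?E) a \<in> Arr (arrow_cat ?E)" using functor_arr_arrow_cat[of "m_fun ?E" ?E a] a E.category_axioms by simp
    have k2: "Fa (arrow_fun (kappa P)) a \<in> Arr (arrow_cat (comma P))"
      using functor_arr_arrow_cat[of "arrow_fun (kappa P)" "comma P" a] a P by simp
    have k3: "Fa (kappa (Cod_fun P)) (Fa (arrow_fun (kappa P)) a) \<in> Arr (comma (Cod_fun P))"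
      using functor_arr_comma[OF kappa_functor[OF Cod_fun_functor[OF P]], of "Cod_fun P" "Fa (arrow_fun (kappa P)) a"] k2 by simp
    have l: "Fa (kappa P) (Fa (m_fun ?E) a) =
        parr (Fo (kappa P) (cmp ?E (psnd (psrc a)) (psrc (psrc a)))) (Fo (kappa P) (cmp ?E (psnd (ptgt a)) (psrc (ptgt a))))
          (pfst (pfst a)) (Fa P (psnd (psnd a)))"
      using m a by (simp del: kappa_simps(3))
    \<comment> \<open>The deleted rules keep the endpoints folded, so that the object equation
      \<open>Fo\<close> can identify them at the end. The two arrow components, at the initial and
      the terminal vertex, are computed separately below.\<close>
    have "Fa (M_fun P) (Fa (kappa (Cod_fun P)) (Fa (arrow_fun (kappa P)) a)) =
       parr (M_obj P (Fo (kappa (Cod_fun P)) (Fa (kappa P) (psrc a)))) (M_obj P (Fo (kappa (Cod_fun P)) (Fa (kappa P) (ptgt a))))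
         (pfst (pfst (Fa (arrow_fun (kappa P)) a))) (Fa (Cod_fun P) (psnd (Fa (arrow_fun (kappa P)) a)))"
      using k2 k3 a by (simp del: kappa_simps(3) kappa_simps(4)[of _ P] Cod_fun_simps(4))
    also have "pfst (pfst (Fa (arrow_fun (kappa P)) a)) = pfst (pfst a)"
      using a A by (simp del: kappa_simps(3))
    also have "Fa (Cod_fun P) (psnd (Fa (arrow_fun (kappa P)) a)) = Fa P (psnd (psnd a))"
      using a A Fa[of "psnd a"] by (simp del: kappa_simps(3))
    finally show ?thesis using l Fo[OF A(1)] Fo[OF A(2)] a k2 by
      (simp del: kappa_simps(3,4) arrow_fun_simps(4) M_fun_simps(4) m_fun_simps(4))
  qed
qed simp_all

lemma Dom_simps [simp]: "on0 Dom = Fsrc" "on1 Dom = top1" "on2 Dom = top2"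
  by (simp_all add: Dom_def dom_2functor_def)

section \<open>2-naturality of \<open>kappa\<close> and the colax morphism\<close>

text \<open>At \<open>f\<close> from \<open>x\<close> to \<open>y\<close>, the 1-cell condition
  compares \<open>(T x, Q T f)\<close> with \<open>(T x, S P f)\<close>, equal because
  \<open>Q T = S P\<close>. The 2-cell condition compares the pairs
  \<open>(beta_x, Q beta_y)\<close> and \<open>(beta_x, alpha_(P y))\<close>, equal because
  \<open>Q beta = alpha P\<close>.\<close>

lemma kappa_natural: "two_natural CAT2 CAT (endo Squaring \<circ>\<^sub>2 Dom) (Dom \<circ>\<^sub>2 endo Comma) kappa"
proof (rule CAT_two_naturalI)
  show "two_functor CAT2 CAT (endo Squaring \<circ>\<^sub>2 Dom)" by (rule tfcomp[OF Dom Squaring_endo])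
  show "two_functor CAT2 CAT (Dom \<circ>\<^sub>2 endo Comma)" by (rule tfcomp[OF Comma_endo Dom])
next
  fix s :: "'a functor_square" assume "s \<in> C1 CAT2"
  then have s: "s \<in> arrow_cells1 CAT" by simp
  note S = CAT2_cell1D[OF s]
  let ?P = "dom1 s" and ?Q = "cod1 s"
  have Fo: "Fo (kappa ?Q) (Fa (top1 s) f) = Fo (bar_fun s) (Fo (kappa ?P) f)"
    and obj: "Fo (kappa ?P) f \<in> comma_obj ?P" if f: "f \<in> Arr (Fsrc ?P)" for f
  proof -
    show "Fo (kappa ?P) f \<in> comma_obj ?P"
      using functor_obj_comma[OF kappa_functor[OF S(1)], of ?P f] f by simp
    then show "Fo (kappa ?Q) (Fa (top1 s) f) = Fo (bar_fun s) (Fo (kappa ?P) f)"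
      using f S by simp
  qed
  have "kappa ?Q \<circ>\<^sub>F arrow_fun (top1 s) = bar_fun s \<circ>\<^sub>F kappa ?P"
  proof (rule func_eqI)
    fix a assume "a \<in> Arr (Fsrc (kappa ?Q \<circ>\<^sub>F arrow_fun (top1 s)))"
    then have a: "a \<in> Arr (arrow_cat (Fsrc ?P))" using S by simp
    note A = arrow_cat_arr(1-8)[OF a]
    have "Fa (arrow_fun (top1 s)) a \<in> Arr (arrow_cat (Fsrc ?Q))"
      using functor_arr_arrow_cat[of "arrow_fun (top1 s)" "Fsrc ?Q" a] a S by simp
    moreover have "Fa (kappa ?P) a \<in> Arr (comma ?P)"
      using functor_arr_comma[OF kappa_functor[OF S(1)], of ?P a] a by simp
    ultimately show "Fa (kappa ?Q \<circ>\<^sub>F arrow_fun (top1 s)) a = Fa (bar_fun s \<circ>\<^sub>F kappa ?P) a"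
      using a A S Fo[OF A(1)] Fo[OF A(2)] by (simp del: kappa_simps(3) bar_fun_simps(3))
  qed (use S s Fo in \<open>simp_all del: kappa_simps(3) bar_fun_simps(3)\<close>)
  then show "kappa (tgt1 CAT2 s) \<circ>\<^sub>F on1 (endo Squaring \<circ>\<^sub>2 Dom) s =
        on1 (Dom \<circ>\<^sub>2 endo Comma) s \<circ>\<^sub>F kappa (src1 CAT2 s)"
    by simp
next
  fix c :: "'a nattr_square" and f
  assume "c \<in> C2 CAT2" and f: "f \<in> Obj (on0 (endo Squaring \<circ>\<^sub>2 Dom) (src1 CAT2 (src2 CAT2 c)))"
  then have c: "c \<in> arrow_cells2 CAT" by simp
  note D = CAT2_cell2D[OF c]
  note S = CAT2_cell1D[OF D(1)] CAT2_cell1D[OF D(2)]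
  let ?P = "dom1 (dom2 c)" and ?Q = "cod1 (dom2 c)"
  interpret E: category "Fsrc ?P" using functor_category S by blast
  have f: "f \<in> Arr (Fsrc ?P)" using f by simp
  have "Fo (kappa ?P) f \<in> comma_obj ?P"
    using functor_obj_comma[OF kappa_functor[OF S(1)], of ?P f] f by simp
  moreover have "Nc (arrow_nattr (top2 c)) f \<in> Arr (arrow_cat (Fsrc ?Q))"
    using nattr_arr(1)[OF arrow_nattr_nattr[OF D(5)], of "arrow_cat (Fsrc ?Q)" f] f D S by simp
  ultimately show "Fa (kappa (tgt1 CAT2 (src2 CAT2 c))) (Nc (on2 (endo Squaring \<circ>\<^sub>2 Dom) c) f) =
        Nc (on2 (Dom \<circ>\<^sub>2 endo Comma) c) (Fo (kappa (src1 CAT2 (src2 CAT2 c))) f)"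
    using f D S by simp
qed (auto simp: C1_CAT)

lemma kappa_colax: "colax_morphism CAT2 Comma CAT Squaring Dom kappa"
proof (intro colax_morphism.intro colax_morphism_axioms.intro)
  fix P :: "'a func" assume "P \<in> C0 CAT2"
  then have P: "is_functor P" by (simp add: C1_CAT)
  show "comp1 CAT (kappa P) (unit Squaring (on0 Dom P)) = on1 Dom (unit Comma P)"
    using kappa_unit[OF P] by simp
  show "comp1 CAT (kappa P) (mult Squaring (on0 Dom P)) =
      comp1 CAT (on1 Dom (mult Comma P))
       (comp1 CAT (kappa (on0 (endo Comma) P)) (on1 (endo Squaring) (kappa P)))"
    using kappa_mult[OF P] by simp
qed (use Comma Squaring Dom kappa_natural in simp_all)

theorem proposition6p4:
  shows "two_natural (CAT2 :: ('u::universe func, 'u functor_square, 'u nattr_square) twocat) CAT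
      (endo Squaring \<circ>\<^sub>2 Dom) (Dom \<circ>\<^sub>2 endo Comma) kappa
    \<and> (\<forall>(P :: 'u func) \<in> C0 CAT2.
        kappa P \<circ>\<^sub>F I_fun (Fsrc P) = H_fun P \<and>
        kappa P \<circ>\<^sub>F m_fun (Fsrc P) = M_fun P \<circ>\<^sub>F kappa (Cod_fun P) \<circ>\<^sub>F arrow_fun (kappa P))
    \<and> colax_morphism (CAT2 :: ('u func, 'u functor_square, 'u nattr_square) twocat) Comma
        CAT Squaring Dom kappa
    \<and> (\<forall>(P :: 'u func) a. strict_algebra CAT2 Comma P a \<longrightarrow>
        strict_algebra CAT Squaring (on0 Dom P) (pullback_action CAT Dom kappa P a))"
  using kappa_natural kappa_unit kappa_mult kappa_colax
    colax_morphism.strict_algebra_pullback[OF kappa_colax]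
  by (auto simp: C1_CAT)

end
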